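(* Let $1\le p\le n$ be integers with $p\geq\frac n2$, let $\Omega\subset\mathbb{R}^n$ be a bounded domain, let $v$ be a $C^2$ $p$-plurisubharmonic function on $\bar\Omega$, and let $f\in C^2(\bar\Omega\times\mathbb{R}\times\mathbb{R}^n)$ be a positive function. Suppose that a $p$-plurisubharmonic function $u\in C^4(\Omega)\cap C^{1,1}(\bar\Omega)$ is a solution to the Dirichlet problem $$\prod_{1\leq i_1<\cdots<i_p\leq n}(\lambda_{i_1}+\cdots+\lambda_{i_p})=f(x,u,Du)\ \text{ in }\Omega,\qquad u=v\ \text{ on }\partial\Omega,$$ where $(\lambda_1,\dots,\lambda_n)=\lambda(D^2u)$ are the eigenvalues of the Hessian $D^2u$, and that $u<v$ in $\Omega$. Then there exist constants $C$ and $\beta$, depending only on $n$, $p$, $|u|_{C^1}$, $|v|_{C^1}$, $\inf f$, $|f|_{C^2}$ and $\Omega$, such that $$\sup_\Omega\,(v-u)^\beta\,\Delta u\leq C.$$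
   Context: A $C^2$ function $w$ is called $p$-plurisubharmonic if the eigenvalues $\lambda_1,\dots,\lambda_n$ of its Hessian $D^2w$ satisfy $\lambda_{i_1}+\cdots+\lambda_{i_p}\geq 0$ for all $1\leq i_1<\cdots<i_p\leq n$ at every point. *)

theory Defs
  imports "HOL-Analysis.Analysis" "HOL-Computational_Algebra.Computational_Algebra"
begin

definition partial_deriv :: "'a::euclidean_space \<Rightarrow> ('a \<Rightarrow> real) \<Rightarrow> 'a \<Rightarrow> real" where
  "partial_deriv e g x = frechet_derivative g (at x) e"

text \<open>The list of directions plays the role of a multi-index; a mixed partial derivative is
  listed once for each order of differentiation.\<close>

definition iter_partial :: "'a::euclidean_space list \<Rightarrow> ('a \<Rightarrow> real) \<Rightarrow> 'a \<Rightarrow> real" where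
  "iter_partial es g = foldr partial_deriv es g"

definition dirs_le :: "nat \<Rightarrow> 'a::euclidean_space list set" where
  "dirs_le k = {es. set es \<subseteq> Basis \<and> length es \<le> k}"

text \<open>The space \<open>C\<^sup>k(U)\<close>, for open \<open>U\<close>.  Differentiability in the Frechet sense of the derivatives
  of order below \<open>k\<close> is no restriction, since all partial derivatives up to order \<open>k\<close> are continuous.\<close>

definition Ck_on :: "nat \<Rightarrow> 'a::euclidean_space set \<Rightarrow> ('a \<Rightarrow> real) \<Rightarrow> bool" where
  "Ck_on k U g \<longleftrightarrow>
     (\<forall>es\<in>dirs_le k. continuous_on U (iter_partial es g)) \<and>
     (\<forall>es\<in>dirs_le k. length es < k \<longrightarrow> (\<forall>x\<in>U. iter_partial es g differentiable (at x)))"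

text \<open>The space of functions of class \<open>C\<^sup>k\<close> on the closure of the open set \<open>U\<close>: all derivatives up to
  order \<open>k\<close>, taken in \<open>U\<close>, extend continuously to the closure.\<close>

definition Ck_closure :: "nat \<Rightarrow> 'a::euclidean_space set \<Rightarrow> ('a \<Rightarrow> real) \<Rightarrow> bool" where
  "Ck_closure k U g \<longleftrightarrow>
     Ck_on k U g \<and> continuous_on (closure U) g \<and>
     (\<forall>es\<in>dirs_le k. \<exists>h. continuous_on (closure U) h \<and> (\<forall>x\<in>U. h x = iter_partial es g x))"

definition C11_closure :: "'a::euclidean_space set \<Rightarrow> ('a \<Rightarrow> real) \<Rightarrow> bool" where
  "C11_closure U g \<longleftrightarrow>
     Ck_closure 1 U g \<and> (\<forall>e\<in>Basis. \<exists>L. L-lipschitz_on U (partial_deriv e g))"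

text \<open>The suprema are meant for functions whose derivatives up to order \<open>k\<close> are bounded on the
  nonempty set \<open>S\<close>.\<close>

definition Ck_norm :: "nat \<Rightarrow> 'a::euclidean_space set \<Rightarrow> ('a \<Rightarrow> real) \<Rightarrow> real" where
  "Ck_norm k S g = (\<Sum>es\<in>dirs_le k. SUP x\<in>S. \<bar>iter_partial es g x\<bar>)"

definition grad :: "(real^'n \<Rightarrow> real) \<Rightarrow> real^'n \<Rightarrow> real^'n" where
  "grad w x = (\<chi> i. partial_deriv (axis i 1) w x)"

definition hessian :: "(real^'n \<Rightarrow> real) \<Rightarrow> real^'n \<Rightarrow> real^'n^'n" where
  "hessian w x = (\<chi> i j. partial_deriv (axis i 1) (partial_deriv (axis j 1) w) x)"

definition laplacian :: "(real^'n \<Rightarrow> real) \<Rightarrow> real^'n \<Rightarrow> real" where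
  "laplacian w x = trace (hessian w x)"

definition charpoly :: "real^'n^'n \<Rightarrow> real poly" where
  "charpoly A = det (\<chi> i j. if i = j then [:- A $ i $ j, 1:] else [:- A $ i $ j:])"

text \<open>The real eigenvalues in increasing order, repeated according to algebraic multiplicity; for
  a symmetric \<open>n \<times> n\<close> matrix this list has length \<open>n\<close>.\<close>

definition eigvals :: "real^'n^'n \<Rightarrow> real list" where
  "eigvals A = sorted_list_of_multiset (proots (charpoly A))"

text \<open>An index tuple \<open>i\<^sub>1 < \<dots> < i\<^sub>p\<close> is represented by the set of its entries, with indices
  starting at 0.\<close>

definition index_sets :: "nat \<Rightarrow> nat \<Rightarrow> nat set set" where
  "index_sets n p = {I. I \<subseteq> {..<n} \<and> card I = p}"

definition p_psh_on :: "nat \<Rightarrow> (real^'n) set \<Rightarrow> (real^'n \<Rightarrow> real) \<Rightarrow> bool" where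
  "p_psh_on p U w \<longleftrightarrow>
     Ck_on 2 U w \<and>
     (\<forall>x\<in>U. \<forall>I\<in>index_sets CARD('n) p. (\<Sum>i\<in>I. eigvals (hessian w x) ! i) \<ge> 0)"

definition p_sum_prod :: "nat \<Rightarrow> real^'n^'n \<Rightarrow> real" where
  "p_sum_prod p A = (\<Prod>I\<in>index_sets CARD('n) p. \<Sum>i\<in>I. eigvals A ! i)"

text \<open>The values \<open>(x, z, q)\<close> over which \<open>inf f\<close> and the norm of \<open>f\<close> are taken. On all of
  \<open>\<Omega> \<times> \<real> \<times> \<real>\<^sup>n\<close> a positive \<open>C\<^sup>2\<close> function \<open>f\<close> may have infimum zero and infinite norm; here \<open>M\<close> is
  a bound for \<open>\<bar>u\<bar>\<close> and \<open>\<bar>Du\<bar>\<close>, so the set contains all \<open>(x, u(x), Du(x))\<close>.\<close>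

definition jet_range :: "(real^'n) set \<Rightarrow> real \<Rightarrow> ((real^'n) \<times> real \<times> (real^'n)) set" where
  "jet_range \<Omega> M = \<Omega> \<times> {-M..M} \<times> cball 0 M"

end

theory Submission
  imports Defs
begin

text \<open>
The bound comes from the maximum principle.  Let \<open>w = v - u\<close> and let \<open>\<lambda>\<^sub>0 \<le> \<dots> \<le> \<lambda>\<^sub>m\<close>, \<open>m = n - 1\<close>, be the
eigenvalues of \<open>D\<^sup>2u\<close>.  Among all points and all unit vectors \<open>e\<close>, maximise
\<open>\<beta> ln w + ln u\<^sub>e\<^sub>e - 1/3 ln (c - |Du|\<^sup>2/2) + A |x|\<^sup>2/2\<close>.
The maximum exists in the interior, because \<open>w\<close> vanishes on the boundary while \<open>D\<^sup>2u\<close> stays bounded,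
and there \<open>e\<close> may be taken to be an eigenvector for \<open>\<lambda>\<^sub>m\<close>.  If \<open>\<lambda>\<^sub>m \<le> M (1 + 1/w)\<close> is shown at this one point, with
\<open>M\<close> depending on the data only, then \<open>w\<^sup>\<beta> \<lambda>\<^sub>m\<close> is bounded there, and hence \<open>w\<^sup>\<beta> D\<^sup>2u\<close> is bounded from above
everywhere.

For a set \<open>I\<close> of \<open>p\<close> indices let \<open>\<lambda>\<^sub>I\<close> be the sum of its eigenvalues, and let \<open>L\<^sub>i\<close> be the sum of
\<open>1/\<lambda>\<^sub>I\<close> over the sets \<open>I\<close> containing \<open>i\<close>, which is the derivative of \<open>\<Sum>\<^sub>I ln \<lambda>\<^sub>I\<close> with respect to \<open>\<lambda>\<^sub>i\<close>.
Information on the third and fourth derivatives of \<open>u\<close> comes from a barrier: \<open>ln_p_sum_prod_le_tangent\<close>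
bounds \<open>ln \<Prod>\<^sub>I \<mu>\<^sub>I\<close>, for any symmetric matrix \<open>B\<close> whose eigenvalues \<open>\<mu>\<close> have positive
sums \<open>\<mu>\<^sub>I\<close>, by the tangent expression
\<open>\<Sum>\<^sub>I ln \<lambda>\<^sub>I + \<Sum>\<^sub>i L\<^sub>i (\<langle>q\<^sub>i, B q\<^sub>i\<rangle> - \<lambda>\<^sub>i)\<close> for every orthonormal frame \<open>q\<close>.  There is equality at the maximum
point for the eigenframe, so differentiating twice along a frame that rotates with the point gives
both the differentiated equation and, with a good choice of the rotation, the quadratic terms in the third
derivatives (\<open>second_derivative_inequality\<close>).  Combined with the first and second order conditions at
the maximum this yields one scalar inequality (\<open>maximum_principle\<close>).

The rest is algebra on that inequality (the locale \<open>critical_inequality\<close>).  The term to be beaten is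
\<open>C \<lambda>\<^sub>m\<close>, caused by the second derivatives of \<open>f\<close> in the gradient variable, together with
\<open>\<Sum>\<^sub>i L\<^sub>i a\<^sub>i\<^sup>2\<close>, where \<open>a\<^sub>i\<close> is the logarithmic derivative of \<open>u\<^sub>e\<^sub>e\<close>.
If \<open>\<lambda>\<^sub>0 < - \<lambda>\<^sub>m/(4n)\<close>, then \<open>L\<^sub>0 \<lambda>\<^sub>0\<^sup>2\<close>, which is at least a constant times \<open>\<lambda>\<^sub>m\<^sup>2 \<Sum>\<^sub>i L\<^sub>i\<close>, dominates everything, and the
\<open>a\<^sub>i\<close> are simply eliminated by the first order condition.  Otherwise every \<open>\<lambda>\<^sub>I\<close> with \<open>m \<in> I\<close> is at least
\<open>\<lambda>\<^sub>m/2\<close>.  The part of \<open>L\<^sub>i\<close> coming from small \<open>\<lambda>\<^sub>I\<close> is then controlled by the third derivative terms, and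
the remaining part is at most a constant times \<open>1/\<lambda>\<^sub>m\<close>.  This is the place where \<open>p \<ge> n/2\<close> enters: at
least half of all index sets contain \<open>m\<close>, and since the product of all \<open>\<lambda>\<^sub>I\<close> is bounded, some \<open>\<lambda>\<^sub>I\<close> has to
be as small as a constant times \<open>1/\<lambda>\<^sub>m\<close>.  Hence \<open>\<Sum>\<^sub>i L\<^sub>i \<ge> c\<^sub>0 \<lambda>\<^sub>m\<close> (\<open>inverse_sum_ge_top\<close>), and the term
\<open>A \<Sum>\<^sub>i L\<^sub>i\<close> contributed by \<open>A |x|\<^sup>2/2\<close> wins over \<open>C \<lambda>\<^sub>m\<close> once \<open>A\<close> is large.  For \<open>p = n\<close> the equation
itself says \<open>\<Delta>u = f\<close>.
\<close>

section \<open>Derivatives in arbitrary directions\<close>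

abbreviation pd :: "'a::euclidean_space \<Rightarrow> ('a \<Rightarrow> real) \<Rightarrow> 'a \<Rightarrow> real" where
  "pd \<equiv> partial_deriv"

text \<open>All directions are allowed, not only the coordinate ones, since the derivatives needed later are taken along an
eigenframe of the Hessian.\<close>

fun Ck_dir :: "nat \<Rightarrow> 'a::euclidean_space set \<Rightarrow> ('a \<Rightarrow> real) \<Rightarrow> bool" where
  "Ck_dir 0 U g \<longleftrightarrow> continuous_on U g"
| "Ck_dir (Suc k) U g \<longleftrightarrow>
     (\<forall>x\<in>U. g differentiable (at x)) \<and> (\<forall>e. Ck_dir k U (pd e g))"

lemma frechet_derivative_cong_open:
  assumes "open U" "x \<in> U" "\<And>z. z \<in> U \<Longrightarrow> g z = g' z"
  shows "frechet_derivative g (at x) = frechet_derivative g' (at x)"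
proof -
  have "(g has_derivative D) (at x) \<longleftrightarrow> (g' has_derivative D) (at x)" for D
    using has_derivative_transform_within_open[of g D x UNIV U g'] 
      has_derivative_transform_within_open[of g' D x UNIV U g] assms by auto
  then show ?thesis unfolding frechet_derivative_def by simp
qed

lemma partial_deriv_cong_open:
  assumes "open U" "x \<in> U" "\<And>z. z \<in> U \<Longrightarrow> g z = g' z"
  shows "pd e g x = pd e g' x"
  unfolding partial_deriv_def using frechet_derivative_cong_open[OF assms] by simp

lemma Ck_dir_cong:
  assumes "open U" "\<And>z. z \<in> U \<Longrightarrow> g z = g' z" "Ck_dir k U g"
  shows "Ck_dir k U g'"
  using assms(2,3)
proof (induction k arbitrary: g g')
  case 0
  then show ?case using continuous_on_cong[of U U g g'] by simp
next
  case (Suc k)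
  have "g' differentiable (at x)" if "x \<in> U" for x
  proof -
    have "g differentiable (at x)" using Suc.prems(2) that by simp
    then obtain D where "(g has_derivative D) (at x)"
      unfolding differentiable_def by blast
    then have "(g' has_derivative D) (at x)"
      using has_derivative_transform_within_open[of g D x UNIV U g'] assms(1) that Suc.prems(1)
      by auto
    then show ?thesis unfolding differentiable_def by blast
  qed
  moreover have "Ck_dir k U (pd e g')" for e
  proof (rule Suc.IH[of "pd e g"])
    show "pd e g z = pd e g' z" if "z \<in> U" for z
      by (rule partial_deriv_cong_open[OF assms(1) that Suc.prems(1)])
  qed (use Suc.prems in simp)
  ultimately show ?case by simp
qed

lemma partial_deriv_sum:
  assumes "\<And>i. i \<in> I \<Longrightarrow> g i differentiable (at x)"
  shows "pd e (\<lambda>x. \<Sum>i\<in>I. c i * g i x) x = (\<Sum>i\<in>I. c i * pd e (g i) x)"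
proof -
  have "((\<lambda>x. \<Sum>i\<in>I. c i * g i x) has_derivative
      (\<lambda>h. \<Sum>i\<in>I. c i * frechet_derivative (g i) (at x) h)) (at x)"
    using assms by (intro derivative_eq_intros) (auto simp: frechet_derivative_works)
  from fun_cong[OF frechet_derivative_at[OF this], of e] show ?thesis
    unfolding partial_deriv_def by (rule sym)
qed

lemma Ck_dir_sum:
  assumes "open U" "\<And>i. i \<in> I \<Longrightarrow> Ck_dir k U (g i)"
  shows "Ck_dir k U (\<lambda>x. \<Sum>i\<in>I. c i * g i x)"
  using assms(2)
proof (induction k arbitrary: g)
  case 0
  then show ?case by (simp add: continuous_on_sum continuous_on_mult)
next
  case (Suc k)
  have d: "g i differentiable (at x)" if "i \<in> I" "x \<in> U" for i x
    using Suc.prems that by auto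
  have "(\<lambda>x. \<Sum>i\<in>I. c i * g i x) differentiable (at x)" if "x \<in> U" for x
  proof -
    have "((\<lambda>x. \<Sum>i\<in>I. c i * g i x) has_derivative
        (\<lambda>h. \<Sum>i\<in>I. c i * frechet_derivative (g i) (at x) h)) (at x)"
      using d that by (intro derivative_eq_intros) (auto simp: frechet_derivative_works)
    then show ?thesis unfolding differentiable_def by blast
  qed
  moreover have "Ck_dir k U (pd e (\<lambda>x. \<Sum>i\<in>I. c i * g i x))" for e
  proof (rule Ck_dir_cong[OF assms(1)])
    show "Ck_dir k U (\<lambda>x. \<Sum>i\<in>I. c i * pd e (g i) x)"
      by (rule Suc.IH) (use Suc.prems in auto)
    show "(\<Sum>i\<in>I. c i * pd e (g i) z) = pd e (\<lambda>x. \<Sum>i\<in>I. c i * g i x) z"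
      if "z \<in> U" for z
      by (rule partial_deriv_sum[symmetric]) (rule d[OF _ that])
  qed
  ultimately show ?case by simp
qed

lemma partial_deriv_expand:
  assumes "g differentiable (at x)"
  shows "pd e g x = (\<Sum>b\<in>Basis. (e \<bullet> b) * pd b g x)"
proof -
  have "linear (frechet_derivative g (at x))"
    by (rule linear_frechet_derivative[OF assms])
  then have "frechet_derivative g (at x) (\<Sum>b\<in>Basis. (e \<bullet> b) *\<^sub>R b)
     = (\<Sum>b\<in>Basis. (e \<bullet> b) * frechet_derivative g (at x) b)"
    by (simp only: linear_sum linear_scale real_scaleR_def)
  then show ?thesis unfolding partial_deriv_def euclidean_representation .
qed

lemma iter_partial_append: "iter_partial (es @ [e]) g = iter_partial es (pd e g)"
  by (simp add: iter_partial_def)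

lemma Ck_on_partial_deriv:
  assumes "Ck_on (Suc k) U g" "e \<in> Basis"
  shows "Ck_on k U (pd e g)"
  unfolding Ck_on_def
proof (intro conjI ballI impI)
  fix es :: "'a list" assume es: "es \<in> dirs_le k"
  then have *: "es @ [e] \<in> dirs_le (Suc k)" using assms(2) by (auto simp: dirs_le_def)
  then show "continuous_on U (iter_partial es (pd e g))"
    using assms(1) unfolding Ck_on_def by (metis iter_partial_append)
  fix x assume "length es < k" "x \<in> U"
  then show "iter_partial es (pd e g) differentiable at x"
    using assms(1) * unfolding Ck_on_def by (metis Suc_less_eq iter_partial_append length_append_singleton)
qed

text \<open>A derivative in an arbitrary direction is a linear combination of coordinate derivatives with constant
coefficients, so it inherits their regularity.\<close>

lemma Ck_on_imp_Ck_dir: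
  assumes "open U" "Ck_on k U g"
  shows "Ck_dir k U g"
  using assms(2)
proof (induction k arbitrary: g)
  case 0
  then show ?case by (auto simp: Ck_on_def dirs_le_def iter_partial_def)
next
  case (Suc k)
  have "[] \<in> dirs_le (Suc k)" by (simp add: dirs_le_def)
  then have d: "\<forall>x\<in>U. g differentiable (at x)"
    using Suc.prems unfolding Ck_on_def by (force simp: iter_partial_def)
  moreover have "Ck_dir k U (pd e g)" for e
  proof (rule Ck_dir_cong[OF assms(1)])
    show "Ck_dir k U (\<lambda>x. \<Sum>b\<in>Basis. (e \<bullet> b) * pd b g x)"
      using assms(1) Suc by (intro Ck_dir_sum) (auto intro: Ck_on_partial_deriv)
    show "(\<Sum>b\<in>Basis. (e \<bullet> b) * pd b g z) = pd e g z" if "z \<in> U" for z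
      by (rule partial_deriv_expand[symmetric]) (use d that in blast)
  qed
  ultimately show ?case by simp
qed

lemma Ck_dir_continuous: "Ck_dir k U g \<Longrightarrow> continuous_on U g"
proof (cases k)
  case (Suc j)
  assume "Ck_dir k U g"
  then show ?thesis unfolding Suc
    by (intro continuous_at_imp_continuous_on ballI differentiable_imp_continuous_within) simp
qed simp

lemma Ck_dir_pred: "Ck_dir (Suc k) U g \<Longrightarrow> Ck_dir k U g"
proof (induction k arbitrary: g)
  case 0
  then show ?case using Ck_dir_continuous by fastforce
qed simp

lemma Ck_dir_le: "Ck_dir k U g \<Longrightarrow> j \<le> k \<Longrightarrow> Ck_dir j U g"
proof (induction k)
  case (Suc k) then show ?case using Ck_dir_pred le_Suc_eq by blast
qed simp

lemma Ck_dir_differentiable: "Ck_dir k U g \<Longrightarrow> 0 < k \<Longrightarrow> x \<in> U \<Longrightarrow> g differentiable (at x)"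
  by (cases k) auto

lemma Ck_dir_partial: "Ck_dir k U g \<Longrightarrow> 0 < k \<Longrightarrow> Ck_dir (k - 1) U (pd e g)"
  by (cases k) auto

lemma partial_deriv_curve:
  assumes "g differentiable (at (\<gamma> t))" "(\<gamma> has_vector_derivative v) (at t)"
  shows "((\<lambda>t. g (\<gamma> t)) has_real_derivative pd v g (\<gamma> t)) (at t)"
proof -
  let ?D = "frechet_derivative g (at (\<gamma> t))"
  have "(g has_derivative ?D) (at (\<gamma> t))"
    using assms(1) frechet_derivative_works by blast
  then have "((g \<circ> \<gamma>) has_derivative (?D \<circ> (\<lambda>h. h *\<^sub>R v))) (at t)"
    using assms(2) unfolding has_vector_derivative_def by (intro diff_chain_at)
  moreover have "(?D \<circ> (\<lambda>h. h *\<^sub>R v)) = (\<lambda>h. pd v g (\<gamma> t) * h)"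
    by (simp add: fun_eq_iff partial_deriv_def mult.commute
        linear_scale[OF linear_frechet_derivative[OF assms(1)]])
  ultimately show ?thesis
    unfolding has_field_derivative_def by (simp add: comp_def)
qed

lemma partial_deriv_line:
  assumes "g differentiable (at (x + t *\<^sub>R y))"
  shows "((\<lambda>t. g (x + t *\<^sub>R y)) has_real_derivative pd y g (x + t *\<^sub>R y)) (at t)"
  by (rule partial_deriv_curve[where \<gamma> = "\<lambda>t. x + t *\<^sub>R y", OF assms])
    (auto intro!: derivative_eq_intros simp: has_vector_derivative_def)

lemma partial_deriv_linear:
  assumes "g differentiable (at x)"
  shows "linear (\<lambda>e. pd e g x)"
  unfolding partial_deriv_def
  by (rule linear_frechet_derivative[OF assms])

text \<open>The mean value theorem, applied once in each of the two directions.  The left-hand side of the identity is symmetric in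
\<open>y\<close> and \<open>z\<close>, which is what makes the mixed derivatives agree.\<close>

lemma second_difference_mean_value:
  assumes "Ck_dir 2 U g" "t > 0"
    and seg: "\<And>a b. 0 \<le> a \<Longrightarrow> a \<le> t \<Longrightarrow> 0 \<le> b \<Longrightarrow> b \<le> t \<Longrightarrow> x + a *\<^sub>R y + b *\<^sub>R z \<in> U"
  shows "\<exists>a b. 0 \<le> a \<and> a \<le> t \<and> 0 \<le> b \<and> b \<le> t \<and>
    g (x + t *\<^sub>R y + t *\<^sub>R z) - g (x + t *\<^sub>R y) - g (x + t *\<^sub>R z) + g x
      = t^2 * pd z (pd y g) (x + a *\<^sub>R y + b *\<^sub>R z)"
proof -
  have d1: "g differentiable (at z)" if "z \<in> U" for z
    using assms(1) that Ck_dir_differentiable by fastforce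
  have d2: "pd y g differentiable (at z)" if "z \<in> U" for z
    using Ck_dir_partial[OF assms(1)] that Ck_dir_differentiable by fastforce
  let ?\<phi> = "\<lambda>s. g ((x + t *\<^sub>R z) + s *\<^sub>R y) - g (x + s *\<^sub>R y)"
  let ?\<phi>' = "\<lambda>s. pd y g ((x + t *\<^sub>R z) + s *\<^sub>R y) - pd y g (x + s *\<^sub>R y)"
  have "(?\<phi> has_real_derivative ?\<phi>' s) (at s)" if "0 \<le> s" "s \<le> t" for s
    using seg[of s t] seg[of s 0] that assms(2)
    by (intro DERIV_diff partial_deriv_line d1) (auto simp: algebra_simps)
  from MVT2[OF assms(2) this] obtain a where a: "0 < a" "a < t"
    "?\<phi> t - ?\<phi> 0 = (t - 0) * ?\<phi>' a" by auto
  let ?\<chi> = "\<lambda>s. pd y g ((x + a *\<^sub>R y) + s *\<^sub>R z)"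
  have "(?\<chi> has_real_derivative pd z (pd y g) ((x + a *\<^sub>R y) + s *\<^sub>R z)) (at s)"
    if "0 \<le> s" "s \<le> t" for s
    using seg[of a s] that a by (intro partial_deriv_line d2) auto
  from MVT2[OF assms(2) this] obtain b where b: "0 < b" "b < t"
    "?\<chi> t - ?\<chi> 0 = (t - 0) * pd z (pd y g) ((x + a *\<^sub>R y) + b *\<^sub>R z)" by auto
  have "?\<phi>' a = ?\<chi> t - ?\<chi> 0" by (simp add: algebra_simps)
  with a(3) b(3) have "?\<phi> t - ?\<phi> 0 = t^2 * pd z (pd y g) (x + a *\<^sub>R y + b *\<^sub>R z)"
    by (simp add: power2_eq_square)
  then show ?thesis using a b
    by (intro exI[of _ a] exI[of _ b]) (auto simp: algebra_simps)
qed

text \<open>Both mixed derivatives are limits of the same second difference quotient.\<close>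

lemma partial_deriv_commute:
  fixes g :: "'a::euclidean_space \<Rightarrow> real"
  assumes "open U" "x \<in> U" "Ck_dir 2 U g"
  shows "pd y (pd z g) x = pd z (pd y g) x"
proof (rule ccontr)
  let ?P = "pd y (pd z g)" and ?Q = "pd z (pd y g)"
  assume ne: "?P x \<noteq> ?Q x"
  define \<epsilon> where "\<epsilon> = \<bar>?P x - ?Q x\<bar> / 2"
  have "\<epsilon> > 0" using ne by (simp add: \<epsilon>_def)
  have c: "Ck_dir 0 U (pd e (pd e' g))" for e e'
    using assms(3) by (simp add: numeral_2_eq_2)
  then have "continuous_on U ?P" "continuous_on U ?Q" by simp_all
  moreover have "x \<in> interior U" using assms(1,2) by (simp add: interior_open)
  ultimately have "isCont ?P x" "isCont ?Q x" by (blast intro: continuous_on_interior)+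
  then have "\<exists>d>0. \<forall>x'. dist x' x < d \<longrightarrow> dist (?P x') (?P x) < \<epsilon>"
      "\<exists>d>0. \<forall>x'. dist x' x < d \<longrightarrow> dist (?Q x') (?Q x) < \<epsilon>"
    unfolding continuous_at_eps_delta using \<open>\<epsilon> > 0\<close> by simp_all
  then obtain d1 d2 where d12: "d1 > 0" "d2 > 0"
    "\<And>x'. dist x' x < d1 \<Longrightarrow> dist (?P x') (?P x) < \<epsilon>"
    "\<And>x'. dist x' x < d2 \<Longrightarrow> dist (?Q x') (?Q x) < \<epsilon>"
    by blast
  obtain d3 where d3: "d3 > 0" "ball x d3 \<subseteq> U" using assms(1,2) openE by blast
  define d where "d = Min {d1, d2, d3}"
  have "d > 0" using d12 d3 by (simp add: d_def)
  define N where "N = norm y + norm z + 1"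
  have den: "N > 0" by (simp add: N_def add_nonneg_pos)
  define t where "t = d / (2 * N)"
  have "t > 0" using \<open>d > 0\<close> den by (simp add: t_def)
  have near: "norm (a *\<^sub>R y + b *\<^sub>R z) < d" if "0 \<le> a" "a \<le> t" "0 \<le> b" "b \<le> t" for a b
  proof -
    have "norm (a *\<^sub>R y + b *\<^sub>R z) \<le> a * norm y + b * norm z"
      using norm_triangle_ineq[of "a *\<^sub>R y" "b *\<^sub>R z"] that by simp
    also have "\<dots> \<le> t * norm y + t * norm z" using that by (intro add_mono mult_right_mono) auto
    also have "\<dots> \<le> t * N" using \<open>t > 0\<close> by (simp add: N_def algebra_simps)
    also have "\<dots> = d / 2" using den by (simp add: t_def)
    also have "\<dots> < d" using \<open>d > 0\<close> by simp
    finally show ?thesis .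
  qed
  have inU: "x + a *\<^sub>R y + b *\<^sub>R z \<in> U" if "0 \<le> a" "a \<le> t" "0 \<le> b" "b \<le> t" for a b
    using near[OF that] d3(2) by (auto simp: dist_norm d_def add.assoc subset_iff norm_minus_commute)
  from second_difference_mean_value[OF assms(3) \<open>t > 0\<close> inU] obtain a b where ab:
    "0 \<le> a" "a \<le> t" "0 \<le> b" "b \<le> t"
    "g (x + t *\<^sub>R y + t *\<^sub>R z) - g (x + t *\<^sub>R y) - g (x + t *\<^sub>R z) + g x
      = t^2 * ?Q (x + a *\<^sub>R y + b *\<^sub>R z)" by blast
  have inU': "x + b *\<^sub>R z + a *\<^sub>R y \<in> U" if "0 \<le> b" "b \<le> t" "0 \<le> a" "a \<le> t" for a b
    using inU[OF that(3,4,1,2)] by (simp add: algebra_simps)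
  from second_difference_mean_value[OF assms(3) \<open>t > 0\<close> inU'] obtain b' a' where ab':
    "0 \<le> a'" "a' \<le> t" "0 \<le> b'" "b' \<le> t"
    "g (x + t *\<^sub>R z + t *\<^sub>R y) - g (x + t *\<^sub>R z) - g (x + t *\<^sub>R y) + g x
      = t^2 * ?P (x + b' *\<^sub>R z + a' *\<^sub>R y)" by blast
  have "t^2 * ?Q (x + a *\<^sub>R y + b *\<^sub>R z) = t^2 * ?P (x + b' *\<^sub>R z + a' *\<^sub>R y)"
    using ab(5) ab'(5) by (simp add: algebra_simps)
  then have eq: "?Q (x + (a *\<^sub>R y + b *\<^sub>R z)) = ?P (x + (a' *\<^sub>R y + b' *\<^sub>R z))"
    using \<open>t > 0\<close> by (simp add: algebra_simps)
  have "dist (?Q (x + (a *\<^sub>R y + b *\<^sub>R z))) (?Q x) < \<epsilon>"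
    using near[OF ab(1-4)] by (intro d12(4)) (simp add: dist_norm d_def)
  moreover have "dist (?P (x + (a' *\<^sub>R y + b' *\<^sub>R z))) (?P x) < \<epsilon>"
    using near[OF ab'(1-4)] by (intro d12(3)) (simp add: dist_norm d_def)
  ultimately show False using eq unfolding \<epsilon>_def dist_real_def by (simp add: abs_if split: if_splits)
qed

lemma local_max_second_derivative:
  fixes \<phi> :: "real \<Rightarrow> real"
  assumes "\<epsilon> > 0" and d1: "\<And>t. \<bar>t\<bar> < \<epsilon> \<Longrightarrow> (\<phi> has_real_derivative \<phi>' t) (at t)"
    and d2: "(\<phi>' has_real_derivative D) (at 0)"
    and mx: "\<And>t. \<bar>t\<bar> < \<epsilon> \<Longrightarrow> \<phi> t \<le> \<phi> 0"
  shows "\<phi>' 0 = 0" "D \<le> 0"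
proof -
  show 0: "\<phi>' 0 = 0"
    by (rule DERIV_local_max[of \<phi> "\<phi>' 0" 0 \<epsilon>]) (use assms in auto)
  show "D \<le> 0"
  proof (rule ccontr)
    assume "\<not> D \<le> 0"
    then have "D > 0" by simp
    from DERIV_pos_inc_right[OF d2 this] obtain d where d: "d > 0"
      "\<And>h. h > 0 \<Longrightarrow> h < d \<Longrightarrow> \<phi>' 0 < \<phi>' h" by auto
    define t where "t = min d \<epsilon> / 2"
    have t: "t > 0" "t < d" "t < \<epsilon>" using d assms(1) by (auto simp: t_def)
    have "\<exists>z>0. z < t \<and> \<phi> t - \<phi> 0 = (t - 0) * \<phi>' z"
      using MVT2[of 0 t \<phi> \<phi>'] t d1 by auto
    then obtain z where z: "z > 0" "z < t" "\<phi> t - \<phi> 0 = (t - 0) * \<phi>' z" by blast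
    have "\<phi>' z > 0" using d(2)[of z] z t 0 by simp
    then have "\<phi> t - \<phi> 0 > 0" using z t by simp
    moreover have "\<phi> t \<le> \<phi> 0" using mx[of t] t by simp
    ultimately show False by simp
  qed
qed

section \<open>Eigenframes of symmetric matrices and weighted traces\<close>

text \<open>Frames are indexed by numbers below \<open>n\<close>, as the sorted list of eigenvalues is.\<close>

definition orthonormal_frame :: "(nat \<Rightarrow> real^'n) \<Rightarrow> bool" where
  "orthonormal_frame q \<longleftrightarrow>
     (\<forall>i<CARD('n). \<forall>j<CARD('n). q i \<bullet> q j = (if i = j then 1 else 0))"

lemma orthonormal_frame_norm:
  fixes q :: "nat \<Rightarrow> real^'n"
  assumes "orthonormal_frame q" "i < CARD('n)"
  shows "norm (q i) = 1" "q i \<bullet> q i = 1"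
  using assms by (auto simp: orthonormal_frame_def norm_eq_sqrt_inner)

lemma orthonormal_frame_expand:
  fixes q :: "nat \<Rightarrow> real^'n"
  assumes "orthonormal_frame q"
  shows "x = (\<Sum>i<CARD('n). (x \<bullet> q i) *\<^sub>R q i)"
proof -
  let ?B = "q ` {..<CARD('n)}"
  have inj: "inj_on q {..<CARD('n)}"
  proof (rule inj_onI)
    fix i j assume "i \<in> {..<CARD('n)}" "j \<in> {..<CARD('n)}" "q i = q j"
    then show "i = j" using assms unfolding orthonormal_frame_def
      by (metis lessThan_iff zero_neq_one)
  qed
  have po: "pairwise orthogonal ?B"
    using assms unfolding pairwise_def orthogonal_def orthonormal_frame_def by auto
  have n1: "norm y = 1" if "y \<in> ?B" for y
    using that assms orthonormal_frame_norm by blast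
  have "0 \<notin> ?B" using n1 by force
  with po have "independent ?B" by (rule pairwise_orthogonal_independent)
  moreover have "card ?B = DIM(real^'n)" using inj by (simp add: card_image)
  ultimately have "span ?B = UNIV"
    using dim_eq_card_independent[of ?B] dim_eq_full[of ?B] by simp
  then have "x = (\<Sum>b\<in>?B. (x \<bullet> b) *\<^sub>R b)"
    using orthonormal_basis_expand[OF po n1, of x] by simp
  then show ?thesis
    using inj by (simp add: sum.reindex inner_commute)
qed

lemma orthonormal_frame_parseval:
  fixes q :: "nat \<Rightarrow> real^'n"
  assumes "orthonormal_frame q"
  shows "x \<bullet> y = (\<Sum>i<CARD('n). (x \<bullet> q i) * (y \<bullet> q i))"
proof -
  have "x \<bullet> y = x \<bullet> (\<Sum>i<CARD('n). (y \<bullet> q i) *\<^sub>R q i)"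
    using orthonormal_frame_expand[OF assms, of y] by simp
  then show ?thesis by (simp add: inner_sum_right mult.commute)
qed

text \<open>At a maximum of the quadratic form on the unit sphere of \<open>S\<close> the first variation in the direction of
\<open>f e - \<langle>e, f e\<rangle> e\<close> vanishes, and that variation is the squared length of this vector.\<close>

lemma rayleigh_max_eigenvector:
  fixes f :: "'a::euclidean_space \<Rightarrow> 'a"
  assumes f: "linear f" "\<And>x y. f x \<bullet> y = x \<bullet> f y" and S: "subspace S" "f ` S \<subseteq> S"
    and e: "e \<in> S" "norm e = 1" "\<And>x. x \<in> S \<Longrightarrow> norm x = 1 \<Longrightarrow> x \<bullet> f x \<le> e \<bullet> f e"
  shows "f e = (e \<bullet> f e) *\<^sub>R e"
proof -
  let ?M = "e \<bullet> f e"
  have ray: "x \<bullet> f x \<le> ?M * (x \<bullet> x)" if "x \<in> S" for x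
  proof (cases "x = 0")
    case True then show ?thesis using linear_0[OF f(1)] by simp
  next
    case False
    let ?y = "(1 / norm x) *\<^sub>R x"
    have "?y \<bullet> f ?y \<le> ?M"
      using False that S(1) by (intro e(3)) (auto simp: subspace_scale)
    moreover have "?y \<bullet> f ?y = (x \<bullet> f x) / (norm x)^2"
      by (simp add: linear_scale[OF f(1)] power2_eq_square)
    ultimately have "(x \<bullet> f x) / (norm x)^2 \<le> ?M" by (simp only:)
    then have "x \<bullet> f x \<le> ?M * (norm x)^2" using False by (simp add: pos_divide_le_eq)
    then show ?thesis by (simp only: power2_norm_eq_inner)
  qed
  define z where "z = f e - ?M *\<^sub>R e"
  have zS: "z \<in> S" using S e(1) unfolding z_def
    by (metis image_subset_iff subspace_diff subspace_scale)
  \<comment> \<open>Test the Rayleigh quotient along \<open>e + t z\<close>: the linear term in \<open>t\<close> is \<open>2 t (z \<bullet> z)\<close>.\<close>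
  have ze: "z \<bullet> f e - ?M * (z \<bullet> e) = z \<bullet> z"
    by (simp add: z_def inner_diff_right inner_diff_left algebra_simps)
  have "2 * t * (z \<bullet> z) \<le> t^2 * (?M * (z \<bullet> z) - z \<bullet> f z)" for t
  proof -
    have "e + t *\<^sub>R z \<in> S" using zS e(1) S(1) by (simp add: subspace_add subspace_scale)
    from ray[OF this] have "(e + t *\<^sub>R z) \<bullet> f (e + t *\<^sub>R z) \<le> ?M * ((e + t *\<^sub>R z) \<bullet> (e + t *\<^sub>R z))" .
    moreover have "(e + t *\<^sub>R z) \<bullet> f (e + t *\<^sub>R z) = ?M + 2 * t * (z \<bullet> f e) + t^2 * (z \<bullet> f z)"
      using f(2)[of e z]
      by (simp add: linear_add[OF f(1)] linear_scale[OF f(1)] inner_add power2_eq_square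
          algebra_simps inner_commute)
    moreover have "(e + t *\<^sub>R z) \<bullet> (e + t *\<^sub>R z) = 1 + 2 * t * (z \<bullet> e) + t^2 * (z \<bullet> z)"
      using e(2)[unfolded norm_eq_1]
      by (simp add: inner_add_left inner_add_right power2_eq_square algebra_simps inner_commute)
    ultimately have "?M + 2 * t * (z \<bullet> f e) + t^2 * (z \<bullet> f z) \<le> ?M * (1 + 2 * t * (z \<bullet> e) + t^2 * (z \<bullet> z))"
      by (simp only:)
    then have "2 * t * (z \<bullet> f e - ?M * (z \<bullet> e)) \<le> t^2 * (?M * (z \<bullet> z) - z \<bullet> f z)"
      by (simp add: algebra_simps)
    then show ?thesis unfolding ze .
  qed
  note q = this
  have "z \<bullet> z \<le> 0"
  proof (rule ccontr)
    assume "\<not> z \<bullet> z \<le> 0"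
    then have zz: "z \<bullet> z > 0" by (simp only: not_le)
    define K where "K = \<bar>?M * (z \<bullet> z) - z \<bullet> f z\<bar> + 1"
    define t where "t = (z \<bullet> z) / K"
    have "K > 0" by (simp add: K_def add_nonneg_pos)
    have "t > 0" using zz \<open>K > 0\<close> by (simp add: t_def)
    have "?M * (z \<bullet> z) - z \<bullet> f z \<le> K" by (simp add: K_def)
    from mult_left_mono[OF this, of "t^2"] have "2 * t * (z \<bullet> z) \<le> t^2 * K"
      using q[of t] by (meson order_trans zero_le_power2)
    also have "\<dots> = t * (z \<bullet> z)" using \<open>K > 0\<close> by (simp add: t_def power2_eq_square)
    finally show False using \<open>t > 0\<close> zz by simp
  qed
  then have "z = 0" by (metis antisym inner_ge_zero inner_eq_zero_iff)
  then show ?thesis by (simp add: z_def)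
qed

text \<open>Split off a maximiser of the quadratic form and continue in its orthogonal complement, which is again
invariant.\<close>

lemma selfadjoint_orthonormal_eigenbasis:
  fixes f :: "'a::euclidean_space \<Rightarrow> 'a"
  assumes f: "linear f" "\<And>x y. f x \<bullet> y = x \<bullet> f y" and "subspace S" "f ` S \<subseteq> S"
  shows "\<exists>B. B \<subseteq> S \<and> pairwise orthogonal B \<and> span B = S \<and>
      (\<forall>x\<in>B. norm x = 1 \<and> (\<exists>c. f x = c *\<^sub>R x))"
  using assms(3,4)
proof (induction "dim S" arbitrary: S rule: less_induct)
  case less
  show ?case
  proof (cases "S \<subseteq> {0}")
    case True
    then have "S = {0}" using subspace_0[OF less.prems(1)] by auto
    then show ?thesis by (intro exI[of _ "{}"]) auto
  next
    case False
    then obtain a where a: "a \<in> S" "a \<noteq> 0" by auto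
    have "compact (sphere 0 1 \<inter> S)"
      using closed_subspace[OF less.prems(1)] by (simp add: compact_Int_closed)
    moreover have "(1 / norm a) *\<^sub>R a \<in> sphere 0 1 \<inter> S"
      using a less.prems(1) by (simp add: subspace_scale)
    moreover have "continuous_on (sphere 0 1 \<inter> S) (\<lambda>x. x \<bullet> f x)"
      by (intro continuous_intros linear_continuous_on linear_conv_bounded_linear[THEN iffD1] f(1))
    ultimately obtain e where e: "e \<in> sphere 0 1 \<inter> S"
      "\<And>x. x \<in> sphere 0 1 \<inter> S \<Longrightarrow> x \<bullet> f x \<le> e \<bullet> f e"
      using continuous_attains_sup[of "sphere 0 1 \<inter> S" "\<lambda>x. x \<bullet> f x"] by blast
    have ev: "f e = (e \<bullet> f e) *\<^sub>R e"
      by (rule rayleigh_max_eigenvector[OF f less.prems]) (use e in auto)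
    have ee: "e \<bullet> e = 1" "e \<in> S" using e(1) by (auto simp: norm_eq_1)
    define S' where "S' = {y \<in> S. y \<bullet> e = 0}"
    have S': "subspace S'" using less.prems(1)
      unfolding S'_def subspace_def by (auto simp: inner_add_left)
    have inv: "f ` S' \<subseteq> S'"
      using less.prems(2) f(2) ev unfolding S'_def
      by (auto simp: image_subset_iff) (metis inner_scaleR_right mult_zero_right)
    have "e \<notin> S'" using ee by (simp add: S'_def)
    then have "S' \<noteq> S" using ee by auto
    moreover have "S' \<subseteq> S" by (auto simp: S'_def)
    ultimately have "dim S' < dim S"
      using subspace_dim_equal[OF S' less.prems(1)] not_less by blast
    from less.hyps[OF this S' inv] obtain B where B: "B \<subseteq> S'" "pairwise orthogonal B" "span B = S'"
      "\<forall>x\<in>B. norm x = 1 \<and> (\<exists>c. f x = c *\<^sub>R x)" by blast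
    have "pairwise orthogonal (insert e B)"
      using B(1,2) by (auto simp: pairwise_insert orthogonal_def S'_def inner_commute)
    moreover have "span (insert e B) = S"
    proof
      show "span (insert e B) \<subseteq> S"
        using B(1) ee less.prems(1) \<open>S' \<subseteq> S\<close> by (intro span_minimal) auto
      show "S \<subseteq> span (insert e B)"
      proof
        fix x assume "x \<in> S"
        then have "x - (x \<bullet> e) *\<^sub>R e \<in> S'"
          using ee less.prems(1) by (auto simp: S'_def inner_diff_left subspace_diff subspace_scale)
        then show "x \<in> span (insert e B)" using B(3) by (auto simp: span_insert)
      qed
    qed
    moreover have "insert e B \<subseteq> S" using B(1) \<open>S' \<subseteq> S\<close> ee by auto
    moreover have "\<forall>x\<in>insert e B. norm x = 1 \<and> (\<exists>c. f x = c *\<^sub>R x)"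
      using B(4) ev e(1) by auto
    ultimately show ?thesis by blast
  qed
qed

lemma poly_det: "poly (det A) x = det (\<chi> i j. poly (A $ i $ j) x)"
  for A :: "real poly ^'n^'n"
  by (simp add: det_def poly_sum poly_prod)

lemma sum_singleton_mset: "finite A \<Longrightarrow> (\<Sum>j\<in>A. {#f j#}) = image_mset f (mset_set A)"
  by (induction A rule: finite_induct) auto

lemma matrix_inner_transpose: "(A *v x) \<bullet> y = x \<bullet> (transpose A *v y)" for A :: "real^'n^'n"
  using dot_lmul_matrix[of x "transpose A" y] by (simp add: vector_transpose_matrix)

text \<open>Both sides agree at every real number \<open>x\<close>: conjugating \<open>x - A\<close> by the orthogonal matrix of the basis
makes it diagonal.\<close>

lemma charpoly_eigenbasis:
  fixes A :: "real^'n^'n" and b :: "'n \<Rightarrow> real^'n"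
  assumes orth: "\<And>i j. b i \<bullet> b j = (if i = j then 1 else 0)" and ev: "\<And>i. A *v b i = l i *\<^sub>R b i"
  shows "charpoly A = (\<Prod>j\<in>UNIV. [:- l j, 1:])"
proof -
  define Q where "Q = (\<chi> i j. b j $ i)"
  have Q1: "(transpose Q ** Q) = mat 1"
    using orth by (simp add: Q_def vec_eq_iff matrix_matrix_mult_def transpose_def mat_def inner_vec_def)
  have "poly (charpoly A) x = poly (\<Prod>j\<in>UNIV. [:- l j, 1:]) x" for x
  proof -
    let ?M = "x *\<^sub>R mat 1 - A"
    have "poly (charpoly A) x = det ?M"
      unfolding charpoly_def poly_det
      by (intro arg_cong[of _ _ det]) (simp add: vec_eq_iff mat_def)
    also have "\<dots> = det (transpose Q ** (?M ** Q))"
    proof -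
      have "det (transpose Q) * det Q = 1"
        using Q1 by (metis det_I det_mul)
      then show ?thesis by (simp add: det_mul)
    qed
    also have "transpose Q ** (?M ** Q) = (\<chi> i j. if i = j then x - l j else 0)"
    proof -
      have "(transpose Q ** (?M ** Q)) $ i $ j = b i \<bullet> (?M *v b j)" for i j
        by (simp add: matrix_matrix_mult_def Q_def transpose_def inner_vec_def matrix_vector_mult_def)
      moreover have "?M *v b j = (x - l j) *\<^sub>R b j" for j
        by (simp add: matrix_vector_mult_diff_rdistrib ev scaleR_matrix_vector_assoc[symmetric] scaleR_diff_left)
      ultimately show ?thesis using orth by (simp add: vec_eq_iff)
    qed
    also have "det \<dots> = (\<Prod>j\<in>UNIV. x - l j)" by (subst det_diagonal) auto
    finally show ?thesis by (simp add: poly_prod)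
  qed
  then show ?thesis by (simp add: poly_eq_poly_eq_iff[symmetric] fun_eq_iff)
qed

text \<open>The roots of the characteristic polynomial are the eigenvalues of an orthonormal eigenbasis; sorting that basis
by eigenvalue matches it with the sorted list of roots.\<close>

theorem symmetric_eigenframe:
  fixes A :: "real^'n^'n"
  assumes "transpose A = A"
  shows "length (eigvals A) = CARD('n)" "sorted (eigvals A)"
    "\<exists>q. orthonormal_frame q \<and> (\<forall>i<CARD('n). A *v q i = (eigvals A ! i) *\<^sub>R q i)"
proof -
  have "linear ((*v) A)" by simp
  moreover have "(A *v x) \<bullet> y = x \<bullet> (A *v y)" for x y
    using matrix_inner_transpose[of A] assms by simp
  ultimately obtain B where B: "pairwise orthogonal B" "span B = UNIV"
    "\<forall>x\<in>B. norm x = 1 \<and> (\<exists>c. A *v x = c *\<^sub>R x)"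
    using selfadjoint_orthonormal_eigenbasis[of "(*v) A" UNIV] by auto
  have "0 \<notin> B" using B(3) by force
  then have "independent B" by (rule pairwise_orthogonal_independent[OF B(1)])
  then have "finite B" "card B = CARD('n)"
    using B(2) independent_imp_finite dim_span[of B] dim_eq_card_independent[of B] by auto
  then obtain b where b: "bij_betw b (UNIV :: 'n set) B"
    using finite_same_card_bij[of "UNIV :: 'n set" B] by auto
  have "\<forall>i. \<exists>c. A *v b i = c *\<^sub>R b i"
    using B(3) bij_betwE[OF b] by blast
  then obtain l where l: "\<And>i. A *v b i = l i *\<^sub>R b i" by metis
  have orth: "b i \<bullet> b j = (if i = j then 1 else 0)" for i j
  proof (cases "i = j")
    case True then show ?thesis using B(3) b by (simp add: bij_betwE norm_eq_1[symmetric])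
  next
    case False
    then have "b i \<noteq> b j" using b by (auto simp: bij_betw_def inj_on_def)
    then show ?thesis using False B(1) b
      by (auto simp: pairwise_def orthogonal_def bij_betwE)
  qed
  obtain xs where xs: "distinct xs" "set xs = (UNIV :: 'n set)"
    using finite_distinct_list[of "UNIV :: 'n set"] by auto
  define ys where "ys = sort_key l xs"
  have ys: "distinct ys" "set ys = UNIV" "mset ys = mset_set UNIV" "length ys = CARD('n)"
    using xs mset_set_set[OF xs(1)] distinct_card[OF xs(1)] by (simp_all add: ys_def)
  have "proots (charpoly A) = (\<Sum>j\<in>UNIV. {#l j#})"
    unfolding charpoly_eigenbasis[OF orth l] by (subst proots_prod) auto
  also have "\<dots> = mset (map l ys)" by (simp add: sum_singleton_mset ys(3))
  finally have "eigvals A = sort (map l ys)" unfolding eigvals_def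
    by (simp only: sorted_list_of_multiset_mset)
  then have ev: "eigvals A = map l ys"
    by (simp add: ys_def sorted_sort_id)
  show "length (eigvals A) = CARD('n)" using ev ys(4) by simp
  show "sorted (eigvals A)" using ev by (simp add: ys_def)
  show "\<exists>q. orthonormal_frame q \<and> (\<forall>i<CARD('n). A *v q i = (eigvals A ! i) *\<^sub>R q i)"
    using ys(1,4) l by (intro exI[of _ "\<lambda>i. b (ys ! i)"])
      (simp add: orthonormal_frame_def orth ev nth_eq_iff_index_eq)
qed

text \<open>Pairing a decreasing with an increasing sequence gives the least value among all doubly stochastic pairings.
A concave function \<open>g\<close> of \<open>\<mu>\<close> with slopes \<open>c\<close> turns the difference of the two sides into
a sum which telescopes because all row and column sums are 1.\<close>

lemma doubly_stochastic_rearrangement: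
  fixes c \<mu> :: "nat \<Rightarrow> real"
  assumes c: "\<And>i j. i \<le> j \<Longrightarrow> j < n \<Longrightarrow> c j \<le> c i" and \<mu>: "\<And>i j. i \<le> j \<Longrightarrow> j < n \<Longrightarrow> \<mu> i \<le> \<mu> j"
    and D: "\<And>i k. D i k \<ge> 0" "\<And>i. i < n \<Longrightarrow> (\<Sum>k<n. D i k) = 1" "\<And>k. k < n \<Longrightarrow> (\<Sum>i<n. D i k) = 1"
  shows "(\<Sum>i<n. c i * \<mu> i) \<le> (\<Sum>i<n. c i * (\<Sum>k<n. D i k * \<mu> k))"
proof -
  \<comment> \<open>A concave function of \<open>\<mu>\<close> whose supergradient at \<open>\<mu> i\<close> is \<open>c i\<close>.\<close>
  define g where "g k = (\<Sum>j<k. c j * (\<mu> (Suc j) - \<mu> j))" for k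
  have tel: "\<mu> k - \<mu> i = (\<Sum>j=i..<k. \<mu> (Suc j) - \<mu> j)" if "i \<le> k" for i k
    using that by (simp add: sum_Suc_diff')
  have gd: "g k - g i = (\<Sum>j=i..<k. c j * (\<mu> (Suc j) - \<mu> j))" if "i \<le> k" for i k
    unfolding g_def lessThan_atLeast0 by (rule sum_diff_nat_ivl) (use that in auto)
  have super: "g k - g i \<le> c i * (\<mu> k - \<mu> i)" if "i < n" "k < n" for i k
  proof (cases "i \<le> k")
    case True
    show ?thesis unfolding gd[OF True] tel[OF True] sum_distrib_left
      using that c \<mu> by (intro sum_mono mult_right_mono) auto
  next
    case False
    then have ki: "k \<le> i" by simp
    have "c i * (\<mu> i - \<mu> k) \<le> g i - g k" unfolding gd[OF ki] tel[OF ki] sum_distrib_left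
      using that c \<mu> by (intro sum_mono mult_right_mono) auto
    then show ?thesis by (simp add: algebra_simps)
  qed
  have "(\<Sum>i<n. \<Sum>k<n. D i k * (g k - g i)) \<le> (\<Sum>i<n. \<Sum>k<n. D i k * (c i * (\<mu> k - \<mu> i)))"
    using super D(1) by (intro sum_mono mult_left_mono) auto
  moreover have "(\<Sum>i<n. \<Sum>k<n. D i k * (g k - g i)) = 0"
  proof -
    have "(\<Sum>i<n. \<Sum>k<n. D i k * g k) = (\<Sum>k<n. (\<Sum>i<n. D i k) * g k)"
      unfolding sum_distrib_right by (rule sum.swap)
    moreover have "(\<Sum>i<n. \<Sum>k<n. D i k * g i) = (\<Sum>i<n. (\<Sum>k<n. D i k) * g i)"
      unfolding sum_distrib_right ..
    ultimately show ?thesis using D by (simp add: right_diff_distrib sum_subtractf)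
  qed
  moreover have "(\<Sum>i<n. \<Sum>k<n. D i k * (c i * (\<mu> k - \<mu> i)))
    = (\<Sum>i<n. c i * (\<Sum>k<n. D i k * \<mu> k)) - (\<Sum>i<n. c i * \<mu> i)"
  proof -
    have "(\<Sum>k<n. D i k * (c i * (\<mu> k - \<mu> i))) = c i * (\<Sum>k<n. D i k * \<mu> k) - c i * \<mu> i"
      if "i < n" for i
    proof -
      have "(\<Sum>k<n. D i k * (c i * (\<mu> k - \<mu> i)))
        = c i * (\<Sum>k<n. D i k * \<mu> k) - (\<Sum>k<n. D i k) * (c i * \<mu> i)"
        unfolding sum_distrib_left sum_distrib_right sum_subtractf[symmetric]
        by (intro sum.cong) (auto simp: algebra_simps)
      then show ?thesis using D(2)[OF that] by simp
    qed
    then show ?thesis by (simp add: sum_subtractf)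
  qed
  ultimately show ?thesis by simp
qed

text \<open>The squared coefficients of one orthonormal frame in another form a doubly stochastic matrix.\<close>

lemma weighted_trace_ge_eigenvalues:
  fixes A :: "real^'n^'n"
  assumes "transpose A = A" "orthonormal_frame q"
    and c: "\<And>i j. i \<le> j \<Longrightarrow> j < CARD('n) \<Longrightarrow> c j \<le> c i"
  shows "(\<Sum>i<CARD('n). c i * eigvals A ! i) \<le> (\<Sum>i<CARD('n). c i * (q i \<bullet> (A *v q i)))"
proof -
  obtain r where r: "orthonormal_frame r" "\<And>i. i < CARD('n) \<Longrightarrow> A *v r i = (eigvals A ! i) *\<^sub>R r i"
    using symmetric_eigenframe(3)[OF assms(1)] by blast
  define D where "D i k = (q i \<bullet> r k)\<^sup>2" for i k
  have "q i \<bullet> (A *v q i) = (\<Sum>k<CARD('n). D i k * eigvals A ! k)" for i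
  proof -
    have "q i \<bullet> (A *v q i) = (\<Sum>k<CARD('n). (q i \<bullet> r k) * ((A *v q i) \<bullet> r k))"
      by (rule orthonormal_frame_parseval[OF r(1)])
    also have "\<dots> = (\<Sum>k<CARD('n). D i k * eigvals A ! k)"
      using r(2) by (intro sum.cong) 
        (auto simp: D_def matrix_inner_transpose assms(1) power2_eq_square)
    finally show ?thesis .
  qed
  moreover have "(\<Sum>i<CARD('n). c i * eigvals A ! i)
      \<le> (\<Sum>i<CARD('n). c i * (\<Sum>k<CARD('n). D i k * eigvals A ! k))"
  proof (rule doubly_stochastic_rearrangement[OF c])
    show "eigvals A ! i \<le> eigvals A ! j" if "i \<le> j" "j < CARD('n)" for i j
      using symmetric_eigenframe(1,2)[OF assms(1)] that by (simp add: sorted_nth_mono)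
    show "(\<Sum>k<CARD('n). D i k) = 1" if "i < CARD('n)" for i
      using orthonormal_frame_parseval[OF r(1), of "q i" "q i"] orthonormal_frame_norm[OF assms(2) that]
      by (simp add: D_def power2_eq_square)
    show "(\<Sum>i<CARD('n). D i k) = 1" if "k < CARD('n)" for k
      using orthonormal_frame_parseval[OF assms(2), of "r k" "r k"] orthonormal_frame_norm[OF r(1) that]
      by (simp add: D_def power2_eq_square inner_commute)
  qed (auto simp: D_def)
  ultimately show ?thesis by simp
qed

section \<open>Sums of p eigenvalues\<close>

text \<open>The derivative of the sum of \<open>ln (sum l I)\<close> over all index sets with respect to the variable \<open>l i\<close>.\<close>

definition dlog_coeff :: "nat \<Rightarrow> nat \<Rightarrow> (nat \<Rightarrow> real) \<Rightarrow> nat \<Rightarrow> real" where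
  "dlog_coeff n p l i = (\<Sum>I | I \<in> index_sets n p \<and> i \<in> I. 1 / sum l I)"

definition p_positive :: "nat \<Rightarrow> nat \<Rightarrow> (nat \<Rightarrow> real) \<Rightarrow> bool" where
  "p_positive n p l \<longleftrightarrow> (\<forall>I\<in>index_sets n p. sum l I > 0)"

lemma finite_index_sets [simp]: "finite (index_sets n p)"
  unfolding index_sets_def by simp

lemma index_setsD: "I \<in> index_sets n p \<Longrightarrow> I \<subseteq> {..<n} \<and> card I = p \<and> finite I"
  unfolding index_sets_def using finite_subset by auto

lemma dlog_coeff_sum:
  "(\<Sum>i<n. dlog_coeff n p l i * x i) = (\<Sum>I\<in>index_sets n p. sum x I / sum l I)"
proof -
  have "(\<Sum>i<n. dlog_coeff n p l i * x i)
      = (\<Sum>i<n. \<Sum>I\<in>index_sets n p. if i \<in> I then x i / sum l I else 0)"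
  proof (rule sum.cong[OF refl])
    fix i
    show "dlog_coeff n p l i * x i = (\<Sum>I\<in>index_sets n p. if i \<in> I then x i / sum l I else 0)"
      unfolding dlog_coeff_def sum_distrib_right sum.inter_filter[OF finite_index_sets, symmetric]
      by simp
  qed
  also have "\<dots> = (\<Sum>I\<in>index_sets n p. \<Sum>i<n. if i \<in> I then x i / sum l I else 0)"
    by (rule sum.swap)
  also have "\<dots> = (\<Sum>I\<in>index_sets n p. sum x I / sum l I)"
  proof (intro sum.cong refl)
    fix I assume "I \<in> index_sets n p"
    then have "I \<subseteq> {..<n}" by (simp add: index_setsD)
    then have "{i \<in> {..<n}. i \<in> I} = I" by auto
    then show "(\<Sum>i<n. if i \<in> I then x i / sum l I else 0) = sum x I / sum l I"
      by (simp add: sum.inter_filter[symmetric] sum_divide_distrib)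
  qed
  finally show ?thesis .
qed

lemma dlog_coeff_nonneg: "p_positive n p l \<Longrightarrow> dlog_coeff n p l i \<ge> 0"
  unfolding dlog_coeff_def p_positive_def by (intro sum_nonneg) (auto intro: less_imp_le)

text \<open>The sets containing both indices cancel, and exchanging \<open>i\<close> for \<open>j\<close> is a bijection between the remaining ones.\<close>

lemma exchange_difference:
  assumes "i < n" "j < n" "i \<noteq> j"
  shows "dlog_coeff n p l i - dlog_coeff n p l j =
    (\<Sum>I | I \<in> index_sets n p \<and> i \<in> I \<and> j \<notin> I. 1 / sum l I - 1 / (sum l I + l j - l i))"
proof -
  let ?X = "\<lambda>i j. {I. I \<in> index_sets n p \<and> i \<in> I \<and> j \<notin> I}"
  let ?B = "{I. I \<in> index_sets n p \<and> i \<in> I \<and> j \<in> I}"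
  have fin: "finite (?X i j)" "finite (?X j i)" "finite ?B" by auto
  have split: "dlog_coeff n p l i = (\<Sum>I\<in>?X i j. 1 / sum l I) + (\<Sum>I\<in>?B. 1 / sum l I)"
    "dlog_coeff n p l j = (\<Sum>I\<in>?X j i. 1 / sum l I) + (\<Sum>I\<in>?B. 1 / sum l I)"
    unfolding dlog_coeff_def using fin
    by (subst sum.union_disjoint[symmetric]; auto intro: sum.cong)+
  have sw: "insert j (I - {i}) \<in> ?X j i" if "I \<in> ?X i j" "i \<noteq> j" "j < n" for i j I
  proof -
    have "card (insert j (I - {i})) = card I"
      using that index_setsD[of I n p] card_gt_0_iff[of I] by auto
    then show ?thesis using that by (auto simp: index_sets_def)
  qed
  have "(\<Sum>I\<in>?X j i. 1 / sum l I) = (\<Sum>I\<in>?X i j. 1 / (sum l I + l j - l i))"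
  proof (rule sum.reindex_bij_witness[of _ "\<lambda>I. insert j (I - {i})" "\<lambda>I. insert i (I - {j})"])
    fix I assume I: "I \<in> ?X j i"
    then have "finite I" using index_setsD by blast
    show "insert j (insert i (I - {j}) - {i}) = I" using I assms by auto
    show "insert i (I - {j}) \<in> ?X i j" using sw[OF I] assms by auto
    have "sum l (insert i (I - {j})) = l i + (sum l I - l j)"
      using I \<open>finite I\<close> by (simp add: sum_diff1)
    then show "1 / (sum l (insert i (I - {j})) + l j - l i) = 1 / sum l I" by simp
  next
    fix I assume I: "I \<in> ?X i j"
    show "insert i (insert j (I - {i}) - {j}) = I" using I assms by auto
    show "insert j (I - {i}) \<in> ?X j i" using sw[OF I] assms by auto
  qed
  then show ?thesis unfolding split by (simp add: sum_subtractf)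
qed

lemma exchange_positive:
  assumes "p_positive n p l" "I \<in> index_sets n p" "i \<in> I" "j \<notin> I" "j < n"
  shows "sum l I + l j - l i > 0"
proof -
  have I: "I \<subseteq> {..<n}" "card I = p" "finite I" using index_setsD[OF assms(2)] by auto
  have "card (insert j (I - {i})) = card I" using assms(3,4) I(3) card_gt_0_iff[of I] by auto
  then have "insert j (I - {i}) \<in> index_sets n p" using I assms(5) by (auto simp: index_sets_def)
  then have "sum l (insert j (I - {i})) > 0" using assms(1) by (simp add: p_positive_def)
  then show ?thesis using assms(3,4) I(3) by (simp add: sum_diff1)
qed

lemma dlog_coeff_antimono:
  assumes "p_positive n p l" "i < n" "j < n" "l i \<le> l j"
  shows "dlog_coeff n p l j \<le> dlog_coeff n p l i"
proof (cases "i = j")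
  case False
  have "1 / sum l I - 1 / (sum l I + l j - l i) \<ge> 0"
    if "I \<in> index_sets n p" "i \<in> I" "j \<notin> I" for I
    using exchange_positive[OF assms(1) that assms(3)] assms(1,4) that(1)
    by (auto simp: p_positive_def intro!: divide_left_mono mult_pos_pos)
  then have "dlog_coeff n p l i - dlog_coeff n p l j \<ge> 0"
    unfolding exchange_difference[OF assms(2,3) False] by (intro sum_nonneg) auto
  then show ?thesis by simp
qed simp

text \<open>For a set \<open>I\<close> containing \<open>i\<close> whose sum is small, exchanging \<open>i\<close> for the top index \<open>j\<close> gives a sum of at most
\<open>3/2 * l j\<close>.  The resulting factor 3/2, being strictly below 2, is what later leaves room for the
error terms of the maximum principle.\<close>

lemma dlog_coeff_exchange_lower_bound:
  assumes pos: "p_positive n p l" and ij: "i < n" "j < n" "l i \<le> l j" "l j > 0"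
    and low: "l i \<ge> - (l j / 4)" and top: "\<And>I. I \<in> index_sets n p \<Longrightarrow> j \<in> I \<Longrightarrow> sum l I \<ge> l j / 2"
  shows "(l j - l i) * (\<Sum>I | I \<in> index_sets n p \<and> i \<in> I \<and> sum l I \<le> l j / 4. 1 / sum l I)
     \<le> (3 / 2) * l j * (dlog_coeff n p l i - dlog_coeff n p l j)"
proof (cases "i = j")
  case False
  let ?S = "{I. I \<in> index_sets n p \<and> i \<in> I \<and> sum l I \<le> l j / 4}"
  let ?X = "{I. I \<in> index_sets n p \<and> i \<in> I \<and> j \<notin> I}"
  let ?h = "\<lambda>I. 1 / sum l I - 1 / (sum l I + l j - l i)"
  have notin: "j \<notin> I" if "I \<in> ?S" for I
    using that top[of I] ij(4) by fastforce
  have "(l j - l i) * (\<Sum>I\<in>?S. 1 / sum l I) = (\<Sum>I\<in>?S. (l j - l i) * (1 / sum l I))"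
    by (rule sum_distrib_left)
  also have "\<dots> \<le> (\<Sum>I\<in>?S. (3 / 2) * l j * ?h I)"
  proof (rule sum_mono)
    fix I assume I: "I \<in> ?S"
    have a: "sum l I > 0" using I pos by (simp add: p_positive_def)
    have b: "sum l I + l j - l i > 0"
      using exchange_positive[OF pos _ _ notin[OF I] ij(2)] I by auto
    have c: "sum l I + l j - l i \<le> (3 / 2) * l j" using I low by auto
    have "?h I = (l j - l i) / sum l I / (sum l I + l j - l i)"
      using a b by (simp add: field_simps)
    moreover have "(l j - l i) / sum l I \<le> (3 / 2) * l j * ((l j - l i) / sum l I / (sum l I + l j - l i))"
    proof -
      have "(l j - l i) / sum l I * (sum l I + l j - l i) \<le> (l j - l i) / sum l I * ((3 / 2) * l j)"
        using c a ij(3) by (intro mult_left_mono) auto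
      then have "(l j - l i) / sum l I \<le> (l j - l i) / sum l I * ((3 / 2) * l j) / (sum l I + l j - l i)"
        unfolding pos_le_divide_eq[OF b] .
      then show ?thesis by (simp only: times_divide_eq_right mult.commute)
    qed
    ultimately show "(l j - l i) * (1 / sum l I) \<le> (3 / 2) * l j * ?h I" by simp
  qed
  also have "\<dots> = (3 / 2) * l j * (\<Sum>I\<in>?S. ?h I)" by (rule sum_distrib_left[symmetric])
  also have "\<dots> \<le> (3 / 2) * l j * (\<Sum>I\<in>?X. ?h I)"
  proof (intro mult_left_mono sum_mono2)
    show "?S \<subseteq> ?X" using notin by auto
    fix I assume "I \<in> ?X - ?S"
    then have "I \<in> index_sets n p" "i \<in> I" "j \<notin> I" by auto
    then show "0 \<le> ?h I"
      using exchange_positive[OF pos _ _ _ ij(2)] ij(3) pos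
      by (auto simp: p_positive_def intro!: divide_left_mono mult_pos_pos)
  qed (use ij in auto)
  finally show ?thesis unfolding exchange_difference[OF ij(1,2) False] .
qed simp

lemma p_log_sum_le_tangent:
  assumes "p_positive n p l" "p_positive n p m"
  shows "(\<Sum>I\<in>index_sets n p. ln (sum m I))
     \<le> (\<Sum>I\<in>index_sets n p. ln (sum l I)) + (\<Sum>i<n. dlog_coeff n p l i * (m i - l i))"
proof -
  have "ln (sum m I) \<le> ln (sum l I) + (\<Sum>i\<in>I. m i - l i) / sum l I" if "I \<in> index_sets n p" for I
  proof -
    have a: "sum m I > 0" "sum l I > 0" using assms that by (auto simp: p_positive_def)
    then have "ln (sum m I / sum l I) \<le> sum m I / sum l I - 1" by (intro ln_le_minus_one) simp
    then show ?thesis using a by (simp add: ln_div sum_subtractf diff_divide_distrib)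
  qed
  then show ?thesis unfolding dlog_coeff_sum sum.distrib[symmetric] by (rule sum_mono)
qed

lemma ln_p_sum_prod:
  fixes A :: "real^'n^'n"
  assumes "p_positive CARD('n) p (\<lambda>i. eigvals A ! i)"
  shows "ln (p_sum_prod p A) = (\<Sum>I\<in>index_sets CARD('n) p. ln (\<Sum>i\<in>I. eigvals A ! i))"
  unfolding p_sum_prod_def using assms by (subst ln_prod) (auto simp: p_positive_def)

text \<open>Concavity of the operator in a form that involves only diagonal entries with respect to a frame.
Concavity of the logarithm compares \<open>l\<close> with the eigenvalues of \<open>A\<close>, and \<open>weighted_trace_ge_eigenvalues\<close>
replaces the latter by the diagonal entries; it applies since the weights decrease when \<open>l\<close> increases.\<close>

theorem ln_p_sum_prod_le_tangent:
  fixes A :: "real^'n^'n"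
  assumes "transpose A = A" "orthonormal_frame q" "p_positive CARD('n) p (\<lambda>i. eigvals A ! i)"
    and l: "p_positive CARD('n) p l" "\<And>i j. i \<le> j \<Longrightarrow> j < CARD('n) \<Longrightarrow> l i \<le> l j"
  shows "ln (p_sum_prod p A) \<le> (\<Sum>I\<in>index_sets CARD('n) p. ln (sum l I))
     + (\<Sum>i<CARD('n). dlog_coeff CARD('n) p l i * (q i \<bullet> (A *v q i) - l i))"
proof -
  have "(\<Sum>i<CARD('n). dlog_coeff CARD('n) p l i * eigvals A ! i)
    \<le> (\<Sum>i<CARD('n). dlog_coeff CARD('n) p l i * (q i \<bullet> (A *v q i)))"
    by (rule weighted_trace_ge_eigenvalues[OF assms(1,2)])
      (use dlog_coeff_antimono[OF l(1)] l(2) in auto)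
  then have "(\<Sum>i<CARD('n). dlog_coeff CARD('n) p l i * (eigvals A ! i - l i))
     \<le> (\<Sum>i<CARD('n). dlog_coeff CARD('n) p l i * (q i \<bullet> (A *v q i) - l i))"
    by (simp add: right_diff_distrib sum_subtractf)
  then show ?thesis
    using p_log_sum_le_tangent[OF l(1) assms(3)] unfolding ln_p_sum_prod[OF assms(3)] by linarith
qed

text \<open>The factors cannot all exceed \<open>F\<close>.\<close>

lemma inverse_sum_lower_bound:
  assumes "p_positive n p l" "index_sets n p \<noteq> {}" "(\<Prod>I\<in>index_sets n p. sum l I) \<le> F" "F \<ge> 1"
  shows "1 / F \<le> (\<Sum>I\<in>index_sets n p. 1 / sum l I)"
proof -
  have "\<exists>I\<in>index_sets n p. sum l I \<le> F"
  proof (rule ccontr)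
    assume "\<not> ?thesis"
    then have a: "\<And>I. I \<in> index_sets n p \<Longrightarrow> F < sum l I" by auto
    obtain J where J: "J \<in> index_sets n p" using assms(2) by blast
    have "1 * sum l J \<le> (\<Prod>I\<in>index_sets n p - {J}. sum l I) * sum l J"
      using a J assms(4) by (intro mult_right_mono prod_ge_1) (force intro: less_imp_le)+
    also have "\<dots> = (\<Prod>I\<in>index_sets n p. sum l I)"
      using J by (simp add: prod.remove[of _ J] mult.commute)
    finally show False using assms(3) a[OF J] by simp
  qed
  then obtain I where I: "I \<in> index_sets n p" "sum l I \<le> F" by blast
  have "1 / F \<le> 1 / sum l I" using I assms(1) by (auto simp: p_positive_def frac_le)
  also have "\<dots> \<le> (\<Sum>I\<in>index_sets n p. 1 / sum l I)"
    using I assms(1) by (intro member_le_sum) (auto simp: p_positive_def less_imp_le)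
  finally show ?thesis .
qed

lemma card_index_sets: "card (index_sets n p) = n choose p"
  unfolding index_sets_def using n_subsets[of "{..<n}" p] by simp

lemma card_index_sets_avoiding_last:
  assumes "0 < n"
  shows "card {I \<in> index_sets n p. n - 1 \<notin> I} = (n - 1) choose p"
proof -
  have "{I \<in> index_sets n p. n - 1 \<notin> I} = index_sets (n - 1) p"
  proof -
    have "I \<subseteq> {..<n} \<and> n - 1 \<notin> I \<longleftrightarrow> I \<subseteq> {..<n - 1}" for I
      using assms by (auto simp: subset_eq Ball_def) (metis Suc_pred less_SucE)
    then show ?thesis unfolding index_sets_def by blast
  qed
  then show ?thesis by (simp add: card_index_sets)
qed

text \<open>By Pascal's rule these cardinalities are neighbouring binomial coefficients in row \<open>n - 1\<close>, at or to the
right of the middle of the row when \<open>n \<le> 2 p\<close>.\<close>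

lemma half_dimension_index_sets:
  assumes "1 \<le> p" "p < n" "n \<le> 2 * p"
  shows "card {I \<in> index_sets n p. n - 1 \<notin> I} \<le> card {I \<in> index_sets n p. n - 1 \<in> I}"
    "1 \<le> card {I \<in> index_sets n p. n - 1 \<notin> I}"
proof -
  let ?N = "{I \<in> index_sets n p. n - 1 \<notin> I}" and ?T = "{I \<in> index_sets n p. n - 1 \<in> I}"
  have N: "card ?N = (n - 1) choose p" using card_index_sets_avoiding_last assms by simp
  have "index_sets n p = ?T \<union> ?N" by auto
  then have "card (index_sets n p) = card ?T + card ?N"
    using card_Un_disjoint[of ?T ?N] by auto
  moreover have "n choose p = (n - 1 choose (p - 1)) + (n - 1 choose p)"
    using choose_reduce_nat[of n p] assms by simp
  ultimately have T: "card ?T = (n - 1) choose (p - 1)" using N card_index_sets[of n p] by simp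
  show "card ?N \<le> card ?T" unfolding N T by (rule binomial_antimono) (use assms in auto)
  show "1 \<le> card ?N" unfolding N using assms zero_less_binomial[of p "n - 1"] by linarith
qed

text \<open>The sets containing the last index contribute a factor of order \<open>l (n - 1)\<close> each to the product.  They are at least as numerous
as the others, so one of the other factors is at most a constant times the inverse of \<open>l (n - 1)\<close>.\<close>

theorem inverse_sum_ge_top:
  assumes "1 \<le> p" "p < n" "n \<le> 2 * p" and pos: "p_positive n p l"
    and F: "(\<Prod>I\<in>index_sets n p. sum l I) \<le> F" "F \<ge> 0" and l1: "l (n - 1) \<ge> 1"
    and top: "\<And>I. I \<in> index_sets n p \<Longrightarrow> n - 1 \<in> I \<Longrightarrow> sum l I \<ge> l (n - 1) / 2"
  shows "l (n - 1) / (1 + 2 ^ card (index_sets n p) * F) \<le> (\<Sum>I\<in>index_sets n p. 1 / sum l I)"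
proof (rule ccontr)
  let ?N = "{I \<in> index_sets n p. n - 1 \<notin> I}" and ?T = "{I \<in> index_sets n p. n - 1 \<in> I}"
  define K where "K = 1 + 2 ^ card (index_sets n p) * F"
  define x where "x = l (n - 1)"
  define Tr where "Tr = (\<Sum>I\<in>index_sets n p. 1 / sum l I)"
  assume "\<not> ?thesis"
  then have lt: "Tr < x / K" by (simp add: K_def x_def Tr_def)
  have K1: "K \<ge> 1" using F(2) by (simp add: K_def)
  have x1: "x \<ge> 1" using l1 by (simp add: x_def)
  have a: "K / x \<le> sum l I" if "I \<in> index_sets n p" for I
  proof -
    have p0: "sum l I > 0" using pos that by (simp add: p_positive_def)
    have "1 / sum l I \<le> Tr" unfolding Tr_def
      using that pos by (intro member_le_sum) (auto simp: p_positive_def less_imp_le)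
    with lt have "1 / sum l I < x / K" by simp
    then show ?thesis using p0 K1 x1 by (simp add: field_simps)
  qed
  have ba: "card ?N \<le> card ?T" "1 \<le> card ?N" using half_dimension_index_sets[OF assms(1-3)] by auto
  have "(\<Prod>I\<in>?T. x / 2) \<le> (\<Prod>I\<in>?T. sum l I)"
    using top x1 by (intro prod_mono) (auto simp: x_def)
  then have T: "(x / 2) ^ card ?T \<le> (\<Prod>I\<in>?T. sum l I)" by (simp only: prod_constant)
  have "(\<Prod>I\<in>?N. K / x) \<le> (\<Prod>I\<in>?N. sum l I)"
    using a x1 K1 by (intro prod_mono) auto
  then have N: "(K / x) ^ card ?N \<le> (\<Prod>I\<in>?N. sum l I)" by (simp only: prod_constant)
  have nn: "0 \<le> (K / x) ^ card ?N" "0 \<le> (x / 2) ^ card ?T" using x1 K1 by simp_all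
  have "(x / 2) ^ card ?T * (K / x) ^ card ?N \<le> (\<Prod>I\<in>?T. sum l I) * (\<Prod>I\<in>?N. sum l I)"
    by (rule mult_mono[OF T N order_trans[OF nn(2) T] nn(1)])
  also have "\<dots> = (\<Prod>I\<in>index_sets n p. sum l I)"
  proof -
    have "index_sets n p = ?T \<union> ?N" by auto
    then show ?thesis by (subst prod.union_disjoint[symmetric]) auto
  qed
  also note F(1)
  finally have 1: "(x / 2) ^ card ?T * (K / x) ^ card ?N \<le> F" .
  have "K / 2 ^ card (index_sets n p) \<le> (x / 2) ^ card ?T * (K / x) ^ card ?N"
  proof -
    have "K * x ^ card ?N \<le> K ^ card ?N * x ^ card ?T"
      using ba K1 x1 by (intro mult_mono power_increasing) (auto intro!: self_le_power)
    then have "K \<le> K ^ card ?N * x ^ card ?T / x ^ card ?N"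
      using x1 by (simp add: pos_le_divide_eq)
    moreover have "(2::real) ^ card ?T \<le> 2 ^ card (index_sets n p)"
      by (intro power_increasing card_mono) auto
    ultimately have "K / 2 ^ card (index_sets n p) \<le> (K ^ card ?N * x ^ card ?T / x ^ card ?N) / 2 ^ card ?T"
      using K1 by (intro frac_le) auto
    then show ?thesis by (simp add: power_divide field_simps)
  qed
  with 1 have "K / 2 ^ card (index_sets n p) \<le> F" by linarith
  then show False unfolding K_def by (simp add: field_simps)
qed

lemma dlog_coeff_total:
  "(\<Sum>i<n. dlog_coeff n p l i) = real p * (\<Sum>I\<in>index_sets n p. 1 / sum l I)"
  using dlog_coeff_sum[of n p l "\<lambda>_. 1"] by (simp add: index_setsD sum_distrib_left)

lemma dlog_coeff_euler:
  assumes "p_positive n p l"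
  shows "(\<Sum>i<n. dlog_coeff n p l i * l i) = real (card (index_sets n p))"
  unfolding dlog_coeff_sum using assms by (simp add: p_positive_def less_imp_neq[symmetric])

section \<open>Second order jets and Hessians\<close>

text \<open>The first two derivatives at 0 of a function of one variable.  The rules below compute the jet of a composite
expression without spelling out its derivative away from 0.\<close>

definition jet2 :: "(real \<Rightarrow> real) \<Rightarrow> real \<Rightarrow> real \<Rightarrow> bool" where
  "jet2 f d1 d2 \<longleftrightarrow> (\<exists>f'. (\<forall>\<^sub>F t in nhds 0. (f has_real_derivative f' t) (at t)) \<and>
     f' 0 = d1 \<and> (f' has_real_derivative d2) (at 0))"

lemma jet2I:
  assumes "\<forall>\<^sub>F t in nhds 0. (f has_real_derivative f' t) (at t)" "f' 0 = d1"
    "(f' has_real_derivative d2) (at 0)"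
  shows "jet2 f d1 d2"
  using assms unfolding jet2_def by blast

lemma jet2_derivative: "jet2 f d1 d2 \<Longrightarrow> (f has_real_derivative d1) (at 0)"
  unfolding jet2_def using eventually_nhds_x_imp_x by blast

lemma jet2_tendsto: "jet2 f d1 d2 \<Longrightarrow> (f \<longlongrightarrow> f 0) (nhds 0)"
  using DERIV_isCont[OF jet2_derivative] unfolding isCont_def tendsto_at_iff_tendsto_nhds by blast

lemma jet2_const [intro]: "jet2 (\<lambda>t. c) 0 0"
  by (rule jet2I[where f' = "\<lambda>_. 0"]) auto

lemma jet2_affine [intro]: "jet2 (\<lambda>t. a + t * b) b 0"
  by (rule jet2I[where f' = "\<lambda>_. b"]) (auto intro!: always_eventually allI derivative_eq_intros)

lemma jet2_add:
  assumes "jet2 f a1 a2" "jet2 g b1 b2"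
  shows "jet2 (\<lambda>t. f t + g t) (a1 + b1) (a2 + b2)"
proof -
  obtain f' where f: "\<forall>\<^sub>F t in nhds 0. (f has_real_derivative f' t) (at t)" "f' 0 = a1"
    "(f' has_real_derivative a2) (at 0)" using assms(1) jet2_def by blast
  obtain g' where g: "\<forall>\<^sub>F t in nhds 0. (g has_real_derivative g' t) (at t)" "g' 0 = b1"
    "(g' has_real_derivative b2) (at 0)" using assms(2) jet2_def by blast
  show ?thesis
  proof (rule jet2I[where f' = "\<lambda>t. f' t + g' t"])
    show "\<forall>\<^sub>F t in nhds 0. ((\<lambda>t. f t + g t) has_real_derivative f' t + g' t) (at t)"
      using f(1) g(1) by eventually_elim (rule DERIV_add)
  qed (use f g in \<open>auto intro: DERIV_add\<close>)
qed

lemma jet2_mult: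
  assumes "jet2 f a1 a2" "jet2 g b1 b2"
  shows "jet2 (\<lambda>t. f t * g t) (a1 * g 0 + f 0 * b1) (a2 * g 0 + 2 * a1 * b1 + f 0 * b2)"
proof -
  obtain f' where f: "\<forall>\<^sub>F t in nhds 0. (f has_real_derivative f' t) (at t)" "f' 0 = a1"
    "(f' has_real_derivative a2) (at 0)" using assms(1) jet2_def by blast
  obtain g' where g: "\<forall>\<^sub>F t in nhds 0. (g has_real_derivative g' t) (at t)" "g' 0 = b1"
    "(g' has_real_derivative b2) (at 0)" using assms(2) jet2_def by blast
  have fg: "(f has_real_derivative a1) (at 0)" "(g has_real_derivative b1) (at 0)"
    using assms by (auto intro: jet2_derivative)
  show ?thesis
  proof (rule jet2I[where f' = "\<lambda>t. f' t * g t + g' t * f t"])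
    show "\<forall>\<^sub>F t in nhds 0. ((\<lambda>t. f t * g t) has_real_derivative f' t * g t + g' t * f t) (at t)"
      using f(1) g(1) by eventually_elim (rule DERIV_mult)
    have "((\<lambda>t. f' t * g t + g' t * f t) has_real_derivative
        (a2 * g 0 + b1 * f' 0) + (b2 * f 0 + a1 * g' 0)) (at 0)"
      by (intro DERIV_add DERIV_mult f g fg)
    then show "((\<lambda>t. f' t * g t + g' t * f t) has_real_derivative
        a2 * g 0 + 2 * a1 * b1 + f 0 * b2) (at 0)"
      by (simp add: f g algebra_simps)
  qed (use f g in simp)
qed

lemma jet2_cmult: "jet2 f a1 a2 \<Longrightarrow> jet2 (\<lambda>t. c * f t) (c * a1) (c * a2)"
  using jet2_mult[OF jet2_const[of c], of f a1 a2] by simp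

lemma jet2_sum:
  "(\<And>i. i \<in> I \<Longrightarrow> jet2 (f i) (a1 i) (a2 i)) \<Longrightarrow>
     jet2 (\<lambda>t. \<Sum>i\<in>I. f i t) (\<Sum>i\<in>I. a1 i) (\<Sum>i\<in>I. a2 i)"
  by (induction I rule: infinite_finite_induct) (auto intro: jet2_add)

lemma jet2_chain:
  assumes f: "jet2 f a1 a2" and G: "\<forall>\<^sub>F y in nhds (f 0). (G has_real_derivative G' y) (at y)"
    "(G' has_real_derivative g2) (at (f 0))"
  shows "jet2 (\<lambda>t. G (f t)) (G' (f 0) * a1) (g2 * a1\<^sup>2 + G' (f 0) * a2)"
proof -
  obtain f' where f': "\<forall>\<^sub>F t in nhds 0. (f has_real_derivative f' t) (at t)" "f' 0 = a1"
    "(f' has_real_derivative a2) (at 0)" using f jet2_def by blast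
  have "\<forall>\<^sub>F t in nhds 0. (G has_real_derivative G' (f t)) (at (f t))"
    using jet2_tendsto[OF f] G(1) unfolding filterlim_iff by blast
  then have "\<forall>\<^sub>F t in nhds 0. ((\<lambda>t. G (f t)) has_real_derivative G' (f t) * f' t) (at t)"
    using f'(1) by eventually_elim (rule DERIV_chain2)
  moreover have "((\<lambda>t. G' (f t) * f' t) has_real_derivative g2 * a1 * f' 0 + a2 * G' (f 0)) (at 0)"
    by (intro DERIV_mult DERIV_chain2[where f = G'] G(2) jet2_derivative[OF f] f'(3))
  ultimately show ?thesis
    using f'(2) by (intro jet2I[where f' = "\<lambda>t. G' (f t) * f' t"]) (auto simp: power2_eq_square algebra_simps)
qed

lemma jet2_ln:
  assumes "jet2 f a1 a2" "f 0 > 0"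
  shows "jet2 (\<lambda>t. ln (f t)) (a1 / f 0) (a2 / f 0 - (a1 / f 0)\<^sup>2)"
proof -
  have ev: "\<forall>\<^sub>F y in nhds (f 0). (ln has_real_derivative inverse y) (at y)"
  proof (rule eventually_mono)
    show "\<forall>\<^sub>F y in nhds (f 0). y \<in> {0<..}"
      using assms(2) by (intro eventually_nhds_in_open) auto
  qed (auto intro: DERIV_ln)
  have "(inverse has_real_derivative - (inverse (f 0) ^ 2)) (at (f 0))"
    using assms(2) DERIV_inverse[of "f 0"] by (simp add: numeral_2_eq_2)
  from jet2_chain[OF assms(1) ev this] show ?thesis
    by (simp add: field_simps)
qed

lemma jet2_cong:
  assumes "jet2 f a1 a2" "\<forall>\<^sub>F t in nhds 0. f t = g t"
  shows "jet2 g a1 a2"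
proof -
  obtain f' where f: "\<forall>\<^sub>F t in nhds 0. (f has_real_derivative f' t) (at t)" "f' 0 = a1"
    "(f' has_real_derivative a2) (at 0)" using assms(1) jet2_def by blast
  have "\<forall>\<^sub>F t in nhds 0. \<forall>\<^sub>F s in nhds t. f s = g s"
    using assms(2) by (simp add: eventually_eventually)
  then have "\<forall>\<^sub>F t in nhds 0. (g has_real_derivative f' t) (at t)"
    using f(1) by eventually_elim (simp add: DERIV_cong_ev)
  then show ?thesis using f by (intro jet2I)
qed

text \<open>The form in which the first and second order conditions at a maximum are used.\<close>

lemma jet2_local_max:
  assumes "jet2 f a1 a2" "\<forall>\<^sub>F t in nhds 0. f t \<le> f 0"
  shows "a1 = 0" "a2 \<le> 0"
proof -
  obtain f' where f: "\<forall>\<^sub>F t in nhds 0. (f has_real_derivative f' t) (at t)" "f' 0 = a1"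
    "(f' has_real_derivative a2) (at 0)" using assms(1) jet2_def by blast
  have "\<forall>\<^sub>F t in nhds 0. (f has_real_derivative f' t) (at t) \<and> f t \<le> f 0"
    using f(1) assms(2) by (rule eventually_conj)
  then obtain \<epsilon> where "\<epsilon> > 0"
    "\<And>t. \<bar>t\<bar> < \<epsilon> \<Longrightarrow> (f has_real_derivative f' t) (at t) \<and> f t \<le> f 0"
    unfolding eventually_nhds_metric by (auto simp: dist_real_def)
  then show "a1 = 0" "a2 \<le> 0"
    using local_max_second_derivative[of \<epsilon> f f' a2] f by auto
qed

text \<open>The second derivative of a function along a curve, given the jets of the coordinates of the curve.\<close>

lemma jet2_curve:
  fixes \<gamma> :: "real \<Rightarrow> 'a::euclidean_space"
  assumes U: "open U" "\<gamma> 0 \<in> U" "Ck_dir 2 U f"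
    and \<gamma>: "\<And>b. b \<in> Basis \<Longrightarrow> jet2 (\<lambda>t. \<gamma> t \<bullet> b) (v1 \<bullet> b) (v2 \<bullet> b)"
  shows "jet2 (\<lambda>t. f (\<gamma> t)) (pd v1 f (\<gamma> 0))
    (pd v2 f (\<gamma> 0) + (\<Sum>b\<in>Basis. (v1 \<bullet> b) * pd v1 (pd b f) (\<gamma> 0)))"
proof -
  have "\<forall>b\<in>Basis. \<exists>g'. (\<forall>\<^sub>F t in nhds 0. ((\<lambda>t. \<gamma> t \<bullet> b) has_real_derivative g' t) (at t)) \<and>
     g' 0 = v1 \<bullet> b \<and> (g' has_real_derivative v2 \<bullet> b) (at 0)"
    using \<gamma> unfolding jet2_def by blast
  then obtain g' where g': "\<And>b. b \<in> Basis \<Longrightarrow> \<forall>\<^sub>F t in nhds 0. ((\<lambda>t. \<gamma> t \<bullet> b) has_real_derivative g' b t) (at t)"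
    "\<And>b. b \<in> Basis \<Longrightarrow> g' b 0 = v1 \<bullet> b" "\<And>b. b \<in> Basis \<Longrightarrow> (g' b has_real_derivative v2 \<bullet> b) (at 0)"
    unfolding bchoice_iff by blast
  define V where "V t = (\<Sum>b\<in>Basis. g' b t *\<^sub>R b)" for t
  have \<gamma>d: "\<forall>\<^sub>F t in nhds 0. (\<gamma> has_vector_derivative V t) (at t)"
  proof -
    have "\<forall>\<^sub>F t in nhds 0. \<forall>b\<in>Basis. ((\<lambda>t. \<gamma> t \<bullet> b) has_real_derivative g' b t) (at t)"
      using g'(1) by (intro eventually_ball_finite) auto
    then show ?thesis
    proof eventually_elim
      case (elim t)
      have "((\<lambda>t. \<Sum>b\<in>Basis. (\<gamma> t \<bullet> b) *\<^sub>R b) has_vector_derivative V t) (at t)"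
        unfolding V_def
      proof (rule has_vector_derivative_sum)
        fix b :: 'a assume "b \<in> Basis"
        then show "((\<lambda>t. (\<gamma> t \<bullet> b) *\<^sub>R b) has_vector_derivative g' b t *\<^sub>R b) (at t)"
          using has_vector_derivative_scaleR[of "\<lambda>t. \<gamma> t \<bullet> b" "g' b t" t UNIV "\<lambda>_. b" 0] elim by simp
      qed
      then show ?case by (simp add: euclidean_representation)
    qed
  qed
  have lim: "(\<gamma> \<longlongrightarrow> \<gamma> 0) (nhds 0)"
    using eventually_nhds_x_imp_x[OF \<gamma>d] has_vector_derivative_continuous
    unfolding isCont_def tendsto_at_iff_tendsto_nhds[symmetric] continuous_within by blast
  then have inU: "\<forall>\<^sub>F t in nhds 0. \<gamma> t \<in> U"
    using U(1,2) unfolding tendsto_def by blast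
  have d1: "f differentiable (at x)" and d2: "pd b f differentiable (at x)" if "x \<in> U" for x b
    using U(3) that by (auto simp: numeral_2_eq_2)
  let ?F = "\<lambda>t. \<Sum>b\<in>Basis. g' b t * pd b f (\<gamma> t)"
  have V: "V t \<bullet> b = g' b t" if "b \<in> Basis" for t b
    using that by (simp add: V_def inner_sum_left inner_Basis if_distrib cong: if_cong)
  have V0: "V 0 = v1" by (rule euclidean_eqI) (simp only: V g'(2))
  show ?thesis
  proof (rule jet2I[where f' = ?F])
    show "\<forall>\<^sub>F t in nhds 0. ((\<lambda>t. f (\<gamma> t)) has_real_derivative ?F t) (at t)"
      using \<gamma>d inU
    proof eventually_elim
      case (elim t)
      have "?F t = pd (V t) f (\<gamma> t)"
        using partial_deriv_expand[OF d1[OF elim(2)], of "V t"] V by simp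
      then show ?case using partial_deriv_curve[OF d1[OF elim(2)] elim(1)] by simp
    qed
    show "?F 0 = pd v1 f (\<gamma> 0)"
      using partial_deriv_expand[OF d1[OF U(2)], of v1] g'(2) by simp
    have \<gamma>0: "(\<gamma> has_vector_derivative v1) (at 0)"
      using eventually_nhds_x_imp_x[OF \<gamma>d] V0 by simp
    have "(?F has_real_derivative (\<Sum>b\<in>Basis. (v2 \<bullet> b) * pd b f (\<gamma> 0)
        + pd v1 (pd b f) (\<gamma> 0) * g' b 0)) (at 0)"
      by (intro DERIV_sum DERIV_mult g'(3) partial_deriv_curve d2 U(2) \<gamma>0)
    also have "(\<Sum>b\<in>Basis. (v2 \<bullet> b) * pd b f (\<gamma> 0)
        + pd v1 (pd b f) (\<gamma> 0) * g' b 0)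
      = pd v2 f (\<gamma> 0) + (\<Sum>b\<in>Basis. (v1 \<bullet> b) * pd v1 (pd b f) (\<gamma> 0))"
      unfolding partial_deriv_expand[OF d1[OF U(2)], of v2] sum.distrib
      using g'(2) by (simp add: mult.commute)
    finally show "(?F has_real_derivative pd v2 f (\<gamma> 0)
      + (\<Sum>b\<in>Basis. (v1 \<bullet> b) * pd v1 (pd b f) (\<gamma> 0))) (at 0)" .
  qed
qed

lemma eventually_line:
  fixes y :: "'a::real_normed_vector"
  assumes "eventually P (nhds x)"
  shows "\<forall>\<^sub>F t in nhds 0. P (x + t *\<^sub>R y)"
proof -
  have "((\<lambda>t. x + t *\<^sub>R y) \<longlongrightarrow> x + 0 *\<^sub>R y) (nhds 0)"
    by (intro tendsto_intros) (simp add: filterlim_ident)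
  then show ?thesis using assms unfolding filterlim_iff by simp
qed

lemma eventually_line_in_open:
  fixes y :: "'a::real_normed_vector"
  assumes "open U" "x \<in> U"
  shows "\<forall>\<^sub>F t in nhds 0. x + t *\<^sub>R y \<in> U"
  by (rule eventually_line[OF eventually_nhds_in_open[OF assms]])

lemma jet2_line:
  assumes "open U" "x \<in> U" "Ck_dir 2 U g"
  shows "jet2 (\<lambda>t. g (x + t *\<^sub>R y)) (pd y g x) (pd y (pd y g) x)"
proof (rule jet2I[where f' = "\<lambda>t. pd y g (x + t *\<^sub>R y)"])
  have d: "g differentiable (at z)" "pd y g differentiable (at z)" if "z \<in> U" for z
    using assms(3) that by (auto simp: numeral_2_eq_2)
  show "\<forall>\<^sub>F t in nhds 0. ((\<lambda>t. g (x + t *\<^sub>R y)) has_real_derivative pd y g (x + t *\<^sub>R y)) (at t)"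
    using eventually_line_in_open[OF assms(1,2)]
    by eventually_elim (auto intro: partial_deriv_line d)
  show "((\<lambda>t. pd y g (x + t *\<^sub>R y)) has_real_derivative pd y (pd y g) x) (at 0)"
    using partial_deriv_line[of "pd y g" x 0 y] d(2)[OF assms(2)] by simp
qed simp

lemma partial_deriv_vec:
  fixes g :: "real^'n \<Rightarrow> real"
  assumes "g differentiable (at x)"
  shows "pd y g x = (\<Sum>i\<in>UNIV. y $ i * pd (axis i 1) g x)"
proof -
  have "pd y g x = pd (\<Sum>i\<in>UNIV. y $ i *\<^sub>R axis i 1) g x"
    using basis_expansion[of y] by (simp add: scalar_mult_eq_scaleR)
  then show ?thesis
    by (simp only: linear_sum[OF partial_deriv_linear[OF assms]]
        linear_scale[OF partial_deriv_linear[OF assms]] real_scaleR_def)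
qed

lemma partial_deriv_grad:
  assumes "g differentiable (at x)"
  shows "pd y g x = grad g x \<bullet> y"
  unfolding partial_deriv_vec[OF assms, of y] grad_def by (simp add: inner_vec_def mult.commute)

lemma partial_deriv_inner_arg:
  fixes g :: "real^'n \<Rightarrow> real"
  assumes "open U" "x \<in> U" "Ck_dir 2 U g"
  shows "pd y (pd z g) x
    = (\<Sum>j\<in>UNIV. z $ j * pd y (pd (axis j 1) g) x)"
proof -
  have d: "g differentiable (at w)" "pd e g differentiable (at w)" if "w \<in> U" for w e
    using assms(3) that by (auto simp: numeral_2_eq_2)
  have "pd y (pd z g) x
      = pd y (\<lambda>w. \<Sum>j\<in>UNIV. z $ j * pd (axis j 1) g w) x"
    by (rule partial_deriv_cong_open[OF assms(1,2)]) (rule partial_deriv_vec[OF d(1)])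
  then show ?thesis using d(2)[OF assms(2)] by (simp only: partial_deriv_sum)
qed

lemma hessian_bilinear:
  assumes "open U" "x \<in> U" "Ck_dir 2 U g"
  shows "y \<bullet> (hessian g x *v z) = pd y (pd z g) x"
proof -
  have d: "pd z g differentiable (at x)"
    using assms(2,3) by (auto simp: numeral_2_eq_2)
  have "y \<bullet> (hessian g x *v z)
      = (\<Sum>i\<in>UNIV. y $ i * (\<Sum>j\<in>UNIV. z $ j * pd (axis i 1) (pd (axis j 1) g) x))"
    by (simp add: hessian_def inner_vec_def matrix_vector_mult_def mult.commute)
  also have "\<dots> = (\<Sum>i\<in>UNIV. y $ i * pd (axis i 1) (pd z g) x)"
    by (simp only: partial_deriv_inner_arg[OF assms, of _ z])
  also have "\<dots> = pd y (pd z g) x"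
    by (rule partial_deriv_vec[OF d, symmetric])
  finally show ?thesis .
qed

lemma hessian_symmetric:
  assumes "open U" "x \<in> U" "Ck_dir 2 U g"
  shows "transpose (hessian g x) = hessian g x"
  unfolding hessian_def transpose_def
  using partial_deriv_commute[OF assms] by (simp add: vec_eq_iff)

lemma jet2_hessian:
  assumes "open U" "x \<in> U" "Ck_dir 4 U g"
  shows "jet2 (\<lambda>t. y \<bullet> (hessian g (x + t *\<^sub>R e) *v z))
     (pd e (pd y (pd z g)) x)
     (pd e (pd e (pd y (pd z g))) x)"
proof (rule jet2_cong)
  have "Ck_dir 2 U (pd y (pd z g))"
    using assms(3) by (simp add: eval_nat_numeral)
  then show "jet2 (\<lambda>t. pd y (pd z g) (x + t *\<^sub>R e))
     (pd e (pd y (pd z g)) x)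
     (pd e (pd e (pd y (pd z g))) x)"
    by (rule jet2_line[OF assms(1,2)])
  have C2: "Ck_dir 2 U g" using assms(3) by (rule Ck_dir_le) simp
  show "\<forall>\<^sub>F t in nhds 0. pd y (pd z g) (x + t *\<^sub>R e)
      = y \<bullet> (hessian g (x + t *\<^sub>R e) *v z)"
    using eventually_line_in_open[OF assms(1,2)]
    by eventually_elim (rule hessian_bilinear[OF assms(1) _ C2, symmetric])
qed

text \<open>For orthonormal \<open>e\<close> and \<open>f\<close>, rotation by the angle \<open>\<tau>\<close> in their plane and the identity on the orthogonal complement.\<close>

definition rotate_plane :: "'a::real_inner \<Rightarrow> 'a \<Rightarrow> real \<Rightarrow> 'a \<Rightarrow> 'a" where
  "rotate_plane e f \<tau> v = v + (cos \<tau> - 1) *\<^sub>R ((v \<bullet> e) *\<^sub>R e + (v \<bullet> f) *\<^sub>R f)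
      + sin \<tau> *\<^sub>R ((v \<bullet> e) *\<^sub>R f - (v \<bullet> f) *\<^sub>R e)"

lemma rotate_plane_inner:
  assumes "e \<bullet> e = 1" "f \<bullet> f = 1" "e \<bullet> f = 0"
  shows "rotate_plane e f \<tau> v \<bullet> rotate_plane e f \<tau> w = v \<bullet> w"
proof -
  have fe: "f \<bullet> e = 0" using assms(3) by (simp add: inner_commute)
  define a b a' b' where "a = v \<bullet> e" and "b = v \<bullet> f" and "a' = w \<bullet> e" and "b' = w \<bullet> f"
  have cs: "sin \<tau> * sin \<tau> = 1 - cos \<tau> * cos \<tau>"
    using sin_cos_squared_add[of \<tau>] by (simp add: power2_eq_square algebra_simps)
  have "rotate_plane e f \<tau> v \<bullet> rotate_plane e f \<tau> w = v \<bullet> w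
     + 2 * (cos \<tau> - 1) * (a * a' + b * b') + (cos \<tau> - 1)^2 * (a * a' + b * b')
     + sin \<tau> * sin \<tau> * (a * a' + b * b')"
    unfolding rotate_plane_def
    using assms fe by (simp add: inner_add_left inner_add_right inner_diff_left inner_diff_right
      inner_commute[of e w] inner_commute[of f w] a_def[symmetric] b_def[symmetric]
      a'_def[symmetric] b'_def[symmetric] power2_eq_square algebra_simps)
  also have "\<dots> = v \<bullet> w" unfolding cs by (simp add: power2_eq_square algebra_simps)
  finally show ?thesis .
qed

section \<open>The differentiated equation\<close>

lemma partial_deriv_commute_inner:
  assumes "open U" "x \<in> U" "Ck_dir (Suc 2) U g"
  shows "pd a (pd b (pd c g)) x
       = pd a (pd c (pd b g)) x"
  by (rule partial_deriv_cong_open[OF assms(1,2)])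
    (rule partial_deriv_commute[OF assms(1) _ Ck_dir_pred[OF assms(3)]])

lemma jet2_eq_rhs: "jet2 f a b \<Longrightarrow> b = c \<Longrightarrow> jet2 f a c"
  by simp

text \<open>The gain from rotating the frame with angular speed \<open>x\<close>, at its optimal value.  For \<open>d = 0\<close>, that is for a repeated
top eigenvalue, \<open>b / d\<close> is 0, so that there is no rotation and no gain.\<close>

lemma rotation_speed:
  fixes b d :: real
  assumes "x = b / d"
  shows "2 * (d * x\<^sup>2) - 4 * (x * b) = - (2 * (b\<^sup>2 / d))"
  using assms by (cases "d = 0") (auto simp: power2_eq_square field_simps)

text \<open>The curve \<open>r\<close> has the shape of a frame vector under \<open>rotate_plane\<close>: \<open>y\<close> is the projection of \<open>q\<close> to the plane of
rotation and \<open>z\<close> is that projection turned by a right angle.\<close>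

lemma jet2_rotating_quadratic:
  fixes U :: "(real^'n) set" and q y z e :: "real^'n" and \<kappa> :: real
  assumes "open U" "x \<in> U" "Ck_dir 4 U u"
  defines "r \<equiv> \<lambda>t. q + (cos (\<kappa> * t) - 1) *\<^sub>R y + sin (\<kappa> * t) *\<^sub>R z"
  shows "\<exists>d1. jet2 (\<lambda>t. r t \<bullet> (hessian u (x + t *\<^sub>R e) *v r t)) d1
    (pd e (pd e (pd q (pd q u))) x
      - 2 * \<kappa>\<^sup>2 * pd q (pd y u) x
      + 4 * \<kappa> * pd e (pd q (pd z u)) x
      + 2 * \<kappa>\<^sup>2 * pd z (pd z u) x)"
proof -
  let ?h = "\<lambda>a b t. a \<bullet> (hessian u (x + t *\<^sub>R e) *v b)"
  let ?P = "\<lambda>t. cos (\<kappa> * t) - 1" and ?S = "\<lambda>t. sin (\<kappa> * t)"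
  have P: "jet2 ?P 0 (- \<kappa>\<^sup>2)"
    by (rule jet2I[where f' = "\<lambda>t. - \<kappa> * sin (\<kappa> * t)"])
      (auto intro!: always_eventually derivative_eq_intros simp: power2_eq_square)
  have S: "jet2 ?S \<kappa> 0"
    by (rule jet2I[where f' = "\<lambda>t. \<kappa> * cos (\<kappa> * t)"])
      (auto intro!: always_eventually derivative_eq_intros)
  note h = jet2_hessian[OF assms(1-3), of _ e]
  have C2: "Ck_dir 2 U u" using assms(3) by (rule Ck_dir_le) simp
  have C3: "Ck_dir (Suc 2) U u" using assms(3) by (rule Ck_dir_le) simp
  have h0: "a \<bullet> (hessian u x *v b) = pd a (pd b u) x" for a b
    by (rule hessian_bilinear[OF assms(1,2) C2])
  have comm: "pd a (pd b u) x = pd b (pd a u) x" for a b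
    by (rule partial_deriv_commute[OF assms(1,2) C2])
  have "r t \<bullet> (hessian u (x + t *\<^sub>R e) *v r t) = ?h q q t + ?P t * ?h q y t + ?P t * ?h y q t
     + ?S t * ?h q z t + ?S t * ?h z q t + ?P t * (?P t * ?h y y t) + ?P t * (?S t * ?h y z t)
     + ?S t * (?P t * ?h z y t) + ?S t * (?S t * ?h z z t)" for t
    unfolding r_def
    by (simp add: matrix_vector_right_distrib matrix_vector_mult_scaleR inner_add_left inner_add_right algebra_simps)
  then have eq: "(\<lambda>t. r t \<bullet> (hessian u (x + t *\<^sub>R e) *v r t)) = (\<lambda>t. ?h q q t + ?P t * ?h q y t + ?P t * ?h y q t
     + ?S t * ?h q z t + ?S t * ?h z q t + ?P t * (?P t * ?h y y t) + ?P t * (?S t * ?h y z t)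
     + ?S t * (?P t * ?h z y t) + ?S t * (?S t * ?h z z t))" by (rule ext)
  note jets = jet2_add[OF jet2_add[OF jet2_add[OF jet2_add[OF jet2_add[OF jet2_add[OF jet2_add[OF
     jet2_add[OF h[of q q] jet2_mult[OF P h[of q y]]] jet2_mult[OF P h[of y q]]]
     jet2_mult[OF S h[of q z]]] jet2_mult[OF S h[of z q]]] jet2_mult[OF P jet2_mult[OF P h[of y y]]]]
     jet2_mult[OF P jet2_mult[OF S h[of y z]]]] jet2_mult[OF S jet2_mult[OF P h[of z y]]]]
     jet2_mult[OF S jet2_mult[OF S h[of z z]]]]
  show ?thesis unfolding eq
    by (rule exI, rule jet2_eq_rhs[OF jets]) (simp add: h0 comm[of y q]
      partial_deriv_commute_inner[OF assms(1,2) C3, of e z q] power2_eq_square algebra_simps)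
qed

text \<open>A point together with an eigenframe of the Hessian there.  The vector \<open>e\<close> is the top eigenvector, and \<open>L\<close> holds the
coefficients of the linearised operator.\<close>

locale eigenframe_at =
  fixes U :: "(real^'n) set" and u :: "real^'n \<Rightarrow> real" and x0 :: "real^'n" and p :: nat
    and q :: "nat \<Rightarrow> real^'n" and l L :: "nat \<Rightarrow> real" and m :: nat and e :: "real^'n"
  assumes U: "open U" "x0 \<in> U" and u: "Ck_dir 4 U u"
    and positive: "\<And>x. x \<in> U \<Longrightarrow> p_positive CARD('n) p (\<lambda>i. eigvals (hessian u x) ! i)"
    and l: "l = (\<lambda>i. eigvals (hessian u x0) ! i)"
    and frame: "orthonormal_frame q"
    and eigen: "\<And>i. i < CARD('n) \<Longrightarrow> hessian u x0 *v q i = l i *\<^sub>R q i"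
    and L_def: "L = dlog_coeff CARD('n) p l"
    and m: "CARD('n) = Suc m" and e: "e = q m"
begin

lemma C3: "Ck_dir (Suc 2) U u" and C2: "Ck_dir 2 U u"
  using u by (auto intro: Ck_dir_le)

lemma C2_second: "Ck_dir 2 U (pd a (pd b u))"
  using u by (simp add: eval_nat_numeral)

lemma C2_first: "Ck_dir 2 U (pd b u)" "Ck_dir 3 U (pd b u)"
  using Ck_dir_partial[OF u, of b] by (auto intro: Ck_dir_le)

lemma l_mono: "i \<le> j \<Longrightarrow> j < CARD('n) \<Longrightarrow> l i \<le> l j"
  unfolding l using symmetric_eigenframe(1,2)[OF hessian_symmetric[OF U C2]]
  by (simp add: sorted_nth_mono)

lemma l_positive: "p_positive CARD('n) p l"
  using positive[OF U(2)] unfolding l .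

lemma frame_inner: "i < CARD('n) \<Longrightarrow> j < CARD('n) \<Longrightarrow> q i \<bullet> q j = (if i = j then 1 else 0)"
  using frame by (simp add: orthonormal_frame_def)

lemma hessian_frame: "i < CARD('n) \<Longrightarrow> pd y (pd (q i) u) x0 = l i * (y \<bullet> q i)"
  using hessian_bilinear[OF U C2, of y "q i"] eigen by simp

text \<open>The function on the right is a barrier for the left-hand side: for the eigenframe at \<open>x0\<close> both sides vanish.\<close>

lemma tangent_nonneg:
  assumes "orthonormal_frame r" "x \<in> U"
  shows "ln (p_sum_prod p (hessian u x)) - ln (p_sum_prod p (hessian u x0))
     \<le> (\<Sum>i<CARD('n). L i * (r i \<bullet> (hessian u x *v r i) - l i))"
  using ln_p_sum_prod_le_tangent[OF hessian_symmetric[OF U(1) assms(2) C2] assms(1)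
    positive[OF assms(2)] l_positive l_mono] ln_p_sum_prod[OF positive[OF U(2)]] l L_def by simp

text \<open>Along a line through \<open>x0\<close> the difference of the two sides of \<open>tangent_nonneg\<close> has a minimum at \<open>x0\<close>, for every moving frame
that starts as the eigenframe.\<close>

lemma touching:
  assumes jet: "jet2 (\<lambda>t. ln (p_sum_prod p (hessian u (x0 + t *\<^sub>R y)))) d1 d2"
    and r: "\<And>t. orthonormal_frame (r t)" "\<And>i. i < CARD('n) \<Longrightarrow> r 0 i = q i"
    and rj: "\<And>i. i < CARD('n) \<Longrightarrow> jet2 (\<lambda>t. r t i \<bullet> (hessian u (x0 + t *\<^sub>R y) *v r t i)) (a1 i) (a2 i)"
  shows "d1 = (\<Sum>i<CARD('n). L i * a1 i)" "d2 \<le> (\<Sum>i<CARD('n). L i * a2 i)"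
proof -
  let ?\<psi> = "\<lambda>t. ln (p_sum_prod p (hessian u (x0 + t *\<^sub>R y)))"
  let ?\<Phi> = "\<lambda>t. \<Sum>i<CARD('n). L i * (r t i \<bullet> (hessian u (x0 + t *\<^sub>R y) *v r t i))"
  have "jet2 (\<lambda>t. ?\<psi> t + (-1) * ?\<Phi> t) (d1 + (-1) * (\<Sum>i<CARD('n). L i * a1 i)) (d2 + (-1) * (\<Sum>i<CARD('n). L i * a2 i))"
    using rj by (intro jet2_add jet jet2_cmult jet2_sum) auto
  moreover have "\<forall>\<^sub>F t in nhds 0. ?\<psi> t + (-1) * ?\<Phi> t \<le> ?\<psi> 0 + (-1) * ?\<Phi> 0"
    using eventually_line_in_open[OF U, of y]
  proof eventually_elim
    case (elim t)
    have "?\<Phi> 0 = (\<Sum>i<CARD('n). L i * l i)"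
      using r(2) eigen frame_inner by (intro sum.cong) auto
    then show ?case using tangent_nonneg[OF r(1) elim, of t]
      by (simp add: right_diff_distrib sum_subtractf)
  qed
  ultimately show "d1 = (\<Sum>i<CARD('n). L i * a1 i)" "d2 \<le> (\<Sum>i<CARD('n). L i * a2 i)"
    using jet2_local_max by fastforce+
qed

text \<open>The equation differentiated once; the frame may stay fixed.\<close>

lemma first_derivative_equation:
  assumes "jet2 (\<lambda>t. ln (p_sum_prod p (hessian u (x0 + t *\<^sub>R y)))) d1 d2"
  shows "(\<Sum>i<CARD('n). L i * pd y (pd (q i) (pd (q i) u)) x0) = d1"
  by (rule sym, rule touching(1)[OF assms, of "\<lambda>t. q", OF frame refl jet2_hessian[OF U u]])

lemma third_derivative_rotate:
  "pd a (pd b (pd z u)) x0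
     = pd z (pd a (pd b u)) x0"
  using partial_deriv_commute_inner[OF U C3, of a b z]
    partial_deriv_commute[OF U C2_first(1)[of b], of a z] by simp

lemma third_derivative_expand:
  "pd a (pd b (pd z u)) x0
     = (\<Sum>i<CARD('n). (z \<bullet> q i) * pd a (pd b (pd (q i) u)) x0)"
proof -
  have d: "pd a (pd b u) differentiable (at x0)"
    using C2_second[of a b] U(2) by (simp add: numeral_2_eq_2)
  have "pd z (pd a (pd b u)) x0
     = pd (\<Sum>i<CARD('n). (z \<bullet> q i) *\<^sub>R q i) (pd a (pd b u)) x0"
    using orthonormal_frame_expand[OF frame, of z] by simp
  then show ?thesis unfolding third_derivative_rotate[of a b]
    by (simp only: linear_sum[OF partial_deriv_linear[OF d]]
        linear_scale[OF partial_deriv_linear[OF d]] real_scaleR_def)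
qed

text \<open>The equation differentiated twice in the direction \<open>e\<close>.  The frame is rotated in the plane of \<open>e\<close> and a vector \<open>\<xi>\<close>
orthogonal to \<open>e\<close>.  Its contribution is quadratic in the coefficients of \<open>\<xi>\<close>, and its optimum produces the squares of the third
derivatives \<open>b i\<close> with the divided differences of \<open>L\<close> as weights.\<close>

theorem second_derivative_inequality:
  assumes jet: "jet2 (\<lambda>t. ln (p_sum_prod p (hessian u (x0 + t *\<^sub>R e)))) d1 d2"
  defines "b \<equiv> \<lambda>i. pd e (pd e (pd (q i) u)) x0"
  shows "d2 + 2 * (\<Sum>i<m. (L i - L m) * ((b i)\<^sup>2 / (l m - l i)))
     \<le> (\<Sum>i<CARD('n). L i * pd e (pd e (pd (q i) (pd (q i) u))) x0)"
proof -
  have top: "m < CARD('n)" using m by simp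
  \<comment> \<open>Minimises \<open>2 (l m - l i) s\<^sup>2 - 4 s (b i)\<close> over all speeds \<open>s\<close>.\<close>
  define \<xi>c where "\<xi>c i = b i / (l m - l i)" for i
  define \<xi> where "\<xi> = (\<Sum>i<m. \<xi>c i *\<^sub>R q i)"
  define \<kappa> where "\<kappa> = norm \<xi>"
  define f where "f = (if \<xi> = 0 then 0 else (1 / \<kappa>) *\<^sub>R \<xi>)"
  have \<kappa>f: "\<kappa> *\<^sub>R f = \<xi>" by (simp add: f_def \<kappa>_def)
  have \<xi>q: "\<xi> \<bullet> q i = (if i < m then \<xi>c i else 0)" if "i < CARD('n)" for i
  proof -
    have "\<xi> \<bullet> q i = (\<Sum>j<m. \<xi>c j * (if j = i then 1 else 0))"
      unfolding \<xi>_def inner_sum_left using that by (intro sum.cong) (auto simp: frame_inner m)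
    then show ?thesis by (simp add: if_distrib cong: if_cong)
  qed
  have "\<xi> \<bullet> e = 0" using \<xi>q[of m] top e by simp
  then have ef: "e \<bullet> f = 0" by (simp add: f_def inner_commute)
  have ee: "e \<bullet> e = 1" using frame_inner[of m m] top e by simp
  define r where "r t i = rotate_plane e f (\<kappa> * t) (q i)" for t i
  have rf: "orthonormal_frame (r t)" for t
  proof (cases "\<xi> = 0")
    case True
    then have "r t = q" by (simp add: r_def rotate_plane_def \<kappa>_def fun_eq_iff)
    then show ?thesis using frame by simp
  next
    case False
    then have ff: "f \<bullet> f = 1" by (simp add: f_def \<kappa>_def dot_square_norm power2_eq_square)
    show ?thesis using frame unfolding orthonormal_frame_def r_def rotate_plane_inner[OF ee ff ef] .
  qed
  define y where "y i = (q i \<bullet> e) *\<^sub>R e + (q i \<bullet> f) *\<^sub>R f" for i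
  define z where "z i = (q i \<bullet> e) *\<^sub>R f - (q i \<bullet> f) *\<^sub>R e" for i
  define a2 where "a2 i = pd e (pd e (pd (q i) (pd (q i) u))) x0
      - 2 * \<kappa>\<^sup>2 * pd (q i) (pd (y i) u) x0
      + 4 * \<kappa> * pd e (pd (q i) (pd (z i) u)) x0
      + 2 * \<kappa>\<^sup>2 * pd (z i) (pd (z i) u) x0" for i
  have "\<exists>d1. jet2 (\<lambda>t. r t i \<bullet> (hessian u (x0 + t *\<^sub>R e) *v r t i)) d1 (a2 i)" for i
    using jet2_rotating_quadratic[OF U u, of "q i" \<kappa> "y i" "z i" e]
    unfolding r_def rotate_plane_def a2_def y_def z_def by simp
  then have "\<forall>i. \<exists>d1. jet2 (\<lambda>t. r t i \<bullet> (hessian u (x0 + t *\<^sub>R e) *v r t i)) d1 (a2 i)"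
    by blast
  then obtain a1 where "\<And>i. jet2 (\<lambda>t. r t i \<bullet> (hessian u (x0 + t *\<^sub>R e) *v r t i)) (a1 i) (a2 i)"
    unfolding choice_iff by blast
  then have main: "d2 \<le> (\<Sum>i<CARD('n). L i * a2 i)"
    by (intro touching(2)[OF jet, of r]) (auto intro: rf simp: r_def rotate_plane_def)
  let ?D4 = "\<lambda>i. pd e (pd e (pd (q i) (pd (q i) u))) x0"
  have hb: "pd y (pd z u) x0 = y \<bullet> (hessian u x0 *v z)" for y z
    using hessian_bilinear[OF U C2] by simp
  have qf: "\<kappa> * (q i \<bullet> f) = (if i < m then \<xi>c i else 0)" if "i < CARD('n)" for i
    using \<xi>q[OF that] \<kappa>f by (metis inner_commute inner_scaleR_right)
  have a2_low: "a2 i = ?D4 i - 2 * ((b i)\<^sup>2 / (l m - l i))" if i: "i < m" for i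
  proof -
    have i': "i < CARD('n)" "i \<noteq> m" using i m by auto
    have yz: "\<kappa> *\<^sub>R y i = \<xi>c i *\<^sub>R f" "\<kappa> *\<^sub>R z i = - (\<xi>c i *\<^sub>R e)"
      using qf[OF i'(1)] i frame_inner[of i m] i' e top by (auto simp: y_def z_def)
    have "\<kappa>\<^sup>2 * pd (q i) (pd (y i) u) x0 = l i * (\<xi>c i)\<^sup>2"
    proof -
      have "\<kappa>\<^sup>2 * pd (q i) (pd (y i) u) x0
          = \<kappa> * pd (\<kappa> *\<^sub>R y i) (pd (q i) u) x0"
        unfolding partial_deriv_commute[OF U C2, of "q i"] hessian_frame[OF i'(1)]
        by (simp add: power2_eq_square)
      also have "\<dots> = l i * \<xi>c i * (\<kappa> * (q i \<bullet> f))"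
        unfolding yz hessian_frame[OF i'(1)] by (simp add: inner_commute)
      finally show ?thesis using qf[OF i'(1)] i by (simp add: power2_eq_square)
    qed
    moreover have "\<kappa> * pd e (pd (q i) (pd (z i) u)) x0 = - \<xi>c i * b i"
    proof -
      have zi: "\<kappa> * (z i \<bullet> q j) = - \<xi>c i * (if j = m then 1 else 0)" if "j < CARD('n)" for j
      proof -
        have "\<kappa> * (z i \<bullet> q j) = (\<kappa> *\<^sub>R z i) \<bullet> q j" by simp
        also have "\<dots> = - \<xi>c i * (e \<bullet> q j)" unfolding yz by simp
        finally show ?thesis using frame_inner[of m j] that e top by auto
      qed
      have "\<kappa> * pd e (pd (q i) (pd (z i) u)) x0
        = (\<Sum>j<CARD('n). (\<kappa> * (z i \<bullet> q j)) * pd e (pd (q i) (pd (q j) u)) x0)"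
        unfolding third_derivative_expand[of e "q i" "z i"] by (simp add: sum_distrib_left mult.assoc)
      also have "\<dots> = (\<Sum>j<CARD('n). if j = m then - \<xi>c i * pd e (pd (q i) (pd e u)) x0 else 0)"
        by (intro sum.cong) (auto simp: zi e)
      also have "\<dots> = - \<xi>c i * b i"
        unfolding b_def partial_deriv_commute_inner[OF U C3, of e "q i" e] using top by simp
      finally show ?thesis .
    qed
    moreover have "\<kappa>\<^sup>2 * pd (z i) (pd (z i) u) x0 = l m * (\<xi>c i)\<^sup>2"
    proof -
      have "\<kappa>\<^sup>2 * pd (z i) (pd (z i) u) x0
         = (\<kappa> *\<^sub>R z i) \<bullet> (hessian u x0 *v (\<kappa> *\<^sub>R z i))"
        unfolding hb by (simp add: matrix_vector_mult_scaleR power2_eq_square)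
      also have "\<dots> = (\<xi>c i)\<^sup>2 * (e \<bullet> (hessian u x0 *v e))"
        unfolding yz using matrix_vector_mult_scaleR[of "hessian u x0" "- \<xi>c i" e]
        by (simp add: power2_eq_square)
      finally show ?thesis using eigen[of m] ee e top by simp
    qed
    ultimately have "a2 i = ?D4 i - 2 * (l i * (\<xi>c i)\<^sup>2) + 4 * (- \<xi>c i * b i) + 2 * (l m * (\<xi>c i)\<^sup>2)"
      unfolding a2_def by (simp add: algebra_simps)
    also have "\<dots> = ?D4 i - 2 * ((b i)\<^sup>2 / (l m - l i))"
      using rotation_speed[OF \<xi>c_def[of i]] by (simp add: algebra_simps)
    finally show ?thesis .
  qed
  have a2_top: "a2 m = ?D4 m + 2 * (\<Sum>i<m. (b i)\<^sup>2 / (l m - l i))"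
  proof -
    have yz: "y m = e" "z m = f" using ee ef e by (simp_all add: y_def z_def)
    have "\<kappa> * pd e (pd e (pd f u)) x0
        = (\<Sum>j<CARD('n). (\<kappa> * (q j \<bullet> f)) * b j)"
      unfolding third_derivative_expand[of e e f] b_def
      by (simp add: sum_distrib_left mult.assoc inner_commute)
    also have "\<dots> = (\<Sum>j<m. \<xi>c j * b j)"
      using qf m by (subst m) simp
    finally have 1: "\<kappa> * pd e (pd e (pd f u)) x0 = (\<Sum>j<m. \<xi>c j * b j)" .
    have \<xi>exp: "\<xi> \<bullet> (hessian u x0 *v \<xi>) = (\<Sum>j<m. l j * (\<xi>c j)\<^sup>2)"
    proof -
      have "\<xi> \<bullet> (hessian u x0 *v \<xi>) = (\<Sum>j<CARD('n). (\<xi> \<bullet> q j) * ((hessian u x0 *v \<xi>) \<bullet> q j))"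
        by (rule orthonormal_frame_parseval[OF frame])
      also have "\<dots> = (\<Sum>j<CARD('n). (\<xi> \<bullet> q j) * (l j * (\<xi> \<bullet> q j)))"
        using eigen by (intro sum.cong) (auto simp: matrix_inner_transpose hessian_symmetric[OF U C2])
      also have "\<dots> = (\<Sum>j<m. l j * (\<xi>c j)\<^sup>2)"
        by (simp add: m \<xi>q power2_eq_square mult.left_commute)
      finally show ?thesis .
    qed
    have 2: "\<kappa>\<^sup>2 * pd f (pd f u) x0 = (\<Sum>j<m. l j * (\<xi>c j)\<^sup>2)"
      unfolding hb \<xi>exp[symmetric] \<kappa>f[symmetric]
      by (simp add: matrix_vector_mult_scaleR power2_eq_square)
    have 3: "\<kappa>\<^sup>2 = (\<Sum>j<m. (\<xi>c j)\<^sup>2)"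
    proof -
      have "\<kappa>\<^sup>2 = \<xi> \<bullet> \<xi>" by (simp add: \<kappa>_def power2_norm_eq_inner)
      also have "\<dots> = (\<Sum>j<CARD('n). (\<xi> \<bullet> q j) * (\<xi> \<bullet> q j))" by (rule orthonormal_frame_parseval[OF frame])
      also have "\<dots> = (\<Sum>j<m. (\<xi>c j)\<^sup>2)"
        by (simp add: m \<xi>q power2_eq_square)
      finally show ?thesis .
    qed
    have "a2 m = ?D4 m - 2 * l m * \<kappa>\<^sup>2 + 4 * (\<kappa> * pd e (pd e (pd f u)) x0)
        + 2 * (\<kappa>\<^sup>2 * pd f (pd f u) x0)"
      unfolding a2_def yz using hessian_frame[of m e] ee e top by simp
    also have "\<dots> = ?D4 m + (\<Sum>j<m. 4 * (\<xi>c j * b j) + 2 * (l j * (\<xi>c j)\<^sup>2) - 2 * l m * (\<xi>c j)\<^sup>2)"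
      unfolding 1 2 unfolding 3 by (simp add: sum.distrib sum_subtractf sum_distrib_left)
    also have "(\<Sum>j<m. 4 * (\<xi>c j * b j) + 2 * (l j * (\<xi>c j)\<^sup>2) - 2 * l m * (\<xi>c j)\<^sup>2)
       = (\<Sum>j<m. 2 * ((b j)\<^sup>2 / (l m - l j)))"
    proof (intro sum.cong refl)
      fix j
      show "4 * (\<xi>c j * b j) + 2 * (l j * (\<xi>c j)\<^sup>2) - 2 * l m * (\<xi>c j)\<^sup>2 = 2 * ((b j)\<^sup>2 / (l m - l j))"
        using rotation_speed[OF \<xi>c_def[of j]] by (simp add: algebra_simps)
    qed
    finally show ?thesis by (simp add: sum_distrib_left)
  qed
  have "(\<Sum>i<CARD('n). L i * a2 i) = (\<Sum>i<m. L i * a2 i) + L m * a2 m"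
    by (subst m) simp
  also have "\<dots> = (\<Sum>i<m. L i * ?D4 i) + L m * ?D4 m
     - 2 * (\<Sum>i<m. (L i - L m) * ((b i)\<^sup>2 / (l m - l i)))"
  proof -
    define S where "S i = (b i)\<^sup>2 / (l m - l i)" for i
    have "(\<Sum>i<m. L i * a2 i) = (\<Sum>i<m. L i * ?D4 i - 2 * (L i * S i))"
      by (intro sum.cong refl) (simp add: a2_low S_def[symmetric] algebra_simps)
    moreover have "\<dots> = (\<Sum>i<m. L i * ?D4 i) - 2 * (\<Sum>i<m. L i * S i)"
      by (simp only: sum_subtractf sum_distrib_left)
    moreover have "(\<Sum>i<m. (L i - L m) * S i) = (\<Sum>i<m. L i * S i) - L m * (\<Sum>i<m. S i)"
      by (simp add: left_diff_distrib sum_subtractf sum_distrib_left)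
    ultimately show ?thesis
      unfolding a2_top S_def[symmetric] by (simp add: algebra_simps)
  qed
  also have "(\<Sum>i<m. L i * ?D4 i) + L m * ?D4 m = (\<Sum>i<CARD('n). L i * ?D4 i)"
    by (simp add: m)
  finally show ?thesis using main by simp
qed

end

section \<open>The test function at its maximum\<close>

context eigenframe_at
begin

text \<open>The coefficient \<open>- 1 / 3\<close> is chosen so that \<open>h(s) = - 1/3 ln (c - s)\<close> satisfies \<open>h'' = 3 h'\<^sup>2\<close>.  The term with
\<open>h''\<close> then absorbs the square of \<open>h'\<close> that appears whenever the first order condition is squared.\<close>

definition test_function :: "(real^'n \<Rightarrow> real) \<Rightarrow> real \<Rightarrow> real \<Rightarrow> real \<Rightarrow> real^'n \<Rightarrow> real" where
  "test_function v \<beta> A c x = \<beta> * ln (v x - u x) + ln (e \<bullet> (hessian u x *v e))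
     + (- 1 / 3) * ln (c - (grad u x \<bullet> grad u x) / 2) + A * ((x \<bullet> x) / 2)"

lemma differentiable_u: "u differentiable (at x0)" "pd a u differentiable (at x0)"
  using C2 U(2) by (auto simp: numeral_2_eq_2)

lemma grad_components: "(\<Sum>i\<in>UNIV. grad u x $ i * pd (axis i 1) g x0) = pd (grad u x) g x0"
  if "g differentiable (at x0)"
  using partial_deriv_vec[OF that, of "grad u x"] by simp

text \<open>In an eigendirection the gradient changes by \<open>l i\<close> times that direction.\<close>

lemma jet2_gradient_square:
  assumes i: "i < CARD('n)"
  shows "jet2 (\<lambda>t. grad u (x0 + t *\<^sub>R q i) \<bullet> grad u (x0 + t *\<^sub>R q i) / 2)
    (l i * pd (q i) u x0)
    ((l i)\<^sup>2 + pd (grad u x0) (pd (q i) (pd (q i) u)) x0)"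
proof -
  let ?D = "\<lambda>k. pd (axis k 1) u"
  have jD: "jet2 (\<lambda>t. ?D k (x0 + t *\<^sub>R q i)) (pd (q i) (?D k) x0)
      (pd (q i) (pd (q i) (?D k)) x0)" for k
    by (rule jet2_line[OF U C2_first(1)])
  have qD: "pd (q i) (?D k) x0 = l i * q i $ k" for k
    using partial_deriv_commute[OF U C2, of "q i" "axis k 1"] hessian_frame[OF i, of "axis k 1"]
    by (simp add: inner_axis' )
  have d: "pd (q i) (pd (q i) u) differentiable (at x0)"
    using C2_second[of "q i" "q i"] U(2) by (simp add: numeral_2_eq_2)
  have "jet2 (\<lambda>t. \<Sum>k\<in>UNIV. (1 / 2) * (?D k (x0 + t *\<^sub>R q i) * ?D k (x0 + t *\<^sub>R q i)))
     (\<Sum>k\<in>UNIV. (1 / 2) * ((l i * q i $ k) * ?D k (x0 + 0 *\<^sub>R q i) + ?D k (x0 + 0 *\<^sub>R q i) * (l i * q i $ k)))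
     (\<Sum>k\<in>UNIV. (1 / 2) * (pd (q i) (pd (q i) (?D k)) x0 * ?D k (x0 + 0 *\<^sub>R q i)
        + 2 * (l i * q i $ k) * (l i * q i $ k)
        + ?D k (x0 + 0 *\<^sub>R q i) * pd (q i) (pd (q i) (?D k)) x0))"
    using jD unfolding qD by (intro jet2_sum jet2_cmult jet2_mult) auto
  moreover have "(\<Sum>k\<in>UNIV. (1 / 2) * (?D k x * ?D k x)) = grad u x \<bullet> grad u x / 2" for x
    by (simp add: grad_def inner_vec_def sum_divide_distrib)
  moreover have "(\<Sum>k\<in>UNIV. (1 / 2) * ((l i * q i $ k) * ?D k x0 + ?D k x0 * (l i * q i $ k)))
      = l i * pd (q i) u x0"
    unfolding partial_deriv_grad[OF differentiable_u(1), of "q i"]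
    by (simp add: grad_def inner_vec_def sum_distrib_left algebra_simps)
  moreover have "(\<Sum>k\<in>UNIV. (1 / 2) * (pd (q i) (pd (q i) (?D k)) x0 * ?D k x0
        + 2 * (l i * q i $ k) * (l i * q i $ k)
        + ?D k x0 * pd (q i) (pd (q i) (?D k)) x0))
     = (l i)\<^sup>2 + pd (grad u x0) (pd (q i) (pd (q i) u)) x0"
  proof -
    have "(\<Sum>k\<in>UNIV. (1 / 2) * (pd (q i) (pd (q i) (?D k)) x0 * ?D k x0
        + 2 * (l i * q i $ k) * (l i * q i $ k)
        + ?D k x0 * pd (q i) (pd (q i) (?D k)) x0))
      = (\<Sum>k\<in>UNIV. (l i)\<^sup>2 * (q i $ k * q i $ k) 
          + grad u x0 $ k * pd (axis k 1) (pd (q i) (pd (q i) u)) x0)"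
      by (intro sum.cong refl) (simp add: third_derivative_rotate[of "q i" "q i"] grad_def power2_eq_square algebra_simps)
    also have "\<dots> = (l i)\<^sup>2 * (q i \<bullet> q i) + pd (grad u x0) (pd (q i) (pd (q i) u)) x0"
      unfolding sum.distrib grad_components[OF d] by (simp add: sum_distrib_left inner_vec_def)
    finally show ?thesis using frame_inner[OF i i] by simp
  qed
  ultimately show ?thesis by (simp only: scaleR_zero_left add_0_right)
qed

text \<open>Here \<open>H\<close> is the derivative of the function \<open>h\<close> at half the square of the gradient.\<close>

lemma jet2_test_function:
  assumes v: "Ck_dir 2 U v" and w: "v x0 - u x0 > 0" and lm: "l m > 0"
    and c: "c - (grad u x0 \<bullet> grad u x0) / 2 > 0" and H: "H = 1 / (3 * (c - (grad u x0 \<bullet> grad u x0) / 2))"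
    and i: "i < CARD('n)"
  shows "jet2 (\<lambda>t. test_function v \<beta> A c (x0 + t *\<^sub>R q i))
     (\<beta> * ((pd (q i) v x0 - pd (q i) u x0) / (v x0 - u x0))
      + pd e (pd e (pd (q i) u)) x0 / l m
      + H * (l i * pd (q i) u x0) + A * (x0 \<bullet> q i))
     (\<beta> * ((pd (q i) (pd (q i) v) x0 - l i) / (v x0 - u x0)
         - ((pd (q i) v x0 - pd (q i) u x0) / (v x0 - u x0))\<^sup>2)
      + (pd e (pd e (pd (q i) (pd (q i) u))) x0 / l m
         - (pd e (pd e (pd (q i) u)) x0 / l m)\<^sup>2)
      + (H * ((l i)\<^sup>2 + pd (grad u x0) (pd (q i) (pd (q i) u)) x0)
         + 3 * H\<^sup>2 * (l i * pd (q i) u x0)\<^sup>2) + A)"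
proof -
  let ?q = "q i"
  let ?s = "grad u x0 \<bullet> grad u x0 / 2"
  have j1: "jet2 (\<lambda>t. v (x0 + t *\<^sub>R ?q) + (-1) * u (x0 + t *\<^sub>R ?q))
      (pd ?q v x0 + (-1) * pd ?q u x0)
      (pd ?q (pd ?q v) x0 + (-1) * pd ?q (pd ?q u) x0)"
    by (intro jet2_add jet2_cmult jet2_line[OF U] v C2)
  have uqq: "pd ?q (pd ?q u) x0 = l i"
    using hessian_frame[OF i] frame_inner[OF i i] by simp
  have j1': "jet2 (\<lambda>t. ln (v (x0 + t *\<^sub>R ?q) - u (x0 + t *\<^sub>R ?q)))
      ((pd ?q v x0 - pd ?q u x0) / (v x0 - u x0))
      ((pd ?q (pd ?q v) x0 - l i) / (v x0 - u x0)
         - ((pd ?q v x0 - pd ?q u x0) / (v x0 - u x0))\<^sup>2)"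
    using jet2_ln[OF j1] w uqq by simp
  have ee0: "e \<bullet> (hessian u x0 *v e) = l m"
    using eigen[of m] frame_inner[of m m] m e by simp
  have comm4: "pd ?q (pd ?q (pd e (pd e u))) x0
      = pd e (pd e (pd ?q (pd ?q u))) x0"
  proof -
    have C3': "Ck_dir (Suc 2) U (pd a u)" for a using C2_first(2)[of a] by (simp add: eval_nat_numeral)
    have "pd ?q (pd ?q (pd e (pd e u))) x0
        = pd ?q (pd e (pd ?q (pd e u))) x0"
      by (rule partial_deriv_commute_inner[OF U C3'])
    also have "\<dots> = pd e (pd ?q (pd ?q (pd e u))) x0"
      by (rule partial_deriv_commute[OF U C2_second])
    also have "\<dots> = pd e (pd e (pd ?q (pd ?q u))) x0"
    proof (rule partial_deriv_cong_open[OF U])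
      fix x assume x: "x \<in> U"
      have "pd ?q (pd ?q (pd e u)) x
          = pd ?q (pd e (pd ?q u)) x"
        by (rule partial_deriv_commute_inner[OF U(1) x C3])
      also have "\<dots> = pd e (pd ?q (pd ?q u)) x"
        by (rule partial_deriv_commute[OF U(1) x C2_first(1)])
      finally show "pd ?q (pd ?q (pd e u)) x
          = pd e (pd ?q (pd ?q u)) x" .
    qed
    finally show ?thesis .
  qed
  have j2: "jet2 (\<lambda>t. ln (e \<bullet> (hessian u (x0 + t *\<^sub>R ?q) *v e)))
      (pd e (pd e (pd ?q u)) x0 / l m)
      (pd e (pd e (pd ?q (pd ?q u))) x0 / l m
         - (pd e (pd e (pd ?q u)) x0 / l m)\<^sup>2)"
    using jet2_ln[OF jet2_hessian[OF U u, of e ?q e]] ee0 lm unfolding third_derivative_rotate[of e e ?q, symmetric] comm4 by simp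
  define S1 where "S1 = l i * pd ?q u x0"
  define S2 where "S2 = (l i)\<^sup>2 + pd (grad u x0) (pd ?q (pd ?q u)) x0"
  have j3: "jet2 (\<lambda>t. (- 1 / 3) * ln (c + (-1) * (grad u (x0 + t *\<^sub>R ?q) \<bullet> grad u (x0 + t *\<^sub>R ?q) / 2)))
      (H * S1) (H * S2 + 3 * H\<^sup>2 * S1\<^sup>2)"
  proof -
    have "jet2 (\<lambda>t. c + (-1) * (grad u (x0 + t *\<^sub>R ?q) \<bullet> grad u (x0 + t *\<^sub>R ?q) / 2))
       (0 + (-1) * S1) (0 + (-1) * S2)"
      unfolding S1_def S2_def by (intro jet2_add jet2_const jet2_cmult jet2_gradient_square i)
    from jet2_cmult[OF jet2_ln[OF this], of "-1/3"] have
      "jet2 (\<lambda>t. (- 1 / 3) * ln (c + (-1) * (grad u (x0 + t *\<^sub>R ?q) \<bullet> grad u (x0 + t *\<^sub>R ?q) / 2)))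
        (- 1 / 3 * (- S1 / (c - ?s))) (- 1 / 3 * (- S2 / (c - ?s) - (- S1 / (c - ?s))\<^sup>2))"
      using c by simp
    moreover have "- 1 / 3 * (- S1 / (c - ?s)) = H * S1" unfolding H by simp
    moreover have "- 1 / 3 * (- S2 / (c - ?s) - (- S1 / (c - ?s))\<^sup>2) = H * S2 + 3 * H\<^sup>2 * S1\<^sup>2"
    proof -
      define d where "d = c - ?s"
      have "d > 0" using c by (simp add: d_def)
      then show ?thesis unfolding H d_def[symmetric] by (simp add: field_simps power2_eq_square)
    qed
    ultimately show ?thesis by simp
  qed
  have j4: "jet2 (\<lambda>t. (x0 + t *\<^sub>R ?q) \<bullet> (x0 + t *\<^sub>R ?q) / 2) (x0 \<bullet> ?q) 1"
  proof -
    have "(x0 + t *\<^sub>R ?q) \<bullet> (x0 + t *\<^sub>R ?q) / 2 = x0 \<bullet> x0 / 2 + t * (x0 \<bullet> ?q) + t\<^sup>2 / 2" for t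
      using frame_inner[OF i i] by (simp add: inner_add_left inner_add_right power2_eq_square inner_commute algebra_simps)
    moreover have "jet2 (\<lambda>t. x0 \<bullet> x0 / 2 + t * (x0 \<bullet> ?q) + t\<^sup>2 / 2) (x0 \<bullet> ?q) 1"
      by (rule jet2I[where f' = "\<lambda>t. x0 \<bullet> ?q + t"]) (auto intro!: always_eventually derivative_eq_intros)
    ultimately show ?thesis by (simp only:)
  qed
  show ?thesis
    using jet2_add[OF jet2_add[OF jet2_add[OF jet2_cmult[OF j1', of \<beta>] j2] j3] jet2_cmult[OF j4, of A]]
    unfolding test_function_def S1_def S2_def by simp
qed

lemma L_nonneg: "L i \<ge> 0"
  unfolding L_def by (rule dlog_coeff_nonneg[OF l_positive])

lemma L_antimono: "i \<le> j \<Longrightarrow> j < CARD('n) \<Longrightarrow> L j \<le> L i"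
  unfolding L_def using dlog_coeff_antimono[OF l_positive] l_mono by simp

text \<open>Since \<open>L\<close> is decreasing, the weighted trace is least when the frame diagonalises the Hessian of \<open>v\<close> in increasing order,
and then it is a nonnegative combination of sums of \<open>p\<close> eigenvalues.\<close>

lemma psh_weighted_trace_nonneg:
  assumes v: "Ck_dir 2 U v" "\<And>I. I \<in> index_sets CARD('n) p \<Longrightarrow> (\<Sum>i\<in>I. eigvals (hessian v x0) ! i) \<ge> 0"
  shows "(\<Sum>i<CARD('n). L i * pd (q i) (pd (q i) v) x0) \<ge> 0"
proof -
  have "0 \<le> (\<Sum>I\<in>index_sets CARD('n) p. (\<Sum>i\<in>I. eigvals (hessian v x0) ! i) / sum l I)"
    using v(2) l_positive unfolding p_positive_def by (intro sum_nonneg[OF divide_nonneg_pos]) auto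
  also have "\<dots> = (\<Sum>i<CARD('n). L i * eigvals (hessian v x0) ! i)"
    unfolding L_def dlog_coeff_sum ..
  also have "\<dots> \<le> (\<Sum>i<CARD('n). L i * (q i \<bullet> (hessian v x0 *v q i)))"
    by (rule weighted_trace_ge_eigenvalues[OF hessian_symmetric[OF U v(1)] frame L_antimono])
  finally show ?thesis unfolding hessian_bilinear[OF U v(1)] .
qed

text \<open>The second order conditions in the directions of the frame, weighted with \<open>L\<close> and added.  The fourth derivatives
of \<open>u\<close> are replaced using \<open>second_derivative_inequality\<close>, the third derivatives along the gradient using
\<open>first_derivative_equation\<close>.\<close>

theorem maximum_principle:
  assumes v: "Ck_dir 2 U v" "\<And>I. I \<in> index_sets CARD('n) p \<Longrightarrow> (\<Sum>i\<in>I. eigvals (hessian v x0) ! i) \<ge> 0"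
    and w: "v x0 - u x0 > 0" and lm: "l m > 0" and \<beta>: "\<beta> \<ge> 0"
    and c: "c - (grad u x0 \<bullet> grad u x0) / 2 > 0" and H: "H = 1 / (3 * (c - (grad u x0 \<bullet> grad u x0) / 2))"
    and mx: "\<forall>\<^sub>F x in nhds x0. test_function v \<beta> A c x \<le> test_function v \<beta> A c x0"
    and \<psi>: "jet2 (\<lambda>t. ln (p_sum_prod p (hessian u (x0 + t *\<^sub>R e)))) d1 d2"
    and \<psi>y: "jet2 (\<lambda>t. ln (p_sum_prod p (hessian u (x0 + t *\<^sub>R grad u x0)))) y1 y2"
    and a: "\<And>i. a i = pd e (pd e (pd (q i) u)) x0 / l m"
    and wi: "\<And>i. wi i = (pd (q i) v x0 - pd (q i) u x0) / (v x0 - u x0)"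
  shows "- (\<beta> * card (index_sets CARD('n) p) / (v x0 - u x0)) + d2 / l m
     + (\<Sum>i<m. 2 * l m * ((L i - L m) / (l m - l i)) * (a i)\<^sup>2)
     + (\<Sum>i<CARD('n). L i * (H * (l i)\<^sup>2 + 3 * (H * (l i * pd (q i) u x0))\<^sup>2 + A
          - (a i)\<^sup>2 - \<beta> * (wi i)\<^sup>2)) + H * y1 \<le> 0"
proof -
  let ?w = "v x0 - u x0"
  let ?V = "\<lambda>i. pd (q i) (pd (q i) v) x0"
  let ?D4 = "\<lambda>i. pd e (pd e (pd (q i) (pd (q i) u))) x0"
  let ?D3 = "\<lambda>i. pd (grad u x0) (pd (q i) (pd (q i) u)) x0"
  let ?R = "\<lambda>i. H * (l i)\<^sup>2 + 3 * (H * (l i * pd (q i) u x0))\<^sup>2 + A - (a i)\<^sup>2 - \<beta> * (wi i)\<^sup>2"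
  have "(\<Sum>i<CARD('n). (\<beta> / ?w) * (L i * ?V i) - (\<beta> / ?w) * (L i * l i) + (1 / l m) * (L i * ?D4 i)
      + L i * ?R i + H * (L i * ?D3 i)) \<le> 0"
  proof (rule sum_nonpos)
    fix i assume "i \<in> {..<CARD('n)}"
    then have i: "i < CARD('n)" by simp
    have le: "\<forall>\<^sub>F t in nhds 0. test_function v \<beta> A c (x0 + t *\<^sub>R q i)
        \<le> test_function v \<beta> A c (x0 + 0 *\<^sub>R q i)"
      using eventually_line[OF mx, of "q i"] by simp
    have "L i * (\<beta> * ((?V i - l i) / ?w - (wi i)\<^sup>2) + (?D4 i / l m - (a i)\<^sup>2)
      + (H * ((l i)\<^sup>2 + ?D3 i) + 3 * H\<^sup>2 * (l i * pd (q i) u x0)\<^sup>2) + A) \<le> 0"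
      using jet2_local_max(2)[OF jet2_test_function[OF v(1) w lm c H i] le] L_nonneg[of i]
      unfolding a wi by (rule mult_nonneg_nonpos[rotated])
    then show "(\<beta> / ?w) * (L i * ?V i) - (\<beta> / ?w) * (L i * l i) + (1 / l m) * (L i * ?D4 i)
      + L i * ?R i + H * (L i * ?D3 i) \<le> 0"
      by (simp add: algebra_simps diff_divide_distrib power_mult_distrib)
  qed
  then have main: "(\<beta> / ?w) * (\<Sum>i<CARD('n). L i * ?V i) - (\<beta> / ?w) * (\<Sum>i<CARD('n). L i * l i)
      + (1 / l m) * (\<Sum>i<CARD('n). L i * ?D4 i) + (\<Sum>i<CARD('n). L i * ?R i)
      + H * (\<Sum>i<CARD('n). L i * ?D3 i) \<le> 0"
    by (simp only: sum.distrib sum_subtractf sum_distrib_left)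
  have "0 \<le> (\<beta> / ?w) * (\<Sum>i<CARD('n). L i * ?V i)"
    using psh_weighted_trace_nonneg[OF v] \<beta> w by simp
  moreover have eu: "(\<beta> / ?w) * (\<Sum>i<CARD('n). L i * l i) = \<beta> * card (index_sets CARD('n) p) / ?w"
    using dlog_coeff_euler[OF l_positive] unfolding L_def by simp
  moreover have "d2 / l m + (\<Sum>i<m. 2 * l m * ((L i - L m) / (l m - l i)) * (a i)\<^sup>2)
      \<le> (1 / l m) * (\<Sum>i<CARD('n). L i * ?D4 i)"
  proof -
    have eq: "(\<Sum>i<m. 2 * l m * ((L i - L m) / (l m - l i)) * (a i)\<^sup>2)
      = (1 / l m) * (2 * (\<Sum>i<m. (L i - L m) * ((pd e (pd e (pd (q i) u)) x0)\<^sup>2 / (l m - l i))))"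
      unfolding sum_distrib_left
    proof (intro sum.cong refl)
      fix i
      define D where "D = pd e (pd e (pd (q i) u)) x0"
      have "a i = D / l m" by (simp add: a D_def)
      then show "2 * l m * ((L i - L m) / (l m - l i)) * (a i)\<^sup>2
         = 1 / l m * (2 * ((L i - L m) * (D\<^sup>2 / (l m - l i))))"
        using lm by (simp add: power_divide power2_eq_square)
    qed
    have "d2 / l m + (1 / l m) * B \<le> (1 / l m) * Z" if "d2 + B \<le> Z" for B Z
      using that lm by (simp add: add_divide_distrib[symmetric] divide_right_mono)
    then show ?thesis unfolding eq using second_derivative_inequality[OF \<psi>] by blast
  qed
  moreover note main[unfolded eu first_derivative_equation[OF \<psi>y]]
  ultimately show ?thesis by linarith
qed

end

section \<open>From the critical inequality to an eigenvalue bound\<close>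

lemma square_sum3_le: "(x + y + z)\<^sup>2 \<le> 3 * (x\<^sup>2 + y\<^sup>2 + z\<^sup>2)" for x y z :: real
proof -
  have "0 \<le> (x - y)\<^sup>2 + (y - z)\<^sup>2 + (x - z)\<^sup>2" by simp
  then show ?thesis by (simp add: power2_eq_square algebra_simps)
qed

text \<open>Eliminates \<open>a\<close>.  It is used with weights that are either small or dominated by another term.\<close>

lemma critical_crude_bound:
  fixes a b h x A \<beta> :: real
  assumes "\<beta> * b + a + h + A * x = 0" "\<beta> \<ge> 1"
  shows "a\<^sup>2 + \<beta> * b\<^sup>2 \<le> 3 * h\<^sup>2 + 3 * A\<^sup>2 * x\<^sup>2 + 4 * \<beta>\<^sup>2 * b\<^sup>2"
proof -
  have "a = - (\<beta> * b + h + A * x)" using assms(1) by simp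
  then have "a\<^sup>2 = (\<beta> * b + h + A * x)\<^sup>2" by (simp only: power2_minus)
  then have "a\<^sup>2 \<le> 3 * ((\<beta> * b)\<^sup>2 + h\<^sup>2 + (A * x)\<^sup>2)" using square_sum3_le[of "\<beta> * b" h "A * x"] by simp
  moreover have "\<beta> * b\<^sup>2 \<le> \<beta>\<^sup>2 * b\<^sup>2"
    using assms(2) by (intro mult_right_mono self_le_power) auto
  ultimately show ?thesis by (simp add: power_mult_distrib)
qed

text \<open>Eliminates \<open>b\<close> instead.  Dividing by the large \<open>\<beta>\<close> leaves \<open>a\<^sup>2\<close> with a factor only slightly above 1.\<close>

lemma critical_fine_bound:
  fixes a b h x A \<beta> R :: real
  assumes "\<beta> * b + a + h + A * x = 0" "\<beta> \<ge> 9" "\<beta> \<ge> 12 * A * R\<^sup>2" "\<bar>x\<bar> \<le> R" "A \<ge> 0"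
  shows "a\<^sup>2 + \<beta> * b\<^sup>2 \<le> (4 / 3) * a\<^sup>2 + 3 * h\<^sup>2 + A / 4"
proof -
  have "\<beta> * b = - (a + h + A * x)" using assms(1) by simp
  then have "(\<beta> * b)\<^sup>2 = (a + h + A * x)\<^sup>2" by (simp only: power2_minus)
  then have "(\<beta> * b)\<^sup>2 \<le> 3 * (a\<^sup>2 + h\<^sup>2 + (A * x)\<^sup>2)" using square_sum3_le[of a h "A * x"] by simp
  also have "\<dots> \<le> \<beta> * (a\<^sup>2 / 3 + h\<^sup>2 + A / 4)"
  proof -
    have "x\<^sup>2 \<le> R\<^sup>2" using assms(4) by (metis abs_ge_zero power2_abs power_mono)
    then have "12 * A * x\<^sup>2 \<le> \<beta>" using assms(3) mult_left_mono[of "x\<^sup>2" "R\<^sup>2" "12 * A"] assms(5) by simp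
    then have "3 * (A * x)\<^sup>2 \<le> \<beta> * (A / 4)"
      using mult_right_mono[of "12 * A * x\<^sup>2" \<beta> "A / 4"] assms(5) by (simp add: power2_eq_square algebra_simps)
    moreover have "3 * a\<^sup>2 \<le> \<beta> * (a\<^sup>2 / 3)" using mult_right_mono[OF assms(2), of "a\<^sup>2 / 3"] by simp
    moreover have "3 * h\<^sup>2 \<le> \<beta> * h\<^sup>2" using assms(2) by (intro mult_right_mono) auto
    ultimately show ?thesis by (simp add: algebra_simps)
  qed
  finally have "\<beta> * (\<beta> * b\<^sup>2) \<le> \<beta> * (a\<^sup>2 / 3 + h\<^sup>2 + A / 4)" by (simp add: power2_eq_square mult_ac)
  then have "\<beta> * b\<^sup>2 \<le> a\<^sup>2 / 3 + h\<^sup>2 + A / 4" using assms(2) by simp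
  moreover have "0 \<le> h\<^sup>2" by simp
  ultimately show ?thesis by linarith
qed

lemma sum_containing_top_ge_half:
  fixes l :: "nat \<Rightarrow> real"
  assumes "p \<le> n" "\<Lambda> \<ge> 0" and low: "\<And>i. i < n \<Longrightarrow> l i \<ge> - (\<Lambda> / (4 * real n))"
    and I: "I \<in> index_sets n p" "j \<in> I" "l j = \<Lambda>"
  shows "sum l I \<ge> \<Lambda> / 2"
proof -
  have I': "I \<subseteq> {..<n}" "card I = p" "finite I" using index_setsD[OF I(1)] by auto
  have "j < n" using I(2) I'(1) by auto
  have "sum l I = \<Lambda> + sum l (I - {j})" using I(2,3) I'(3) by (simp add: sum.remove)
  moreover have "sum l (I - {j}) \<ge> (\<Sum>i\<in>I - {j}. - (\<Lambda> / (4 * real n)))"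
    using low I'(1) by (intro sum_mono) auto
  moreover have "real (card (I - {j})) * (\<Lambda> / (4 * real n)) \<le> real n * (\<Lambda> / (4 * real n))"
    using I'(2,3) assms(1,2) card_mono[of I "I - {j}"] by (intro mult_right_mono) auto
  moreover have "real n * (\<Lambda> / (4 * real n)) = \<Lambda> / 4" using \<open>j < n\<close> by simp
  ultimately show ?thesis using assms(2) by simp
qed

lemma split_estimate:
  fixes s a A L q X c h :: real
  assumes "s * - ((4 / 3) * a + A) \<le> s * X" "s * A \<le> L * A" "(L - s) * - q \<le> (L - s) * X"
    "(L - s) * q \<le> c" "0 \<le> h"
  shows "- ((4 / 3) * s * a) - L * A - c \<le> h + s * X + (L - s) * X"
proof -
  have "s * - ((4 / 3) * a + A) = - ((4 / 3) * s * a) - s * A" by (simp add: algebra_simps)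
  moreover have "(L - s) * - q = - ((L - s) * q)" by simp
  ultimately show ?thesis using assms by linarith
qed

text \<open>The situation at the maximum, reduced to numbers: \<open>a\<close> and \<open>b\<close> are the logarithmic derivatives of \<open>u\<^sub>e\<^sub>e\<close> and
of \<open>v - u\<close>, \<open>g\<close> and \<open>x\<close> the components of the gradient and of the position, \<open>w\<close> the value of \<open>v - u\<close>, and \<open>P\<close> collects the
terms that come from the right-hand side.  The constant \<open>A\<close> is chosen so that \<open>3/4 A\<close> times the lower bound for
\<open>\<Sum>\<^sub>i L i\<close> exceeds \<open>(C1 + 1) \<Lambda>\<close>, and \<open>\<beta>\<close> is chosen for \<open>critical_fine_bound\<close>.\<close>

locale critical_inequality =
  fixes n p m :: nat and l L a b g x :: "nat \<Rightarrow> real" and \<Lambda> w P F R K H H0 C1 C2 A \<beta> E :: real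
  assumes n: "n = Suc m" and p: "1 \<le> p" "p < n" "n \<le> 2 * p"
    and pos: "p_positive n p l" and mono: "\<And>i j. i \<le> j \<Longrightarrow> j < n \<Longrightarrow> l i \<le> l j"
    and L: "L = dlog_coeff n p l" and \<Lambda>: "\<Lambda> = l m" "\<Lambda> \<ge> 1"
    and F: "(\<Prod>I\<in>index_sets n p. sum l I) \<le> F" "F \<ge> 1"
    and w: "w > 0" and x: "\<And>i. i < n \<Longrightarrow> \<bar>x i\<bar> \<le> R" and b: "\<And>i. i < n \<Longrightarrow> \<bar>b i\<bar> \<le> K / w"
    and nonneg: "C1 \<ge> 0" "C2 \<ge> 0" "R \<ge> 0" "K \<ge> 0" and H: "H \<ge> H0" "H0 > 0"
    and A: "A = 2 * (C1 + 1) * (1 + 2 ^ card (index_sets n p) * F)" and \<beta>: "\<beta> = 9 + 12 * A * R\<^sup>2"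
    and critical: "\<And>i. i < n \<Longrightarrow> \<beta> * b i + a i + H * (l i * g i) + A * x i = 0"
    and P: "P \<ge> - (C1 * \<Lambda> + C2 * (1 + \<beta> / w + A))"
    and main: "- (\<beta> * card (index_sets n p) / w) + P
       + (\<Sum>i<m. 2 * \<Lambda> * ((L i - L m) / (\<Lambda> - l i)) * (a i)\<^sup>2)
       + (\<Sum>i<n. L i * (H * (l i)\<^sup>2 + 3 * (H * (l i * g i))\<^sup>2 + A - (a i)\<^sup>2 - \<beta> * (b i)\<^sup>2)) \<le> 0"
    and E: "E = \<beta> * card (index_sets n p) + C2 * (1 + \<beta> + A)
       + 4 * real n * card (index_sets n p) * (3 * A\<^sup>2 * R\<^sup>2 + 4 * \<beta>\<^sup>2 * K\<^sup>2)"
begin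

abbreviation (input) "N \<equiv> real (card (index_sets n p))"
abbreviation (input) "Q \<equiv> 3 * A\<^sup>2 * R\<^sup>2 + 4 * \<beta>\<^sup>2 * K\<^sup>2"

definition T where "T = (\<Sum>i<n. L i)"
definition r where "r = 1 + 1 / w"

lemma A_pos: "A > 0" using nonneg(1) F(2) unfolding A by (intro mult_pos_pos) (auto intro: add_pos_nonneg)
lemma \<beta>_ge: "\<beta> \<ge> 9" "\<beta> \<ge> 12 * A * R\<^sup>2" using A_pos unfolding \<beta> by auto
lemma L_nonneg: "L i \<ge> 0" unfolding L by (rule dlog_coeff_nonneg[OF pos])
lemma L_antimono: "i < n \<Longrightarrow> j < n \<Longrightarrow> l i \<le> l j \<Longrightarrow> L j \<le> L i"
  unfolding L by (rule dlog_coeff_antimono[OF pos])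
lemma l_le: "i < n \<Longrightarrow> l i \<le> \<Lambda>" using mono[of i m] n \<Lambda> by simp
lemma N_ge: "N \<ge> 1"
proof -
  have "0 < n choose p" using p by (intro zero_less_binomial) simp
  then show ?thesis unfolding card_index_sets by linarith
qed
lemma r_ge: "r \<ge> 1" using w by (simp add: r_def)
lemma Q_nonneg: "Q \<ge> 0" by simp

lemma T_eq: "T = p * (\<Sum>I\<in>index_sets n p. 1 / sum l I)"
  unfolding T_def unfolding L by (rule dlog_coeff_total)

lemma inverse_sum_nonneg: "(\<Sum>I\<in>index_sets n p. 1 / sum l I) \<ge> 0"
  using pos by (intro sum_nonneg) (auto simp: p_positive_def less_imp_le)

lemma T_ge_inverse_sum: "T \<ge> (\<Sum>I\<in>index_sets n p. 1 / sum l I)"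
  unfolding T_eq using p(1) inverse_sum_nonneg by (simp add: mult_le_cancel_right1)

lemma T_lower: "T \<ge> 1 / F"
proof -
  have "index_sets n p \<noteq> {}" using N_ge by auto
  then show ?thesis using inverse_sum_lower_bound[OF pos _ F] T_ge_inverse_sum by linarith
qed

lemma T_pos: "T > 0"
proof -
  have "1 / F > 0" using F(2) by simp
  then show ?thesis using T_lower by linarith
qed

lemma crude: "i < n \<Longrightarrow> 3 * (H * (l i * g i))\<^sup>2 - (a i)\<^sup>2 - \<beta> * (b i)\<^sup>2 \<ge> - (Q * r\<^sup>2)"
proof -
  assume i: "i < n"
  have "\<beta> \<ge> 1" using \<beta>_ge by simp
  from critical_crude_bound[OF critical[OF i] this]
  have 1: "(a i)\<^sup>2 + \<beta> * (b i)\<^sup>2 \<le> 3 * (H * (l i * g i))\<^sup>2 + 3 * A\<^sup>2 * (x i)\<^sup>2 + 4 * \<beta>\<^sup>2 * (b i)\<^sup>2" .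
  have r2: "1 \<le> r\<^sup>2" using r_ge by (simp add: one_le_power)
  have "(x i)\<^sup>2 \<le> R\<^sup>2" using x[OF i] by (metis abs_ge_zero power2_abs power_mono)
  also have "\<dots> \<le> R\<^sup>2 * r\<^sup>2" using r2 by (simp add: mult_le_cancel_left1)
  finally have 2: "3 * A\<^sup>2 * (x i)\<^sup>2 \<le> 3 * A\<^sup>2 * (R\<^sup>2 * r\<^sup>2)" by (intro mult_left_mono) auto
  have "\<bar>b i\<bar> \<le> K * r"
  proof -
    have "K / w \<le> K * r" using nonneg(4) by (simp add: r_def algebra_simps)
    then show ?thesis using b[OF i] by linarith
  qed
  then have "(b i)\<^sup>2 \<le> (K * r)\<^sup>2" by (metis abs_ge_zero power2_abs power_mono)
  then have 3: "4 * \<beta>\<^sup>2 * (b i)\<^sup>2 \<le> 4 * \<beta>\<^sup>2 * (K * r)\<^sup>2" by (intro mult_left_mono) auto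
  show ?thesis using 1 2 3 by (simp add: power_mult_distrib algebra_simps)
qed

lemma lower_order: "- (\<beta> * N / w) + P \<ge> - (C1 * \<Lambda>) - (\<beta> * N + C2 * (1 + \<beta> + A)) * r"
proof -
  have "\<beta> * N / w \<le> \<beta> * N * r" using \<beta>_ge by (simp add: r_def algebra_simps)
  moreover have "C2 * (1 + \<beta> / w + A) \<le> C2 * ((1 + \<beta> + A) * r)"
  proof (intro mult_left_mono)
    define X Y where "X = (1 + A) * r" and "Y = \<beta> * r"
    have "Y = \<beta> + \<beta> / w" by (simp add: Y_def r_def algebra_simps)
    moreover have "(1 + A) * 1 \<le> X" unfolding X_def using A_pos r_ge by (intro mult_left_mono) auto
    moreover have "(1 + \<beta> + A) * r = X + Y" by (simp add: X_def Y_def algebra_simps)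
    moreover have "0 \<le> \<beta>" using \<beta>_ge by simp
    ultimately show "1 + \<beta> / w + A \<le> (1 + \<beta> + A) * r" by simp
  qed (use nonneg in simp)
  ultimately show ?thesis using P by (simp add: algebra_simps)
qed

text \<open>The eigenvalue in the denominator may equal \<open>\<Lambda>\<close>; the quotient is then 0.\<close>

lemma third_order_nonneg:
  "i < m \<Longrightarrow> 2 * \<Lambda> * ((L i - L m) / (\<Lambda> - l i)) * (a i)\<^sup>2 \<ge> 0"
  using L_antimono[of i m] l_le[of i] n \<Lambda> mono[of i m] by (intro mult_nonneg_nonneg divide_nonneg_nonneg) auto

lemma E_parts: "E \<ge> 0" "\<beta> * N + C2 * (1 + \<beta> + A) \<le> E" "Q \<le> E" "4 * real n * N * Q \<le> E"
proof -
  have nn: "\<beta> * N + C2 * (1 + \<beta> + A) \<ge> 0"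
    using \<beta>_ge A_pos nonneg by (intro add_nonneg_nonneg mult_nonneg_nonneg) auto
  have "1 * 1 \<le> (4 * real n) * N" using N_ge n by (intro mult_mono) auto
  then have q: "1 * Q \<le> 4 * real n * N * Q" using Q_nonneg by (intro mult_right_mono) auto
  define X Y Z where "X = \<beta> * N + C2 * (1 + \<beta> + A)" and "Y = Q" and "Z = 4 * real n * N * Q"
  have "E = X + Z" "0 \<le> X" "0 \<le> Y" "Y \<le> Z"
    using nn q Q_nonneg unfolding E X_def Y_def Z_def by simp_all
  then have "E \<ge> 0" "X \<le> E" "Y \<le> E" "Z \<le> E" by linarith+
  then show "E \<ge> 0" "\<beta> * N + C2 * (1 + \<beta> + A) \<le> E" "Q \<le> E" "4 * real n * N * Q \<le> E"
    unfolding X_def Y_def Z_def .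
qed

text \<open>The coefficient \<open>L 0\<close> is the largest, so \<open>L 0 * (l 0)\<^sup>2\<close> is at least a constant times \<open>T * \<Lambda>\<^sup>2\<close>.  All other terms are at most of order
\<open>\<Lambda>\<close>, \<open>r\<close> or \<open>T * r\<^sup>2\<close>.\<close>

lemma very_negative_case:
  assumes neg: "l 0 < - (\<Lambda> / (4 * real n))"
  shows "\<Lambda> \<le> (1 + (C1 * F + E * F + E) / (H0 / (16 * real n ^ 3))) * r"
proof -
  define \<kappa> where "\<kappa> = H0 / (16 * real n ^ 3)"
  have n0: "real n > 0" using n by simp
  have \<kappa>: "\<kappa> > 0" using H n0 by (simp add: \<kappa>_def)
  have sq: "(\<Sum>i<n. L i * (l i)\<^sup>2) \<ge> T * \<Lambda>\<^sup>2 / (16 * real n ^ 3)"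
  proof -
    have "T \<le> (\<Sum>i<n. L 0)" unfolding T_def using L_antimono[of 0] mono n by (intro sum_mono) auto
    then have L0: "L 0 \<ge> T / n" using n0 by (simp add: field_simps)
    have "(\<Lambda> / (4 * real n))\<^sup>2 \<le> (- l 0)\<^sup>2" using neg \<Lambda> by (intro power_mono) auto
    then have "(T / n) * (\<Lambda> / (4 * real n))\<^sup>2 \<le> L 0 * (l 0)\<^sup>2"
      using L0 L_nonneg by (intro mult_mono) auto
    also have "\<dots> \<le> (\<Sum>i<n. L i * (l i)\<^sup>2)"
      using L_nonneg n by (intro member_le_sum) auto
    finally show ?thesis using n0 by (simp add: power_divide power2_eq_square power3_eq_cube field_simps)
  qed
  have "(\<Sum>i<n. L i * (H * (l i)\<^sup>2 - Q * r\<^sup>2))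
      \<le> (\<Sum>i<n. L i * (H * (l i)\<^sup>2 + 3 * (H * (l i * g i))\<^sup>2 + A - (a i)\<^sup>2 - \<beta> * (b i)\<^sup>2))"
    using crude A_pos L_nonneg by (intro sum_mono mult_left_mono) (force simp: algebra_simps)+
  moreover have "(\<Sum>i<n. L i * (H * (l i)\<^sup>2 - Q * r\<^sup>2)) = H * (\<Sum>i<n. L i * (l i)\<^sup>2) - T * (Q * r\<^sup>2)"
    unfolding T_def sum_distrib_left sum_distrib_right sum_subtractf[symmetric]
    by (intro sum.cong refl) (simp add: algebra_simps)
  moreover have "H * (\<Sum>i<n. L i * (l i)\<^sup>2) \<ge> \<kappa> * (T * \<Lambda>\<^sup>2)"
  proof -
    have "H0 * (T * \<Lambda>\<^sup>2 / (16 * real n ^ 3)) \<le> H * (\<Sum>i<n. L i * (l i)\<^sup>2)"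
      using H sq T_pos by (intro mult_mono) auto
    then show ?thesis by (simp add: \<kappa>_def)
  qed
  moreover have "0 \<le> (\<Sum>i<m. 2 * \<Lambda> * ((L i - L m) / (\<Lambda> - l i)) * (a i)\<^sup>2)"
    using third_order_nonneg by (intro sum_nonneg) auto
  ultimately have "\<kappa> * (T * \<Lambda>\<^sup>2) \<le> C1 * \<Lambda> + (\<beta> * N + C2 * (1 + \<beta> + A)) * r + T * (Q * r\<^sup>2)"
    using main lower_order by linarith
  also have "\<dots> \<le> C1 * \<Lambda> + E * r + T * (E * r\<^sup>2)"
  proof (intro add_mono order_refl)
    show "(\<beta> * N + C2 * (1 + \<beta> + A)) * r \<le> E * r"
      using E_parts(2) r_ge by (intro mult_right_mono) auto
    show "T * (Q * r\<^sup>2) \<le> T * (E * r\<^sup>2)"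
      using E_parts(3) T_pos by (intro mult_left_mono mult_right_mono) auto
  qed
  also have "\<dots> \<le> T * ((C1 * F + E * F) * (\<Lambda> * r) + E * r\<^sup>2)"
  proof -
    have TF: "1 \<le> T * F" using T_lower F(2) by (simp add: field_simps)
    have "C1 * \<Lambda> \<le> C1 * (\<Lambda> * r)" using nonneg \<Lambda> r_ge by (intro mult_left_mono) auto
    moreover have "E * r \<le> E * (\<Lambda> * r)" using E_parts \<Lambda> r_ge by (intro mult_left_mono) auto
    ultimately have "C1 * \<Lambda> + E * r \<le> 1 * ((C1 + E) * (\<Lambda> * r))" by (simp add: algebra_simps)
    also have "\<dots> \<le> (T * F) * ((C1 + E) * (\<Lambda> * r))"
      using TF nonneg E_parts \<Lambda> r_ge by (intro mult_right_mono) auto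
    finally show ?thesis by (simp add: algebra_simps)
  qed
  finally have "T * (\<kappa> * \<Lambda>\<^sup>2) \<le> T * ((C1 * F + E * F) * (\<Lambda> * r) + E * r\<^sup>2)"
    by (simp add: mult_ac)
  then have k: "\<kappa> * \<Lambda>\<^sup>2 \<le> (C1 * F + E * F) * (\<Lambda> * r) + E * r\<^sup>2" using T_pos by simp
  have cf: "C1 * F + E * F \<ge> 0" using nonneg E_parts F by simp
  show ?thesis
  proof (cases "\<Lambda> \<le> r")
    case True
    have "1 * r \<le> (1 + (C1 * F + E * F + E) / \<kappa>) * r"
      using cf E_parts \<kappa> r_ge by (intro mult_right_mono) auto
    then show ?thesis using True by (simp add: \<kappa>_def)
  next
    case False
    then have "r\<^sup>2 \<le> \<Lambda> * r" using r_ge by (simp add: power2_eq_square mult_right_mono)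
    then have "E * r\<^sup>2 \<le> E * (\<Lambda> * r)" using E_parts by (intro mult_left_mono) auto
    with k have "\<Lambda> * (\<kappa> * \<Lambda>) \<le> \<Lambda> * ((C1 * F + E * F + E) * r)"
      by (simp add: power2_eq_square algebra_simps)
    then have "\<kappa> * \<Lambda> \<le> (C1 * F + E * F + E) * r" using \<Lambda>(2) by simp
    then have "\<Lambda> \<le> (C1 * F + E * F + E) / \<kappa> * r" using \<kappa> by (simp add: field_simps)
    also have "\<dots> \<le> (1 + (C1 * F + E * F + E) / \<kappa>) * r" using r_ge by (simp add: algebra_simps)
    finally show ?thesis by (simp add: \<kappa>_def)
  qed
qed

text \<open>The part of \<open>L i\<close> that comes from small sums.  Only this part can be large compared with \<open>1 / \<Lambda>\<close>.\<close>

definition S where "S i = (\<Sum>I | I \<in> index_sets n p \<and> i \<in> I \<and> sum l I \<le> \<Lambda> / 4. 1 / sum l I)"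

lemma S_nonneg: "S i \<ge> 0"
  unfolding S_def using pos by (intro sum_nonneg) (auto simp: p_positive_def less_imp_le)

lemma L_minus_S: "0 \<le> L i - S i" "L i - S i \<le> 4 * N / \<Lambda>"
proof -
  let ?X = "{I. I \<in> index_sets n p \<and> i \<in> I}" and ?Y = "{I. I \<in> index_sets n p \<and> i \<in> I \<and> sum l I \<le> \<Lambda> / 4}"
  have fin: "finite ?X" by simp
  have "?Y \<subseteq> ?X" by auto
  then have eq: "L i - S i = (\<Sum>I\<in>?X - ?Y. 1 / sum l I)"
    unfolding L S_def dlog_coeff_def using sum_diff[OF fin, of ?Y "\<lambda>I. 1 / sum l I"] by simp
  show "0 \<le> L i - S i" unfolding eq using pos
    by (intro sum_nonneg) (auto simp: p_positive_def less_imp_le)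
  have "(\<Sum>I\<in>?X - ?Y. 1 / sum l I) \<le> (\<Sum>I\<in>?X - ?Y. 4 / \<Lambda>)"
  proof (rule sum_mono)
    fix I assume "I \<in> ?X - ?Y"
    then have "sum l I > \<Lambda> / 4" by auto
    then show "1 / sum l I \<le> 4 / \<Lambda>" using \<Lambda>(2) frac_le[of 1 1 "\<Lambda> / 4" "sum l I"] by simp
  qed
  also have "\<dots> \<le> N * (4 / \<Lambda>)"
  proof -
    have "card (?X - ?Y) \<le> card (index_sets n p)" by (intro card_mono) auto
    then show ?thesis using \<Lambda>(2) by (simp add: divide_right_mono)
  qed
  finally show "L i - S i \<le> 4 * N / \<Lambda>" unfolding eq by (simp add: mult.commute)
qed

text \<open>The small part \<open>S i\<close> of each coefficient is paired with the third derivative terms, where \<open>2 / (3/2) = 4/3\<close>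
matches the factor in \<open>critical_fine_bound\<close>.  The remaining part of the coefficient is so small that \<open>crude\<close> suffices.\<close>

lemma mildly_negative_case:
  assumes low: "l 0 \<ge> - (\<Lambda> / (4 * real n))"
  shows "\<Lambda> \<le> (1 + 2 * E) * r"
proof -
  have low': "l i \<ge> - (\<Lambda> / (4 * real n))" if "i < n" for i using low mono[of 0 i] that by simp
  have low4: "l i \<ge> - (\<Lambda> / 4)" if "i < n" for i
  proof -
    have "\<Lambda> / (4 * n) \<le> \<Lambda> / 4" using \<Lambda> n by (intro divide_left_mono) auto
    then show ?thesis using low'[OF that] by linarith
  qed
  have half: "sum l I \<ge> \<Lambda> / 2" if "I \<in> index_sets n p" "j \<in> I" "l j = \<Lambda>" for I j
    using sum_containing_top_ge_half[of p n \<Lambda> l, OF _ _ low' that] p \<Lambda> by simp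
  have S0: "S i = 0" if "l i = \<Lambda>" for i
  proof -
    \<comment> \<open>As for the top index, all sums over sets containing \<open>i\<close> are at least \<open>\<Lambda> / 2\<close>.\<close>
    have none: "{I. I \<in> index_sets n p \<and> i \<in> I \<and> sum l I \<le> \<Lambda> / 4} = {}"
      using half[OF _ _ that] \<Lambda>(2) by force
    show ?thesis unfolding S_def none by simp
  qed
  have third: "(4 / 3) * S i * (a i)\<^sup>2 \<le> 2 * \<Lambda> * ((L i - L m) / (\<Lambda> - l i)) * (a i)\<^sup>2" if i: "i < m" for i
  proof (cases "l i = \<Lambda>")
    case True then show ?thesis using S0[OF True] by simp
  next
    case False
    then have lt: "l i < \<Lambda>" using l_le[of i] i n by simp
    define D where "D = (L i - L m) / (\<Lambda> - l i)"
    have "(\<Lambda> - l i) * S i \<le> (3 / 2) * \<Lambda> * (L i - L m)"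
      unfolding S_def unfolding L \<Lambda>(1)
      by (rule dlog_coeff_exchange_lower_bound[OF pos]) (use i n lt \<Lambda> low4 half in auto)
    then have "S i \<le> (3 / 2) * \<Lambda> * (L i - L m) / (\<Lambda> - l i)"
      using lt by (subst pos_le_divide_eq) (auto simp: mult.commute)
    then have "S i \<le> (3 / 2) * \<Lambda> * D" by (simp only: D_def times_divide_eq_right)
    then have "(4 / 3) * S i \<le> 2 * \<Lambda> * ((L i - L m) / (\<Lambda> - l i))"
      unfolding D_def[symmetric] by linarith
    then show ?thesis by (intro mult_right_mono) auto
  qed
  have "(\<Sum>i<n. (4 / 3) * S i * (a i)\<^sup>2) = (\<Sum>i<m. (4 / 3) * S i * (a i)\<^sup>2)"
    using S0[of m] \<Lambda>(1) by (simp add: n)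
  also have "\<dots> \<le> (\<Sum>i<m. 2 * \<Lambda> * ((L i - L m) / (\<Lambda> - l i)) * (a i)\<^sup>2)"
    using third by (intro sum_mono) auto
  finally have 1: "(\<Sum>i<n. (4 / 3) * S i * (a i)\<^sup>2) \<le> (\<Sum>i<m. 2 * \<Lambda> * ((L i - L m) / (\<Lambda> - l i)) * (a i)\<^sup>2)" .
  have "(\<Sum>i<n. L i * A - (4 / 3) * S i * (a i)\<^sup>2 - L i * (A / 4) - 4 * N / \<Lambda> * (Q * r\<^sup>2))
     \<le> (\<Sum>i<n. L i * (H * (l i)\<^sup>2 + 3 * (H * (l i * g i))\<^sup>2 + A - (a i)\<^sup>2 - \<beta> * (b i)\<^sup>2))"
  proof (rule sum_mono)
    fix i assume "i \<in> {..<n}"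
    then have i: "i < n" by simp
    let ?X = "3 * (H * (l i * g i))\<^sup>2 - (a i)\<^sup>2 - \<beta> * (b i)\<^sup>2"
    have "- ((4 / 3) * (a i)\<^sup>2 + A / 4) \<le> ?X"
      using critical_fine_bound[OF critical[OF i] \<beta>_ge x[OF i] less_imp_le[OF A_pos]] by linarith
    then have "S i * - ((4 / 3) * (a i)\<^sup>2 + A / 4) \<le> S i * ?X" by (intro mult_left_mono S_nonneg)
    moreover have "S i * (A / 4) \<le> L i * (A / 4)" using L_minus_S(1)[of i] A_pos by (intro mult_right_mono) auto
    moreover have "(L i - S i) * - (Q * r\<^sup>2) \<le> (L i - S i) * ?X"
      using crude[OF i] L_minus_S(1)[of i] by (intro mult_left_mono) auto
    moreover have "(L i - S i) * (Q * r\<^sup>2) \<le> 4 * N / \<Lambda> * (Q * r\<^sup>2)"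
      using L_minus_S(2)[of i] by (intro mult_right_mono) auto
    moreover have "0 \<le> L i * (H * (l i)\<^sup>2)" using L_nonneg[of i] H by simp
    ultimately have "- ((4 / 3) * S i * (a i)\<^sup>2) - L i * (A / 4) - 4 * N / \<Lambda> * (Q * r\<^sup>2)
        \<le> L i * (H * (l i)\<^sup>2) + S i * ?X + (L i - S i) * ?X"
      by (rule split_estimate)
    then show "L i * A - (4 / 3) * S i * (a i)\<^sup>2 - L i * (A / 4) - 4 * N / \<Lambda> * (Q * r\<^sup>2)
      \<le> L i * (H * (l i)\<^sup>2 + 3 * (H * (l i * g i))\<^sup>2 + A - (a i)\<^sup>2 - \<beta> * (b i)\<^sup>2)"
      by (simp add: algebra_simps)
  qed
  moreover have "(\<Sum>i<n. L i * A - (4 / 3) * S i * (a i)\<^sup>2 - L i * (A / 4) - 4 * N / \<Lambda> * (Q * r\<^sup>2))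
     = T * A - (\<Sum>i<n. (4 / 3) * S i * (a i)\<^sup>2) - T * (A / 4) - n * (4 * N / \<Lambda> * (Q * r\<^sup>2))"
    unfolding T_def by (simp only: sum_subtractf sum_distrib_right[symmetric] sum_constant card_lessThan)
  ultimately have "T * A - T * (A / 4) \<le> C1 * \<Lambda> + (\<beta> * N + C2 * (1 + \<beta> + A)) * r + n * (4 * N / \<Lambda> * (Q * r\<^sup>2))"
    using 1 main lower_order by linarith
  moreover have "(C1 + 1) * \<Lambda> \<le> T * A - T * (A / 4)"
  proof -
    define k where "k = 1 + 2 ^ card (index_sets n p) * F"
    have k: "k \<ge> 1" using F by (simp add: k_def)
    have "l (n - 1) / k \<le> (\<Sum>I\<in>index_sets n p. 1 / sum l I)"
      unfolding k_def using half[of _ m] n \<Lambda> F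
      by (intro inverse_sum_ge_top[OF p pos]) auto
    then have "\<Lambda> / k \<le> T" using T_ge_inverse_sum n \<Lambda> by simp
    then have "\<Lambda> \<le> T * k" using k by (simp add: field_simps)
    then have "(3 / 2) * (C1 + 1) * \<Lambda> \<le> (3 / 2) * (C1 + 1) * (T * k)" using nonneg by (intro mult_left_mono) auto
    moreover have "(C1 + 1) * \<Lambda> \<le> (3 / 2) * (C1 + 1) * \<Lambda>" using nonneg \<Lambda> by (intro mult_right_mono) auto
    moreover have "T * A - T * (A / 4) = (3 / 2) * (C1 + 1) * (T * k)"
      unfolding A k_def[symmetric] by (simp add: field_simps)
    ultimately show ?thesis by linarith
  qed
  moreover have "(C1 + 1) * \<Lambda> = C1 * \<Lambda> + \<Lambda>" by (simp add: algebra_simps)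
  ultimately have "\<Lambda> \<le> (\<beta> * N + C2 * (1 + \<beta> + A)) * r + n * (4 * N / \<Lambda> * (Q * r\<^sup>2))"
    by linarith
  also have "\<dots> \<le> E * r + E * (r\<^sup>2 / \<Lambda>)"
  proof (intro add_mono mult_right_mono E_parts)
    have "real n * (4 * N / \<Lambda> * (Q * r\<^sup>2)) = (4 * real n * N * Q) * (r\<^sup>2 / \<Lambda>)" by simp
    also have "\<dots> \<le> E * (r\<^sup>2 / \<Lambda>)" using E_parts \<Lambda> by (intro mult_right_mono) auto
    finally show "real n * (4 * N / \<Lambda> * (Q * r\<^sup>2)) \<le> E * (r\<^sup>2 / \<Lambda>)" .
  qed (use r_ge in simp)
  finally have fin: "\<Lambda> \<le> E * r + E * (r\<^sup>2 / \<Lambda>)" .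
  show ?thesis
  proof (cases "\<Lambda> \<le> r")
    case True
    have "1 * r \<le> (1 + 2 * E) * r" using E_parts r_ge by (intro mult_right_mono) auto
    then show ?thesis using True by simp
  next
    case False
    then have "r\<^sup>2 / \<Lambda> \<le> r" using r_ge \<Lambda> by (simp add: power2_eq_square pos_divide_le_eq)
    then have "E * (r\<^sup>2 / \<Lambda>) \<le> E * r" using E_parts by (intro mult_left_mono) auto
    then show ?thesis using fin r_ge by (simp add: algebra_simps)
  qed
qed

theorem top_eigenvalue_bound:
  "\<Lambda> \<le> (1 + 2 * E + (C1 * F + E * F + E) / (H0 / (16 * real n ^ 3))) * (1 + 1 / w)"
proof -
  define M where "M = (C1 * F + E * F + E) / (H0 / (16 * real n ^ 3))"
  have M: "M \<ge> 0" unfolding M_def using nonneg E_parts F H by (intro divide_nonneg_nonneg) auto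
  have "\<Lambda> \<le> (1 + M) * r \<or> \<Lambda> \<le> (1 + 2 * E) * r"
    using very_negative_case mildly_negative_case unfolding M_def by linarith
  moreover have "(1 + M) * r \<le> (1 + 2 * E + M) * r" "(1 + 2 * E) * r \<le> (1 + 2 * E + M) * r"
    using M E_parts r_ge by (auto intro!: mult_right_mono)
  ultimately have "\<Lambda> \<le> (1 + 2 * E + M) * r" by linarith
  then show ?thesis unfolding M_def r_def .
qed

end

section \<open>The contribution of the right-hand side\<close>

lemma partial_deriv_bound:
  fixes f :: "'a::euclidean_space \<Rightarrow> real"
  assumes "f differentiable (at z)" "\<And>b. b \<in> Basis \<Longrightarrow> \<bar>pd b f z\<bar> \<le> K"
  shows "\<bar>pd v f z\<bar> \<le> K * DIM('a) * norm v"
proof -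
  have "\<bar>pd v f z\<bar> \<le> (\<Sum>b\<in>Basis. \<bar>(v \<bullet> b) * pd b f z\<bar>)"
    unfolding partial_deriv_expand[OF assms(1), of v] by (rule sum_abs)
  also have "\<dots> \<le> (\<Sum>b\<in>(Basis :: 'a set). norm v * K)"
    unfolding abs_mult using assms(2) by (intro sum_mono mult_mono Basis_le_norm) auto
  finally show ?thesis by (simp add: mult_ac)
qed

lemma second_partial_deriv_bound:
  fixes f :: "'a::euclidean_space \<Rightarrow> real"
  assumes "\<And>b. b \<in> Basis \<Longrightarrow> pd b f differentiable (at z)"
    "\<And>b c. b \<in> Basis \<Longrightarrow> c \<in> Basis \<Longrightarrow> \<bar>pd c (pd b f) z\<bar> \<le> K"
  shows "\<bar>\<Sum>b\<in>Basis. (v \<bullet> b) * pd v (pd b f) z\<bar> \<le> K * (DIM('a) * norm v)\<^sup>2"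
proof -
  have "\<bar>\<Sum>b\<in>Basis. (v \<bullet> b) * pd v (pd b f) z\<bar>
      \<le> (\<Sum>b\<in>Basis. \<bar>(v \<bullet> b) * pd v (pd b f) z\<bar>)" by (rule sum_abs)
  also have "\<dots> \<le> (\<Sum>b\<in>(Basis :: 'a set). norm v * (K * DIM('a) * norm v))"
    unfolding abs_mult
    by (intro sum_mono mult_mono Basis_le_norm partial_deriv_bound assms) auto
  finally show ?thesis by (simp add: power2_eq_square mult_ac)
qed

context eigenframe_at
begin

text \<open>The argument of \<open>f\<close> in the equation; the next two definitions are the first and second derivatives of that argument along the line in the
direction \<open>y\<close>.\<close>

definition jet_point :: "(real^'n) \<times> real \<times> (real^'n)" where
  "jet_point = (x0, u x0, grad u x0)"

definition jet_velocity :: "real^'n \<Rightarrow> (real^'n) \<times> real \<times> (real^'n)" where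
  "jet_velocity y = (y, pd y u x0, hessian u x0 *v y)"

definition jet_acceleration :: "real^'n \<Rightarrow> (real^'n) \<times> real \<times> (real^'n)" where
  "jet_acceleration y = (0, pd y (pd y u) x0,
     (\<chi> i. pd y (pd y (pd (axis i 1) u)) x0))"

lemma jet2_right_hand_side:
  assumes f: "Ck_dir 2 (U \<times> UNIV \<times> UNIV) f"
    and eq: "\<And>x. x \<in> U \<Longrightarrow> p_sum_prod p (hessian u x) = f (x, u x, grad u x)"
    and fpos: "f jet_point > 0"
  shows "jet2 (\<lambda>t. ln (p_sum_prod p (hessian u (x0 + t *\<^sub>R y))))
    (pd (jet_velocity y) f jet_point / f jet_point)
    ((pd (jet_acceleration y) f jet_point
        + (\<Sum>b\<in>Basis. (jet_velocity y \<bullet> b) * pd (jet_velocity y) (pd b f) jet_point)) / f jet_point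
     - (pd (jet_velocity y) f jet_point / f jet_point)\<^sup>2)"
proof -
  define \<gamma> where "\<gamma> t = (x0 + t *\<^sub>R y, u (x0 + t *\<^sub>R y), grad u (x0 + t *\<^sub>R y))" for t
  have \<gamma>0: "\<gamma> 0 = jet_point" by (simp add: \<gamma>_def jet_point_def)
  have hess: "(hessian u x0 *v y) $ i = pd y (pd (axis i 1) u) x0" for i
    using hessian_bilinear[OF U C2, of "axis i 1" y] partial_deriv_commute[OF U C2, of y "axis i 1"]
    by (simp add: inner_axis')
  have comp: "jet2 (\<lambda>t. \<gamma> t \<bullet> b) (jet_velocity y \<bullet> b) (jet_acceleration y \<bullet> b)" for b
  proof -
    obtain b1 b2 b3 where b: "b = (b1, b2, b3)" by (cases b) auto
    have "jet2 (\<lambda>t. (x0 \<bullet> b1 + t * (y \<bullet> b1)) + (b2 * u (x0 + t *\<^sub>R y)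
        + (\<Sum>i\<in>UNIV. b3 $ i * pd (axis i 1) u (x0 + t *\<^sub>R y))))
      (y \<bullet> b1 + (b2 * pd y u x0 + (\<Sum>i\<in>UNIV. b3 $ i * pd y (pd (axis i 1) u) x0)))
      (0 + (b2 * pd y (pd y u) x0
        + (\<Sum>i\<in>UNIV. b3 $ i * pd y (pd y (pd (axis i 1) u)) x0)))"
      by (intro jet2_add jet2_affine jet2_cmult jet2_sum jet2_line[OF U] C2 C2_first)
    moreover have "(\<lambda>t. \<gamma> t \<bullet> b) = (\<lambda>t. (x0 \<bullet> b1 + t * (y \<bullet> b1)) + (b2 * u (x0 + t *\<^sub>R y)
        + (\<Sum>i\<in>UNIV. b3 $ i * pd (axis i 1) u (x0 + t *\<^sub>R y))))"
      by (simp add: fun_eq_iff \<gamma>_def b inner_add_left grad_def inner_vec_def[of "vec_lambda _"] mult.commute)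
    moreover have "jet_velocity y \<bullet> b = y \<bullet> b1 + (b2 * pd y u x0
        + (\<Sum>i\<in>UNIV. b3 $ i * pd y (pd (axis i 1) u) x0))"
      by (simp add: jet_velocity_def b inner_vec_def[of "_ *v _"] hess mult.commute)
    moreover have "jet_acceleration y \<bullet> b = 0 + (b2 * pd y (pd y u) x0
        + (\<Sum>i\<in>UNIV. b3 $ i * pd y (pd y (pd (axis i 1) u)) x0))"
      by (simp add: jet_acceleration_def b inner_vec_def[of "vec_lambda _"] mult.commute)
    ultimately show ?thesis by (simp only:)
  qed
  have W: "open (U \<times> (UNIV :: real set) \<times> (UNIV :: (real^'n) set))"
    by (intro open_Times U open_UNIV)
  have "jet2 (\<lambda>t. f (\<gamma> t)) (pd (jet_velocity y) f jet_point)
    (pd (jet_acceleration y) f jet_point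
        + (\<Sum>b\<in>Basis. (jet_velocity y \<bullet> b) * pd (jet_velocity y) (pd b f) jet_point))"
    unfolding \<gamma>0[symmetric]
    by (rule jet2_curve[OF W _ f comp]) (simp add: \<gamma>_def U)
  from jet2_ln[OF this] fpos
  have "jet2 (\<lambda>t. ln (f (\<gamma> t)))
    (pd (jet_velocity y) f jet_point / f jet_point)
    ((pd (jet_acceleration y) f jet_point
        + (\<Sum>b\<in>Basis. (jet_velocity y \<bullet> b) * pd (jet_velocity y) (pd b f) jet_point)) / f jet_point
     - (pd (jet_velocity y) f jet_point / f jet_point)\<^sup>2)"
    unfolding \<gamma>0 by simp
  then show ?thesis
  proof (rule jet2_cong)
    show "\<forall>\<^sub>F t in nhds 0. ln (f (\<gamma> t)) = ln (p_sum_prod p (hessian u (x0 + t *\<^sub>R y)))"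
      using eventually_line_in_open[OF U, of y] by eventually_elim (simp add: eq \<gamma>_def)
  qed
qed

lemma norm_triple_le: "norm (a, b, c) \<le> norm a + norm b + norm c"
  using norm_Pair_le[of a "(b, c)"] norm_Pair_le[of b c] by linarith

lemma top_positive:
  assumes "1 \<le> p" "p \<le> CARD('n)"
  shows "l m > 0"
proof -
  have "{..<p} \<in> index_sets CARD('n) p" using assms by (auto simp: index_sets_def)
  then have "0 < sum l {..<p}" using l_positive by (simp add: p_positive_def)
  also have "\<dots> \<le> (\<Sum>i<p. l m)" using assms m by (intro sum_mono l_mono) auto
  finally show ?thesis using assms by (simp add: zero_less_mult_iff)
qed

text \<open>Positivity of the sums of \<open>p\<close> eigenvalues bounds the negative eigenvalues by the top one.\<close>

lemma eigenvalue_abs_bound: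
  assumes "1 \<le> p" "p \<le> CARD('n)" "i < CARD('n)"
  shows "\<bar>l i\<bar> \<le> CARD('n) * l m"
proof -
  have lm: "l m > 0" by (rule top_positive[OF assms(1,2)])
  have "{..<p} \<in> index_sets CARD('n) p" using assms by (auto simp: index_sets_def)
  then have "0 < sum l {..<p}" using l_positive by (simp add: p_positive_def)
  also have "sum l {..<p} = l 0 + sum l ({..<p} - {0})" using assms(1) by (simp add: sum.remove[of _ 0])
  also have "sum l ({..<p} - {0}) \<le> (\<Sum>i\<in>{..<p} - {0}. l m)" using assms m by (intro sum_mono l_mono) auto
  also have "(\<Sum>i\<in>{..<p} - {0}. l m) = (real p - 1) * l m" using assms(1) by (simp add: of_nat_diff)
  finally have "- l 0 \<le> (real p - 1) * l m" by simp
  also have "\<dots> \<le> CARD('n) * l m" using assms lm by (intro mult_right_mono) auto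
  finally have 1: "- l 0 \<le> CARD('n) * l m" .
  have "l i \<le> 1 * l m" using l_mono[of i m] assms m by simp
  also have "\<dots> \<le> CARD('n) * l m" using lm m by (intro mult_right_mono) auto
  finally show ?thesis using 1 l_mono[of 0 i] assms by linarith
qed

lemma hessian_norm_bound:
  assumes "1 \<le> p" "p \<le> CARD('n)"
  shows "norm (hessian u x0 *v y) \<le> CARD('n) * l m * norm y"
proof -
  let ?k = "CARD('n) * l m"
  have k: "?k \<ge> 0" using top_positive[OF assms] by simp
  have "(hessian u x0 *v y) \<bullet> (hessian u x0 *v y) = (\<Sum>i<CARD('n). ((hessian u x0 *v y) \<bullet> q i) * ((hessian u x0 *v y) \<bullet> q i))"
    by (rule orthonormal_frame_parseval[OF frame])
  also have "\<dots> = (\<Sum>i<CARD('n). (l i)\<^sup>2 * ((y \<bullet> q i) * (y \<bullet> q i)))"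
    using eigen by (intro sum.cong refl)
      (simp add: matrix_inner_transpose hessian_symmetric[OF U C2] power2_eq_square)
  also have "\<dots> \<le> (\<Sum>i<CARD('n). ?k\<^sup>2 * ((y \<bullet> q i) * (y \<bullet> q i)))"
  proof (intro sum_mono mult_right_mono)
    fix i assume "i \<in> {..<CARD('n)}"
    then have "\<bar>l i\<bar> \<le> ?k" using eigenvalue_abs_bound[OF assms] by simp
    then show "(l i)\<^sup>2 \<le> ?k\<^sup>2" by (metis abs_ge_zero power2_abs power_mono)
  qed auto
  also have "\<dots> = ?k\<^sup>2 * (y \<bullet> y)"
    unfolding orthonormal_frame_parseval[OF frame, of y y] by (simp add: sum_distrib_left)
  finally have "(norm (hessian u x0 *v y))\<^sup>2 \<le> (?k * norm y)\<^sup>2"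
    by (simp add: power2_norm_eq_inner power_mult_distrib)
  then show ?thesis using k by (simp add: power2_le_iff_abs_le)
qed

lemma norm_le_frame_sum: "norm y \<le> (\<Sum>i<CARD('n). \<bar>y \<bullet> q i\<bar>)"
proof -
  have "norm y = norm (\<Sum>i<CARD('n). (y \<bullet> q i) *\<^sub>R q i)"
    using orthonormal_frame_expand[OF frame, of y] by simp
  also have "\<dots> \<le> (\<Sum>i<CARD('n). norm ((y \<bullet> q i) *\<^sub>R q i))" by (rule norm_sum)
  also have "\<dots> = (\<Sum>i<CARD('n). \<bar>y \<bullet> q i\<bar>)"
    using orthonormal_frame_norm[OF frame] by simp
  finally show ?thesis .
qed

lemma acceleration_component:
  "(\<chi> i. pd y (pd y (pd (axis i 1) u)) x0) \<bullet> z
     = pd y (pd y (pd z u)) x0"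
proof -
  have d: "pd y (pd y u) differentiable (at x0)"
    using C2_second[of y y] U(2) by (simp add: numeral_2_eq_2)
  show ?thesis unfolding third_derivative_rotate[of y y] partial_deriv_vec[OF d, of z]
    by (simp add: inner_vec_def mult.commute)
qed

text \<open>Differentiating \<open>ln f(x, u, Du)\<close> twice produces \<open>u\<^sub>e\<^sub>e\<^sup>2\<close> and the gradient of \<open>u\<^sub>e\<^sub>e\<close>.  The latter is
expressed by the first order condition, and after division by \<open>l m\<close> the total is linear in \<open>l m\<close>.  The factor in front of \<open>l m\<close>
does not involve \<open>A\<close> and \<open>\<beta>\<close>, so that \<open>A\<close> can be chosen afterwards.\<close>

theorem right_hand_side_bound:
  fixes K k D A R w \<beta> H m0 Kf :: real
  assumes p: "1 \<le> p" "p \<le> CARD('n)" and lm: "l m \<ge> 1"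
    and f: "Ck_dir 2 (U \<times> UNIV \<times> UNIV) f" and fm: "f jet_point \<ge> m0" "m0 > 0"
    and fK: "\<And>b. b \<in> Basis \<Longrightarrow> \<bar>pd b f jet_point\<bar> \<le> Kf"
      "\<And>b b'. b \<in> Basis \<Longrightarrow> b' \<in> Basis \<Longrightarrow> \<bar>pd b' (pd b f) jet_point\<bar> \<le> Kf"
    and K: "norm (grad u x0) \<le> K" and D: "D = DIM((real^'n) \<times> real \<times> (real^'n))" and k: "k = Kf * D / m0"
    and H: "0 \<le> H" "H \<le> 1" and nn: "\<beta> \<ge> 0" "w > 0" "A \<ge> 0" "R \<ge> 0"
    and a: "\<And>i. i < CARD('n) \<Longrightarrow> a i = pd e (pd e (pd (q i) u)) x0 / l m"
    and critical: "\<And>i. i < CARD('n) \<Longrightarrow> \<beta> * b i + a i + H * (l i * pd (q i) u x0) + A * x i = 0"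
    and bx: "\<And>i. i < CARD('n) \<Longrightarrow> \<bar>b i\<bar> \<le> K / w" "\<And>i. i < CARD('n) \<Longrightarrow> \<bar>x i\<bar> \<le> R"
    and d2: "d2 = (pd (jet_acceleration e) f jet_point
        + (\<Sum>b\<in>Basis. (jet_velocity e \<bullet> b) * pd (jet_velocity e) (pd b f) jet_point)) / f jet_point
     - (pd (jet_velocity e) f jet_point / f jet_point)\<^sup>2"
    and y1: "y1 = pd (jet_velocity (grad u x0)) f jet_point / f jet_point"
  shows "d2 / l m + H * y1 \<ge> - ((k * (K + K\<^sup>2 + real CARD('n) * K) + k * (real CARD('n))\<^sup>2 * K + (k * D + k\<^sup>2) * (2 + K)\<^sup>2) * l m
      + k * (1 + real CARD('n) * K + real CARD('n) * R) * (1 + \<beta> / w + A))"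
proof -
  let ?n = "real CARD('n)"
  have K0: "K \<ge> 0" using K norm_ge_zero order_trans by blast
  obtain b0 :: "(real^'n) \<times> real \<times> (real^'n)" where "b0 \<in> Basis" using nonempty_Basis by blast
  then have Kf0: "Kf \<ge> 0" using fK(1) abs_ge_zero order_trans by blast
  have D0: "D \<ge> 0" by (simp add: D)
  have k0: "k \<ge> 0" unfolding k using Kf0 D0 fm by simp
  have z: "jet_point \<in> U \<times> UNIV \<times> UNIV" using U by (simp add: jet_point_def)
  have fd: "f differentiable (at jet_point)" "pd b f differentiable (at jet_point)" for b
    using Ck_dir_differentiable[OF f _ z] Ck_dir_differentiable[OF Ck_dir_partial[OF f] _ z] by simp_all
  have first: "\<bar>pd v f jet_point / f jet_point\<bar> \<le> k * norm v" for v
  proof -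
    have "\<bar>pd v f jet_point\<bar> / f jet_point \<le> (Kf * D * norm v) / m0"
      unfolding D using fm Kf0 by (intro frac_le partial_deriv_bound fd fK(1)) auto
    then show ?thesis using fm by (simp add: k abs_divide)
  qed
  have second: "\<bar>(\<Sum>b\<in>Basis. (v \<bullet> b) * pd v (pd b f) jet_point) / f jet_point\<bar>
      \<le> k * D * (norm v)\<^sup>2" for v
  proof -
    have "\<bar>\<Sum>b\<in>Basis. (v \<bullet> b) * pd v (pd b f) jet_point\<bar> / f jet_point
      \<le> Kf * (D * norm v)\<^sup>2 / m0"
      unfolding D using fm Kf0 by (intro frac_le second_partial_deriv_bound fd(2) fK(2)) auto
    then show ?thesis using fm by (simp add: k abs_divide power2_eq_square mult_ac)
  qed
  have m': "m < CARD('n)" using m by simp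
  have en: "norm e = 1" using orthonormal_frame_norm(1)[OF frame m'] e by simp
  have grad_le: "\<bar>pd y u x0\<bar> \<le> K * norm y" for y
  proof -
    have "\<bar>pd y u x0\<bar> \<le> norm (grad u x0) * norm y"
      unfolding partial_deriv_grad[OF differentiable_u(1)] by (rule Cauchy_Schwarz_ineq2)
    also have "\<dots> \<le> K * norm y" using K by (intro mult_right_mono) auto
    finally show ?thesis .
  qed
  have "H * y1 \<ge> - (k * (K + K\<^sup>2 + ?n * K) * l m)"
  proof -
    have "norm (jet_velocity (grad u x0)) \<le> K + K * K + ?n * l m * K"
    proof -
      have "\<bar>pd (grad u x0) u x0\<bar> \<le> K * K"
        using grad_le[of "grad u x0"] mult_left_mono[OF K K0] by linarith
      moreover have "norm (hessian u x0 *v grad u x0) \<le> ?n * l m * K"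
      proof -
        have "0 \<le> ?n * l m" using lm by simp
        from mult_left_mono[OF K this] show ?thesis
          using hessian_norm_bound[OF p, of "grad u x0"] by linarith
      qed
      ultimately show ?thesis
        unfolding jet_velocity_def using norm_triple_le[of "grad u x0" "pd (grad u x0) u x0" "hessian u x0 *v grad u x0"] K
        by simp
    qed
    also have "\<dots> \<le> (K + K\<^sup>2 + ?n * K) * l m"
    proof -
      have "K * 1 \<le> K * l m" "K * K * 1 \<le> K * K * l m" using K0 lm by (intro mult_left_mono; simp)+
      then show ?thesis by (simp add: power2_eq_square algebra_simps)
    qed
    finally have "k * norm (jet_velocity (grad u x0)) \<le> k * ((K + K\<^sup>2 + ?n * K) * l m)"
      using k0 by (intro mult_left_mono)
    then have y: "\<bar>y1\<bar> \<le> k * ((K + K\<^sup>2 + ?n * K) * l m)" unfolding y1 using first order_trans by blast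
    have "\<bar>H * y1\<bar> \<le> 1 * \<bar>y1\<bar>" unfolding abs_mult using H by (intro mult_right_mono) auto
    then show ?thesis using y by simp
  qed
  moreover
  have "d2 / l m \<ge> - ((k * ?n\<^sup>2 * K + (k * D + k\<^sup>2) * (2 + K)\<^sup>2) * l m + k * (1 + ?n * K + ?n * R) * (1 + \<beta> / w + A))"
  proof -
    let ?a = "jet_acceleration e" and ?v = "jet_velocity e"
    have hess_e: "hessian u x0 *v e = l m *\<^sub>R e" using eigen[OF m'] e by simp
    have v: "norm ?v \<le> (2 + K) * l m"
    proof -
      have "norm ?v \<le> 1 + K + l m"
        unfolding jet_velocity_def hess_e
        using norm_triple_le[of e "pd e u x0" "l m *\<^sub>R e"] en grad_le[of e] lm by simp
      moreover have "(1 + K) * 1 \<le> (1 + K) * l m" using K0 lm by (intro mult_left_mono) auto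
      ultimately show ?thesis by (simp add: algebra_simps)
    qed
    have ai: "\<bar>a i\<bar> \<le> \<beta> * (K / w) + ?n * l m * K + A * R" if i: "i < CARD('n)" for i
    proof -
      have "a i = - (\<beta> * b i + H * (l i * pd (q i) u x0) + A * x i)" using critical[OF i] by simp
      then have "\<bar>a i\<bar> \<le> \<bar>\<beta> * b i\<bar> + \<bar>H * (l i * pd (q i) u x0)\<bar> + \<bar>A * x i\<bar>" by linarith
      moreover have "\<bar>\<beta> * b i\<bar> \<le> \<beta> * (K / w)" unfolding abs_mult using bx(1)[OF i] nn by (intro mult_mono) auto
      moreover have "\<bar>A * x i\<bar> \<le> A * R" unfolding abs_mult using bx(2)[OF i] nn by (intro mult_mono) auto
      moreover have "\<bar>H * (l i * pd (q i) u x0)\<bar> \<le> 1 * ((?n * l m) * K)"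
        unfolding abs_mult
        using H eigenvalue_abs_bound[OF p i] grad_le[of "q i"] orthonormal_frame_norm(1)[OF frame i] lm
        by (intro mult_mono) auto
      ultimately show ?thesis by simp
    qed
    have acc: "norm ?a \<le> l m * (1 + ?n * (\<beta> * (K / w) + ?n * l m * K + A * R))"
    proof -
      let ?g = "\<chi> i. pd e (pd e (pd (axis i 1) u)) x0"
      have "norm ?g \<le> (\<Sum>i<CARD('n). \<bar>?g \<bullet> q i\<bar>)" by (rule norm_le_frame_sum)
      also have "\<dots> = (\<Sum>i<CARD('n). l m * \<bar>a i\<bar>)"
        unfolding acceleration_component using lm by (intro sum.cong refl) (simp add: a abs_divide)
      also have "\<dots> \<le> (\<Sum>i<CARD('n). l m * (\<beta> * (K / w) + ?n * l m * K + A * R))"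
        using ai lm by (intro sum_mono mult_left_mono) auto
      finally have g: "norm ?g \<le> l m * (?n * (\<beta> * (K / w) + ?n * l m * K + A * R))" by (simp add: mult_ac)
      have "pd e (pd e u) x0 = l m"
        using hessian_frame[OF m', of e] e frame_inner[OF m' m'] by simp
      then have "norm ?a \<le> l m + norm ?g"
        unfolding jet_acceleration_def using norm_triple_le[of "0 :: real^'n" "l m" ?g] lm by simp
      then show ?thesis using g by (simp add: distrib_left)
    qed
    have "k * norm ?a \<le> k * (l m * (1 + ?n * (\<beta> * (K / w) + ?n * l m * K + A * R)))"
      using acc k0 by (rule mult_left_mono)
    moreover have "(k * D + k\<^sup>2) * (norm ?v)\<^sup>2 \<le> (k * D + k\<^sup>2) * ((2 + K) * l m)\<^sup>2"
      using v k0 D0 by (intro mult_left_mono power_mono) auto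
    moreover have "- d2 \<le> k * norm ?a + k * D * (norm ?v)\<^sup>2 + (k * norm ?v)\<^sup>2"
    proof -
      have "(pd ?v f jet_point / f jet_point)\<^sup>2 \<le> (k * norm ?v)\<^sup>2"
        using first[of ?v] by (metis abs_ge_zero power2_abs power_mono)
      then show ?thesis using first[of ?a] second[of ?v] unfolding d2 add_divide_distrib by linarith
    qed
    ultimately have "- d2 \<le> l m * (k * (1 + ?n * (\<beta> * (K / w) + ?n * l m * K + A * R)) + (k * D + k\<^sup>2) * (2 + K)\<^sup>2 * l m)"
      by (simp add: power_mult_distrib power2_eq_square algebra_simps)
    then have "- (d2 / l m) \<le> k * (1 + ?n * (\<beta> * (K / w) + ?n * l m * K + A * R)) + (k * D + k\<^sup>2) * (2 + K)\<^sup>2 * l m"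
      (is "_ \<le> ?X")
    proof -
      assume *: "- d2 \<le> l m * ?X"
      have "(- d2) / l m \<le> ?X" using lm * by (subst pos_divide_le_eq) (simp_all only: mult.commute)
      then show ?thesis by (simp only: minus_divide_left)
    qed
    also have "\<dots> \<le> (k * ?n\<^sup>2 * K + (k * D + k\<^sup>2) * (2 + K)\<^sup>2) * l m + k * (1 + ?n * K + ?n * R) * (1 + \<beta> / w + A)"
    proof -
      have "1 + ?n * K * (\<beta> / w) + ?n * R * A \<le> (1 + ?n * K + ?n * R) * (1 + \<beta> / w + A)"
      proof -
        define s1 s2 t where "s1 = ?n * K" and "s2 = ?n * R" and "t = \<beta> / w"
        have "0 \<le> s1" "0 \<le> s2" "0 \<le> t" using K0 nn by (auto simp: s1_def s2_def t_def)
        then have "0 \<le> s1 + s2 + t + A + s1 * A + s2 * t" using nn by simp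
        moreover have "(1 + s1 + s2) * (1 + t + A)
            = 1 + s1 * t + s2 * A + (s1 + s2 + t + A + s1 * A + s2 * t)" by (simp add: algebra_simps)
        ultimately show ?thesis unfolding s1_def[symmetric] s2_def[symmetric] t_def[symmetric] by linarith
      qed
      from mult_left_mono[OF this k0] show ?thesis by (simp add: power2_eq_square algebra_simps)
    qed
    finally show ?thesis by linarith
  qed
  ultimately show ?thesis by (simp add: algebra_simps)
qed

end

section \<open>Existence of the interior maximum\<close>

lemma quadratic_form_le_top:
  fixes B :: "real^'n^'n"
  assumes "orthonormal_frame q" "\<And>i. i < CARD('n) \<Longrightarrow> B *v q i = l i *\<^sub>R q i"
    "transpose B = B" "\<And>i. i < CARD('n) \<Longrightarrow> l i \<le> \<Lambda>" "norm \<xi> = 1"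
  shows "\<xi> \<bullet> (B *v \<xi>) \<le> \<Lambda>"
proof -
  have "\<xi> \<bullet> (B *v \<xi>) = (\<Sum>i<CARD('n). (\<xi> \<bullet> q i) * ((B *v \<xi>) \<bullet> q i))"
    by (rule orthonormal_frame_parseval[OF assms(1)])
  also have "\<dots> = (\<Sum>i<CARD('n). l i * ((\<xi> \<bullet> q i) * (\<xi> \<bullet> q i)))"
    using assms(2,3) by (intro sum.cong refl) (simp add: matrix_inner_transpose)
  also have "\<dots> \<le> (\<Sum>i<CARD('n). \<Lambda> * ((\<xi> \<bullet> q i) * (\<xi> \<bullet> q i)))"
    using assms(4) by (intro sum_mono mult_right_mono) auto
  also have "\<dots> = \<Lambda> * (\<xi> \<bullet> \<xi>)"
    unfolding orthonormal_frame_parseval[OF assms(1), of \<xi> \<xi>] by (simp add: sum_distrib_left)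
  finally show ?thesis using assms(5) by (simp add: dot_square_norm)
qed

lemma trace_axis: "trace B = (\<Sum>i\<in>UNIV. axis i 1 \<bullet> (B *v axis i 1))" for B :: "real^'n^'n"
  by (simp add: trace_def inner_axis' matrix_vector_mult_basis column_def)

lemma trace_eq_sum_eigvals:
  fixes B :: "real^'n^'n"
  assumes "transpose B = B"
  shows "trace B = (\<Sum>i<CARD('n). eigvals B ! i)"
proof -
  obtain q where q: "orthonormal_frame q" "\<And>i. i < CARD('n) \<Longrightarrow> B *v q i = (eigvals B ! i) *\<^sub>R q i"
    using symmetric_eigenframe(3)[OF assms] by blast
  have "trace B = (\<Sum>k\<in>UNIV. \<Sum>i<CARD('n). (axis k 1 \<bullet> q i) * ((B *v axis k 1) \<bullet> q i))"
    unfolding trace_axis by (intro sum.cong refl orthonormal_frame_parseval[OF q(1)])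
  also have "\<dots> = (\<Sum>k\<in>UNIV. \<Sum>i<CARD('n). eigvals B ! i * (q i $ k * q i $ k))"
    using q(2) by (intro sum.cong refl) (simp add: matrix_inner_transpose assms inner_axis')
  also have "\<dots> = (\<Sum>i<CARD('n). eigvals B ! i * (q i \<bullet> q i))"
    by (subst sum.swap) (simp add: sum_distrib_left inner_vec_def)
  also have "\<dots> = (\<Sum>i<CARD('n). eigvals B ! i)"
    using orthonormal_frame_norm(2)[OF q(1)] by (intro sum.cong) auto
  finally show ?thesis .
qed

lemma continuous_on_quadratic_form:
  fixes u :: "real^'n \<Rightarrow> real"
  assumes "Ck_dir 2 U u"
  shows "continuous_on (U \<times> S) (\<lambda>z. snd z \<bullet> (hessian u (fst z) *v snd z))"
proof -
  have "continuous_on U (\<lambda>x. pd a (pd b u) x)" for a b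
    using assms by (simp add: numeral_2_eq_2)
  then have "continuous_on (U \<times> S) (\<lambda>z. pd a (pd b u) (fst z))" for a b
    by (rule continuous_on_compose2) (auto intro: continuous_intros)
  then show ?thesis
    unfolding inner_vec_def matrix_vector_mult_def hessian_def
    by (simp, intro continuous_intros) auto
qed

text \<open>Where \<open>w\<close> is below some \<open>\<epsilon>\<close> the weighted quantity is smaller than at the given point; the rest of the domain
is compact.\<close>

lemma weighted_hessian_max_attained:
  fixes u :: "real^'n \<Rightarrow> real"
  assumes U: "open U" "bounded U" and u: "Ck_dir 2 U u"
    and w: "continuous_on (closure U) w" "\<And>x. x \<in> frontier U \<Longrightarrow> w x = 0" "\<And>x. x \<in> U \<Longrightarrow> w x > 0"
    and B: "\<And>x \<xi>. x \<in> U \<Longrightarrow> norm \<xi> = 1 \<Longrightarrow> \<bar>\<xi> \<bullet> (hessian u x *v \<xi>)\<bar> \<le> B"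
    and \<rho>: "continuous_on U \<rho>" "\<And>x. x \<in> U \<Longrightarrow> 0 < \<rho> x" "\<And>x. x \<in> U \<Longrightarrow> \<rho> x \<le> Z"
    and \<beta>: "\<beta> > 0" and x1: "x1 \<in> U" "norm \<xi>1 = 1" "\<xi>1 \<bullet> (hessian u x1 *v \<xi>1) > 0"
  shows "\<exists>x0\<in>U. \<exists>\<xi>0. norm \<xi>0 = 1 \<and> (\<forall>x\<in>U. \<forall>\<xi>. norm \<xi> = 1 \<longrightarrow>
     w x powr \<beta> * (\<xi> \<bullet> (hessian u x *v \<xi>)) * \<rho> x \<le> w x0 powr \<beta> * (\<xi>0 \<bullet> (hessian u x0 *v \<xi>0)) * \<rho> x0)"
proof -
  define G where "G z = w (fst z) powr \<beta> * (snd z \<bullet> (hessian u (fst z) *v snd z)) * \<rho> (fst z)" for z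
  define G0 where "G0 = G (x1, \<xi>1)"
  have G0: "G0 > 0" using x1(3) w(3)[OF x1(1)] \<rho>(2)[OF x1(1)] by (auto simp: G0_def G_def intro!: mult_pos_pos)
  have B0: "B \<ge> 0" using B[OF x1(1,2)] by linarith
  have Z0: "Z > 0" using \<rho>(2,3)[OF x1(1)] by linarith
  define C where "C = B * Z + 1"
  have C: "C > 0" using B0 Z0 by (simp add: C_def add_nonneg_pos)
  \<comment> \<open>Chosen so that \<open>\<epsilon> powr \<beta> * C\<close> equals the value at the given point.\<close>
  define \<epsilon> where "\<epsilon> = (G0 / C) powr (1 / \<beta>)"
  have \<epsilon>: "\<epsilon> > 0" "\<epsilon> powr \<beta> = G0 / C" using G0 C \<beta> by (auto simp: \<epsilon>_def powr_powr)
  define X where "X = {x \<in> closure U. \<epsilon> \<le> w x}"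
  have X_sub: "X \<subseteq> U"
  proof
    fix x assume x: "x \<in> X"
    then have "x \<notin> frontier U" using w(2)[of x] \<epsilon>(1) by (auto simp: X_def)
    then show "x \<in> U" using x U(1) by (auto simp: X_def frontier_def interior_open)
  qed
  have small: "G (x, \<xi>) < G0" if "x \<in> U" "norm \<xi> = 1" "x \<notin> X" for x \<xi>
  proof -
    have "w x < \<epsilon>" using that closure_subset by (force simp: X_def)
    then have "w x powr \<beta> < \<epsilon> powr \<beta>" using w(3)[OF that(1)] \<beta> by (intro powr_less_mono2) auto
    then have p: "w x powr \<beta> * C < G0" using \<epsilon>(2) C by (simp add: pos_less_divide_eq)
    have "(\<xi> \<bullet> (hessian u x *v \<xi>)) * \<rho> x \<le> B * Z"
      using B[OF that(1,2)] \<rho>(2,3)[OF that(1)] B0 by (intro mult_mono) auto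
    then have "(\<xi> \<bullet> (hessian u x *v \<xi>)) * \<rho> x \<le> C" by (simp add: C_def)
    then have "w x powr \<beta> * ((\<xi> \<bullet> (hessian u x *v \<xi>)) * \<rho> x) \<le> w x powr \<beta> * C"
      by (intro mult_left_mono) auto
    then show ?thesis using p by (simp add: G_def mult.assoc)
  qed
  have x1X: "x1 \<in> X" using small[OF x1(1,2)] unfolding G0_def by blast
  have "X = closure U \<inter> w -` {\<epsilon>..}" by (auto simp: X_def)
  then have "closed X" using continuous_closed_preimage[OF w(1) closed_closure closed_atLeast] by simp
  moreover have "bounded X" using bounded_closure[OF U(2)] by (rule bounded_subset) (auto simp: X_def)
  ultimately have "compact X" by (simp add: compact_eq_bounded_closed)
  then have "compact (X \<times> sphere (0 :: real^'n) 1)" by (intro compact_Times) auto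
  moreover have "continuous_on (X \<times> sphere (0 :: real^'n) 1) G"
  proof (rule continuous_on_subset)
    have "continuous_on U w" by (rule continuous_on_subset[OF w(1) closure_subset])
    then have "continuous_on (U \<times> sphere (0 :: real^'n) 1) (\<lambda>z. w (fst z))"
      by (rule continuous_on_compose2) (auto intro: continuous_intros)
    moreover have "continuous_on (U \<times> sphere (0 :: real^'n) 1) (\<lambda>z. \<rho> (fst z))"
      using \<rho>(1) by (rule continuous_on_compose2) (auto intro: continuous_intros)
    ultimately show "continuous_on (U \<times> sphere (0 :: real^'n) 1) G"
      unfolding G_def using w(3)
      by (intro continuous_on_mult continuous_on_quadratic_form[OF u] continuous_on_powr continuous_on_const)
        (auto simp: less_imp_neq[symmetric])
  qed (use X_sub in auto)
  moreover have "X \<times> sphere (0 :: real^'n) 1 \<noteq> {}" using x1X x1(2) by auto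
  ultimately obtain z where z: "z \<in> X \<times> sphere 0 1" "\<And>z'. z' \<in> X \<times> sphere 0 1 \<Longrightarrow> G z' \<le> G z"
    using continuous_attains_sup[of "X \<times> sphere (0 :: real^'n) 1" G] by blast
  obtain x0 \<xi>0 where z0: "z = (x0, \<xi>0)" by (metis surj_pair)
  have "G0 \<le> G z" unfolding G0_def using x1X x1(2) by (intro z(2)) auto
  have "G (x, \<xi>) \<le> G z" if "x \<in> U" "norm \<xi> = 1" for x \<xi>
  proof (cases "x \<in> X")
    case True then show ?thesis using that by (intro z(2)) auto
  next
    case False then show ?thesis using small[OF that] \<open>G0 \<le> G z\<close> by linarith
  qed
  then show ?thesis using z(1) X_sub unfolding z0 G_def by (intro bexI[of _ x0] exI[of _ \<xi>0]) auto
qed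

text \<open>This and \<open>bounded_cost\<close> are the coefficients of \<open>l m\<close> and of \<open>1 + \<beta> / w + A\<close> in \<open>right_hand_side_bound\<close>.\<close>

definition linear_cost :: "real \<Rightarrow> real \<Rightarrow> real \<Rightarrow> real \<Rightarrow> real" where
  "linear_cost n K k D = k * (K + K\<^sup>2 + n * K) + k * n\<^sup>2 * K + (k * D + k\<^sup>2) * (2 + K)\<^sup>2"

definition bounded_cost :: "real \<Rightarrow> real \<Rightarrow> real \<Rightarrow> real \<Rightarrow> real" where
  "bounded_cost n K k R = k * (1 + n * K + n * R)"

section \<open>The estimate for bounded data\<close>

locale pogorelov_data =
  fixes U :: "(real^'n) set" and p :: nat and u v :: "real^'n \<Rightarrow> real"
    and f :: "(real^'n) \<times> real \<times> (real^'n) \<Rightarrow> real" and R K F m0 B :: real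
  assumes U: "open U" "bounded U" "\<And>x. x \<in> U \<Longrightarrow> norm x \<le> R" "R \<ge> 0"
    and p: "1 \<le> p" "p < CARD('n)" "CARD('n) \<le> 2 * p"
    and u: "Ck_dir 4 U u" "\<And>x. x \<in> U \<Longrightarrow> p_positive CARD('n) p (\<lambda>i. eigvals (hessian u x) ! i)"
    and v: "Ck_dir 2 U v"
      "\<And>x I. x \<in> U \<Longrightarrow> I \<in> index_sets CARD('n) p \<Longrightarrow> (\<Sum>i\<in>I. eigvals (hessian v x) ! i) \<ge> 0"
    and w: "continuous_on (closure U) (\<lambda>x. v x - u x)" "\<And>x. x \<in> frontier U \<Longrightarrow> v x - u x = 0"
      "\<And>x. x \<in> U \<Longrightarrow> v x - u x > 0" "\<And>x. x \<in> U \<Longrightarrow> v x - u x \<le> K"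
    and B: "\<And>x \<xi>. x \<in> U \<Longrightarrow> norm \<xi> = 1 \<Longrightarrow> \<bar>\<xi> \<bullet> (hessian u x *v \<xi>)\<bar> \<le> B"
    and grads: "\<And>x. x \<in> U \<Longrightarrow> norm (grad u x) + norm (grad v x) \<le> K"
    and f: "Ck_dir 2 (U \<times> UNIV \<times> UNIV) f"
      "\<And>x. x \<in> U \<Longrightarrow> p_sum_prod p (hessian u x) = f (x, u x, grad u x)"
      "\<And>x. x \<in> U \<Longrightarrow> m0 \<le> f (x, u x, grad u x)" "\<And>x. x \<in> U \<Longrightarrow> f (x, u x, grad u x) \<le> F"
      "\<And>x b. x \<in> U \<Longrightarrow> b \<in> Basis \<Longrightarrow> \<bar>pd b f (x, u x, grad u x)\<bar> \<le> F"
      "\<And>x b c. x \<in> U \<Longrightarrow> b \<in> Basis \<Longrightarrow> c \<in> Basis \<Longrightarrow> \<bar>pd c (pd b f) (x, u x, grad u x)\<bar> \<le> F"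
      "F \<ge> 1" "m0 > 0"

locale pogorelov_constants = pogorelov_data U p u v f R K F m0 B
  for U :: "(real^'n) set" and p u v f R K F m0 B +
  fixes D k C1 C2 A \<beta> E c M :: real
  assumes D: "D = DIM((real^'n) \<times> real \<times> (real^'n))" and k: "k = F * D / m0"
    and C1: "C1 = linear_cost CARD('n) K k D" and C2: "C2 = bounded_cost CARD('n) K k R"
    and A: "A = 2 * (C1 + 1) * (1 + 2 ^ card (index_sets CARD('n) p) * F)" and \<beta>: "\<beta> = 9 + 12 * A * R\<^sup>2"
    and E: "E = \<beta> * card (index_sets CARD('n) p) + C2 * (1 + \<beta> + A)
       + 4 * real CARD('n) * card (index_sets CARD('n) p) * (3 * A\<^sup>2 * R\<^sup>2 + 4 * \<beta>\<^sup>2 * K\<^sup>2)"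
    and c: "c = K\<^sup>2 / 2 + 1"
    and M: "M = 1 + 2 * E + (C1 * F + E * F + E) / (1 / (3 * c) / (16 * real CARD('n) ^ 3))"
begin

lemma constants_nonneg:
  assumes "x \<in> U"
  shows "K \<ge> 0" "C1 \<ge> 0" "C2 \<ge> 0" "A \<ge> 0" "\<beta> \<ge> 9"
proof -
  show K0: "K \<ge> 0"
    using grads[OF assms] norm_ge_zero[of "grad u x"] norm_ge_zero[of "grad v x"] by linarith
  have D0: "D \<ge> 0" by (simp add: D)
  have k0: "k \<ge> 0" unfolding k using D0 f(7,8) by simp
  show C1_nonneg: "C1 \<ge> 0" and "C2 \<ge> 0"
    unfolding C1 C2 linear_cost_def bounded_cost_def using k0 K0 D0 U(4) by auto
  show "A \<ge> 0" unfolding A using C1_nonneg f(7) by simp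
  then show "\<beta> \<ge> 9" unfolding \<beta> by simp
qed

text \<open>At the maximum the given unit vector may be exchanged for the top eigenvector; the logarithm of the weighted quantity with
this vector held fixed is the test function.\<close>

lemma estimate_at_maximum:
  assumes \<rho>: "\<And>x. \<rho> x = exp ((- 1 / 3) * ln (c - (grad u x \<bullet> grad u x) / 2) + A * ((x \<bullet> x) / 2))"
    and x0: "x0 \<in> U" "norm \<xi>0 = 1" and pos0: "\<xi>0 \<bullet> (hessian u x0 *v \<xi>0) \<ge> 1"
    and mx: "\<And>x \<xi>. x \<in> U \<Longrightarrow> norm \<xi> = 1 \<Longrightarrow>
     (v x - u x) powr \<beta> * (\<xi> \<bullet> (hessian u x *v \<xi>)) * \<rho> x
       \<le> (v x0 - u x0) powr \<beta> * (\<xi>0 \<bullet> (hessian u x0 *v \<xi>0)) * \<rho> x0"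
  shows "\<xi>0 \<bullet> (hessian u x0 *v \<xi>0) \<le> M * (1 + 1 / (v x0 - u x0))"
proof -
  define m where "m = CARD('n) - 1"
  have m: "CARD('n) = Suc m" by (simp add: m_def)
  define l where "l i = eigvals (hessian u x0) ! i" for i
  have C2u: "Ck_dir 2 U u" using u(1) by (rule Ck_dir_le) simp
  obtain q where q: "orthonormal_frame q" "\<And>i. i < CARD('n) \<Longrightarrow> hessian u x0 *v q i = l i *\<^sub>R q i"
    using symmetric_eigenframe(3)[OF hessian_symmetric[OF U(1) x0(1) C2u]] unfolding l_def by blast
  interpret ef: eigenframe_at U u x0 p q l "dlog_coeff CARD('n) p l" m "q m"
    by unfold_locales (use U x0 u q m in \<open>auto simp: l_def\<close>)
  let ?\<Lambda> = "l m"
  have m': "m < CARD('n)" using m by simp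
  have top: "\<xi>0 \<bullet> (hessian u x0 *v \<xi>0) \<le> ?\<Lambda>"
    by (rule quadratic_form_le_top[OF q hessian_symmetric[OF U(1) x0(1) C2u] _ x0(2)])
      (use ef.l_mono m in auto)
  have \<Lambda>1: "?\<Lambda> \<ge> 1" using top pos0 by linarith
  have ee: "q m \<bullet> (hessian u x0 *v q m) = ?\<Lambda>"
    using q(2)[OF m'] ef.frame_inner[OF m' m'] by simp
  have ne: "norm (q m) = 1" using orthonormal_frame_norm(1)[OF q(1) m'] .
  have w0: "v x0 - u x0 > 0" using w(3) x0 by simp
  note K0 = constants_nonneg(1)[OF x0(1)] and C10 = constants_nonneg(2)[OF x0(1)]
    and C20 = constants_nonneg(3)[OF x0(1)] and A0 = constants_nonneg(4)[OF x0(1)]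
  have \<beta>0: "\<beta> \<ge> 0" using constants_nonneg(5)[OF x0(1)] by simp
  have gradu: "norm (grad u x) \<le> K" if "x \<in> U" for x
    using grads[OF that] norm_ge_zero[of "grad v x"] by linarith
  have cs: "1 \<le> c - (grad u x \<bullet> grad u x) / 2" "c - (grad u x \<bullet> grad u x) / 2 \<le> c" if "x \<in> U" for x
  proof -
    have "(norm (grad u x))\<^sup>2 \<le> K\<^sup>2" using gradu[OF that] by (intro power_mono) auto
    then show "1 \<le> c - (grad u x \<bullet> grad u x) / 2" unfolding c power2_norm_eq_inner by simp
  qed simp
  define H where "H = 1 / (3 * (c - (grad u x0 \<bullet> grad u x0) / 2))"
  have H: "0 \<le> H" "H \<le> 1" "1 / (3 * c) \<le> H" "0 < 1 / (3 * c)"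
  proof -
    define d where "d = c - (grad u x0 \<bullet> grad u x0) / 2"
    have d: "1 \<le> d" "d \<le> c" using cs[OF x0(1)] by (auto simp: d_def)
    show "0 \<le> H" "H \<le> 1" "1 / (3 * c) \<le> H" "0 < 1 / (3 * c)"
      unfolding H_def d_def[symmetric] using d by (auto intro!: divide_left_mono)
  qed
  have wpos: "(v x0 - u x0) powr \<beta> * \<rho> x0 > 0" using w0 by (simp add: \<rho>)
  have mx': "(v x - u x) powr \<beta> * (q m \<bullet> (hessian u x *v q m)) * \<rho> x \<le> (v x0 - u x0) powr \<beta> * ?\<Lambda> * \<rho> x0"
    if "x \<in> U" for x
  proof -
    have "(v x0 - u x0) powr \<beta> * \<rho> x0 * (\<xi>0 \<bullet> (hessian u x0 *v \<xi>0)) \<le> (v x0 - u x0) powr \<beta> * \<rho> x0 * ?\<Lambda>"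
      using top wpos by (intro mult_left_mono) auto
    then show ?thesis using mx[OF that ne] by (simp add: mult_ac)
  qed
  have log: "ef.test_function v \<beta> A c x = ln ((v x - u x) powr \<beta> * (q m \<bullet> (hessian u x *v q m)) * \<rho> x)"
    if "x \<in> U" "q m \<bullet> (hessian u x *v q m) > 0" for x
    using that w(3)[OF that(1)] unfolding ef.test_function_def \<rho>
    by (simp add: ln_mult ln_powr)
  \<comment> \<open>Near \<open>x0\<close> only, where the second derivative along \<open>q m\<close> is still positive.\<close>
  have near: "\<forall>\<^sub>F x in nhds x0. ef.test_function v \<beta> A c x \<le> ef.test_function v \<beta> A c x0"
  proof -
    define h where "h x = q m \<bullet> (hessian u x *v q m)" for x
    have "continuous_on U (\<lambda>x. (x, q m))" by (intro continuous_intros)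
    from continuous_on_compose2[OF continuous_on_quadratic_form[OF C2u, of UNIV] this]
    have "continuous_on U h" unfolding h_def by auto
    then have "isCont h x0" using U(1) x0(1) continuous_on_eq_continuous_at by blast
    then have lim: "(h \<longlongrightarrow> h x0) (nhds x0)" unfolding isCont_def tendsto_at_iff_tendsto_nhds .
    have "0 < h x0" using \<Lambda>1 ee by (simp add: h_def)
    from order_tendstoD(1)[OF lim this] have "\<forall>\<^sub>F x in nhds x0. 0 < q m \<bullet> (hessian u x *v q m)" unfolding h_def .
    moreover have "\<forall>\<^sub>F x in nhds x0. x \<in> U" using U(1) x0(1) by (rule eventually_nhds_in_open)
    ultimately show ?thesis
    proof eventually_elim
      case (elim x)
      have "0 < (v x - u x) powr \<beta> * (q m \<bullet> (hessian u x *v q m)) * \<rho> x"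
        using elim w(3)[OF elim(2)] by (simp add: \<rho>)
      then show ?case
        unfolding log[OF elim(2,1)] using mx'[OF elim(2)] log[OF x0(1)] \<Lambda>1
        unfolding ee by (simp add: ln_mono)
    qed
  qed
  define y1 where "y1 = pd (ef.jet_velocity (grad u x0)) f ef.jet_point / f ef.jet_point"
  define d2 where "d2 = (pd (ef.jet_acceleration (q m)) f ef.jet_point
        + (\<Sum>b\<in>Basis. (ef.jet_velocity (q m) \<bullet> b) * pd (ef.jet_velocity (q m)) (pd b f) ef.jet_point)) / f ef.jet_point
     - (pd (ef.jet_velocity (q m)) f ef.jet_point / f ef.jet_point)\<^sup>2"
  have fz: "f ef.jet_point \<ge> m0" "f ef.jet_point > 0"
    using f(3)[OF x0(1)] f(8) by (auto simp: ef.jet_point_def)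
  note jet = ef.jet2_right_hand_side[OF f(1,2) fz(2)]
  define a where "a i = pd (q m) (pd (q m) (pd (q i) u)) x0 / l m" for i
  define b where "b i = (pd (q i) v x0 - pd (q i) u x0) / (v x0 - u x0)" for i
  have cs0: "c - (grad u x0 \<bullet> grad u x0) / 2 > 0" using cs(1)[OF x0(1)] by linarith
  have lm: "l m > 0" using \<Lambda>1 by linarith
  have critical: "\<beta> * b i + a i + H * (l i * pd (q i) u x0) + A * (x0 \<bullet> q i) = 0" if "i < CARD('n)" for i
  proof -
    have "\<forall>\<^sub>F t in nhds 0. ef.test_function v \<beta> A c (x0 + t *\<^sub>R q i)
        \<le> ef.test_function v \<beta> A c (x0 + 0 *\<^sub>R q i)"
      using eventually_line[OF near, of "q i"] by simp
    from jet2_local_max(1)[OF ef.jet2_test_function[OF v(1) w0 lm cs0 H_def that] this]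
    show ?thesis unfolding a_def b_def .
  qed
  have bb: "\<bar>b i\<bar> \<le> K / (v x0 - u x0)" if i: "i < CARD('n)" for i
  proof -
    have dv: "v differentiable (at x0)" using Ck_dir_differentiable[OF v(1) _ x0(1)] by simp
    have "\<bar>grad v x0 \<bullet> q i - grad u x0 \<bullet> q i\<bar> \<le> norm (grad v x0) + norm (grad u x0)"
      using Cauchy_Schwarz_ineq2[of "grad v x0" "q i"] Cauchy_Schwarz_ineq2[of "grad u x0" "q i"]
        orthonormal_frame_norm(1)[OF q(1) i] by simp
    then have "\<bar>pd (q i) v x0 - pd (q i) u x0\<bar> \<le> K"
      unfolding partial_deriv_grad[OF dv] partial_deriv_grad[OF ef.differentiable_u(1)]
      using grads[OF x0(1)] by linarith
    then show ?thesis using w0 by (simp add: b_def abs_divide divide_right_mono)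
  qed
  have xx: "\<bar>x0 \<bullet> q i\<bar> \<le> R" if i: "i < CARD('n)" for i
    using Cauchy_Schwarz_ineq2[of x0 "q i"] orthonormal_frame_norm(1)[OF q(1) i] U(3)[OF x0(1)] by simp
  have a_eq: "a i = pd (q m) (pd (q m) (pd (q i) u)) x0 / l m"
    if "i < CARD('n)" for i by (rule a_def)
  have fd1: "\<bar>pd b f ef.jet_point\<bar> \<le> F" if "b \<in> Basis" for b
    using f(5)[OF x0(1) that] unfolding ef.jet_point_def .
  have fd2: "\<bar>pd c (pd b f) ef.jet_point\<bar> \<le> F" if "b \<in> Basis" "c \<in> Basis" for b c
    using f(6)[OF x0(1) that] unfolding ef.jet_point_def .
  have P: "d2 / l m + H * y1 \<ge> - (C1 * l m + C2 * (1 + \<beta> / (v x0 - u x0) + A))"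
    unfolding C1 C2 linear_cost_def bounded_cost_def
    by (rule ef.right_hand_side_bound[OF p(1) less_imp_le[OF p(2)] \<Lambda>1 f(1) fz(1) f(8) fd1 fd2 gradu[OF x0(1)]
        D k H(1,2) \<beta>0 w0 A0 U(4) a_eq critical bb xx d2_def y1_def])
  have prodF: "(\<Prod>I\<in>index_sets CARD('n) p. sum l I) \<le> F"
    using f(2,4)[OF x0(1)] unfolding p_sum_prod_def l_def by simp
  have main: "- (\<beta> * card (index_sets CARD('n) p) / (v x0 - u x0)) + (d2 / l m + H * y1)
       + (\<Sum>i<m. 2 * l m * ((dlog_coeff CARD('n) p l i - dlog_coeff CARD('n) p l m) / (l m - l i)) * (a i)\<^sup>2)
       + (\<Sum>i<CARD('n). dlog_coeff CARD('n) p l i * (H * (l i)\<^sup>2 + 3 * (H * (l i * pd (q i) u x0))\<^sup>2 + A - (a i)\<^sup>2 - \<beta> * (b i)\<^sup>2)) \<le> 0"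
    using ef.maximum_principle[OF v(1) v(2)[OF x0(1)] w0 lm \<beta>0 cs0 H_def near
        jet[of "q m", folded d2_def] jet[of "grad u x0", folded y1_def] a_def b_def] by linarith
  interpret ci: critical_inequality "CARD('n)" p m l "dlog_coeff CARD('n) p l" a b
      "\<lambda>i. pd (q i) u x0" "\<lambda>i. x0 \<bullet> q i" ?\<Lambda> "v x0 - u x0" "d2 / l m + H * y1" F R K H "1 / (3 * c)" C1 C2 A \<beta> E
    by (rule critical_inequality.intro[OF m p ef.l_positive ef.l_mono refl refl \<Lambda>1 prodF f(7) w0 xx bb
          C10 C20 U(4) K0 H(3,4) A \<beta> critical P main E])
  have "l m \<le> M * (1 + 1 / (v x0 - u x0))"
    using ci.top_eigenvalue_bound unfolding M .
  then show ?thesis using top by linarith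
qed

text \<open>The weighted quantity is controlled at its maximum, and the factor \<open>\<rho>\<close> lies between positive constants.\<close>

lemma hessian_estimate:
  assumes x: "x \<in> U" "norm \<xi> = 1"
  shows "(v x - u x) powr \<beta> * (\<xi> \<bullet> (hessian u x *v \<xi>))
     \<le> M * (K powr \<beta> + K powr (\<beta> - 1)) * exp (A * R\<^sup>2 / 2 + ln c / 3)"
proof -
  note K0 = constants_nonneg(1)[OF x(1)] and C10 = constants_nonneg(2)[OF x(1)]
    and C20 = constants_nonneg(3)[OF x(1)] and A0 = constants_nonneg(4)[OF x(1)]
    and \<beta>9 = constants_nonneg(5)[OF x(1)]
  have c0: "c \<ge> 1" by (simp add: c)
  have E0: "E \<ge> 0" unfolding E using \<beta>9 C20 A0 by simp
  have M1: "M \<ge> 1" unfolding M using E0 C10 f(7) c0 by simp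
  define \<rho> where "\<rho> x = exp ((- 1 / 3) * ln (c - (grad u x \<bullet> grad u x) / 2) + A * ((x \<bullet> x) / 2))" for x
  have cs: "1 \<le> c - (grad u x \<bullet> grad u x) / 2" "c - (grad u x \<bullet> grad u x) / 2 \<le> c" if "x \<in> U" for x
  proof -
    have "norm (grad u x) \<le> K" using grads[OF that] norm_ge_zero[of "grad v x"] by linarith
    then have "(norm (grad u x))\<^sup>2 \<le> K\<^sup>2" by (intro power_mono) auto
    then show "1 \<le> c - (grad u x \<bullet> grad u x) / 2" unfolding c power2_norm_eq_inner by simp
  qed simp
  have \<rho>_upper: "\<rho> x \<le> exp (A * R\<^sup>2 / 2)" if "x \<in> U" for x
  proof -
    have "(norm x)\<^sup>2 \<le> R\<^sup>2" using U(3)[OF that] by (intro power_mono) auto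
    then have "A * ((x \<bullet> x) / 2) \<le> A * (R\<^sup>2 / 2)"
      unfolding power2_norm_eq_inner using A0 by (intro mult_left_mono) auto
    moreover have "0 \<le> ln (c - (grad u x \<bullet> grad u x) / 2)" using cs[OF that] by simp
    ultimately show ?thesis by (simp add: \<rho>_def)
  qed
  have \<rho>_lower: "exp (- (ln c / 3)) \<le> \<rho> x" if "x \<in> U" for x
  proof -
    have "ln (c - (grad u x \<bullet> grad u x) / 2) \<le> ln c" using cs[OF that] by (intro ln_mono) auto
    moreover have "0 \<le> A * ((x \<bullet> x) / 2)" using A0 by simp
    ultimately show ?thesis by (simp add: \<rho>_def)
  qed
  define T where "T = M * (K powr \<beta> + K powr (\<beta> - 1))"
  have T0: "T \<ge> 0" using M1 by (simp add: T_def)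
  show ?thesis
  proof (cases "\<xi> \<bullet> (hessian u x *v \<xi>) > 0")
    case False
    then have "(v x - u x) powr \<beta> * (\<xi> \<bullet> (hessian u x *v \<xi>)) \<le> 0" by (intro mult_nonneg_nonpos) auto
    also have "0 \<le> T * exp (A * R\<^sup>2 / 2 + ln c / 3)" using T0 by simp
    finally show ?thesis unfolding T_def .
  next
    case True
    have C2u: "Ck_dir 2 U u" using u(1) by (rule Ck_dir_le) simp
    have \<rho>_cont: "continuous_on U \<rho>"
    proof -
      have pc: "Ck_dir 1 U (pd a u)" for a using Ck_dir_partial[OF C2u, of a] by simp
      have g: "continuous_on U (\<lambda>x. grad u x)"
        unfolding grad_def by (intro continuous_on_vec_lambda) (rule Ck_dir_continuous[OF pc])
      have ne: "\<forall>x\<in>U. c - (grad u x \<bullet> grad u x) / 2 \<noteq> 0" using cs(1) by force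
      show ?thesis unfolding \<rho>_def
        by (intro continuous_on_exp continuous_on_add continuous_on_mult continuous_on_const
            continuous_on_ln continuous_on_diff continuous_on_divide continuous_on_inner g continuous_on_id)
          (use ne in auto)
    qed
    have "\<exists>x0\<in>U. \<exists>\<xi>0. norm \<xi>0 = 1 \<and> (\<forall>x\<in>U. \<forall>\<xi>. norm \<xi> = 1 \<longrightarrow>
     (v x - u x) powr \<beta> * (\<xi> \<bullet> (hessian u x *v \<xi>)) * \<rho> x
       \<le> (v x0 - u x0) powr \<beta> * (\<xi>0 \<bullet> (hessian u x0 *v \<xi>0)) * \<rho> x0)"
    proof (rule weighted_hessian_max_attained[where w = "\<lambda>x. v x - u x" and Z = "exp (A * R\<^sup>2 / 2)"])
      show "0 < \<rho> y" for y by (simp add: \<rho>_def)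
    qed (fact U(1) U(2) C2u w(1) w(2) w(3) B \<rho>_cont \<rho>_upper less_le_trans[OF _ \<beta>9, of 0, simplified] x True)+
    then obtain x0 \<xi>0 where x0: "x0 \<in> U" "norm \<xi>0 = 1" and mx: "\<And>x \<xi>. x \<in> U \<Longrightarrow> norm \<xi> = 1 \<Longrightarrow>
     (v x - u x) powr \<beta> * (\<xi> \<bullet> (hessian u x *v \<xi>)) * \<rho> x
       \<le> (v x0 - u x0) powr \<beta> * (\<xi>0 \<bullet> (hessian u x0 *v \<xi>0)) * \<rho> x0"
      by blast
    let ?w = "v x0 - u x0" and ?h = "\<xi>0 \<bullet> (hessian u x0 *v \<xi>0)"
    have w0: "?w > 0" "?w \<le> K" using w(3,4)[OF x0(1)] by auto
    have pow: "?w powr \<beta> \<le> K powr \<beta>" "?w powr (\<beta> - 1) \<le> K powr (\<beta> - 1)"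
      using w0 \<beta>9 by (auto intro!: powr_mono2)
    have "?w powr \<beta> * ?h \<le> T"
    proof (cases "?h \<ge> 1")
      case True
      have "?h \<le> M * (1 + 1 / ?w)"
        by (rule estimate_at_maximum[OF \<rho>_def x0 True mx])
      then have "?w powr \<beta> * ?h \<le> ?w powr \<beta> * (M * (1 + 1 / ?w))" by (intro mult_left_mono) auto
      also have "\<dots> = M * (?w powr \<beta> + ?w powr (\<beta> - 1))"
        using w0 by (simp add: powr_diff field_simps)
      also have "\<dots> \<le> T" unfolding T_def using pow M1 by (intro mult_left_mono add_mono) auto
      finally show ?thesis .
    next
      case False
      then have "?w powr \<beta> * ?h \<le> ?w powr \<beta> * 1" by (intro mult_left_mono) auto
      also have "\<dots> \<le> 1 * (K powr \<beta> + K powr (\<beta> - 1))" using pow by (simp add: add_increasing2)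
      also have "\<dots> \<le> T" unfolding T_def using M1 by (intro mult_right_mono) auto
      finally show ?thesis .
    qed
    then have "?w powr \<beta> * ?h * \<rho> x0 \<le> T * exp (A * R\<^sup>2 / 2)"
      using \<rho>_upper[OF x0(1)] T0 by (intro mult_mono) (auto simp: \<rho>_def)
    with mx[OF x] have 1: "(v x - u x) powr \<beta> * (\<xi> \<bullet> (hessian u x *v \<xi>)) * \<rho> x \<le> T * exp (A * R\<^sup>2 / 2)"
      by linarith
    have "(v x - u x) powr \<beta> * (\<xi> \<bullet> (hessian u x *v \<xi>)) * exp (- (ln c / 3))
        \<le> (v x - u x) powr \<beta> * (\<xi> \<bullet> (hessian u x *v \<xi>)) * \<rho> x"
      using \<rho>_lower[OF x(1)] True by (intro mult_left_mono) auto
    with 1 have "(v x - u x) powr \<beta> * (\<xi> \<bullet> (hessian u x *v \<xi>)) * exp (- (ln c / 3)) \<le> T * exp (A * R\<^sup>2 / 2)"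
      by linarith
    then have "(v x - u x) powr \<beta> * (\<xi> \<bullet> (hessian u x *v \<xi>)) * exp (- (ln c / 3)) * exp (ln c / 3)
       \<le> T * exp (A * R\<^sup>2 / 2) * exp (ln c / 3)" by (intro mult_right_mono) auto
    then show ?thesis
      by (simp add: T_def mult.assoc exp_add[symmetric])
  qed
qed

end

section \<open>The Dirichlet problem\<close>

lemma finite_dirs_le: "finite (dirs_le k :: 'a::euclidean_space list set)"
  unfolding dirs_le_def by (rule finite_lists_length_le[OF finite_Basis])

text \<open>Makes the suprema in \<open>Ck_norm\<close> genuine bounds.\<close>

lemma Ck_closure_derivative_bdd:
  assumes "Ck_closure k U g" "compact C" "C \<subseteq> closure U" "S \<subseteq> C" "S \<subseteq> U" "es \<in> dirs_le k"
  shows "bdd_above ((\<lambda>x. \<bar>iter_partial es g x\<bar>) ` S)"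
proof -
  obtain h where h: "continuous_on (closure U) h" "\<And>x. x \<in> U \<Longrightarrow> h x = iter_partial es g x"
    using assms(1,6) unfolding Ck_closure_def by blast
  have "continuous_on C (\<lambda>x. \<bar>h x\<bar>)"
    using continuous_on_subset[OF h(1) assms(3)] by (intro continuous_intros)
  then have "compact ((\<lambda>x. \<bar>h x\<bar>) ` C)" using assms(2) by (rule compact_continuous_image)
  then have "bdd_above ((\<lambda>x. \<bar>h x\<bar>) ` C)" by (simp add: bounded_imp_bdd_above compact_imp_bounded)
  then have "bdd_above ((\<lambda>x. \<bar>h x\<bar>) ` S)" by (rule bdd_above_mono) (use assms(4) in auto)
  moreover have "(\<lambda>x. \<bar>h x\<bar>) ` S = (\<lambda>x. \<bar>iter_partial es g x\<bar>) ` S"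
    using h(2) assms(5) by (intro image_cong) auto
  ultimately show ?thesis by simp
qed

lemma Ck_norm_sum_bound:
  fixes g :: "'a::euclidean_space \<Rightarrow> real"
  assumes "\<And>es. es \<in> dirs_le k \<Longrightarrow> bdd_above ((\<lambda>x. \<bar>iter_partial es g x\<bar>) ` S)" "x \<in> S" "T \<subseteq> dirs_le k"
  shows "(\<Sum>es\<in>T. \<bar>iter_partial es g x\<bar>) \<le> Ck_norm k S g"
proof -
  have "(\<Sum>es\<in>T. \<bar>iter_partial es g x\<bar>) \<le> (\<Sum>es\<in>dirs_le k. \<bar>iter_partial es g x\<bar>)"
    using assms(3) finite_dirs_le by (intro sum_mono2) auto
  also have "\<dots> \<le> (\<Sum>es\<in>dirs_le k. SUP x\<in>S. \<bar>iter_partial es g x\<bar>)"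
    using assms(1) by (intro sum_mono cSUP_upper[OF assms(2)]) auto
  finally show ?thesis unfolding Ck_norm_def .
qed

lemma Ck_norm_derivative_bound:
  fixes g :: "'a::euclidean_space \<Rightarrow> real"
  assumes "\<And>es. es \<in> dirs_le k \<Longrightarrow> bdd_above ((\<lambda>x. \<bar>iter_partial es g x\<bar>) ` S)" "x \<in> S" "es \<in> dirs_le k"
  shows "\<bar>iter_partial es g x\<bar> \<le> Ck_norm k S g"
  using Ck_norm_sum_bound[of k g S x "{es}"] assms by simp

lemma norm_grad_le_Ck_norm:
  fixes g :: "real^'n \<Rightarrow> real"
  assumes bdd: "\<And>es. es \<in> dirs_le 1 \<Longrightarrow> bdd_above ((\<lambda>x. \<bar>iter_partial es g x\<bar>) ` S)" and x: "x \<in> S"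
    and d: "g differentiable (at x)"
  shows "norm (grad g x) \<le> Ck_norm 1 S g"
proof -
  have "norm (grad g x) \<le> (\<Sum>b\<in>Basis. \<bar>grad g x \<bullet> b\<bar>)" by (rule norm_le_l1)
  also have "\<dots> = (\<Sum>b\<in>Basis. \<bar>iter_partial [b] g x\<bar>)"
    by (simp add: partial_deriv_grad[OF d] iter_partial_def)
  also have "\<dots> = (\<Sum>es\<in>(\<lambda>b. [b]) ` Basis. \<bar>iter_partial es g x\<bar>)"
    by (subst sum.reindex) (auto simp: inj_on_def)
  also have "\<dots> \<le> Ck_norm 1 S g" by (rule Ck_norm_sum_bound[OF bdd x]) (auto simp: dirs_le_def)
  finally show ?thesis .
qed

text \<open>Difference quotients of \<open>g\<close> along a line obey the same bound.\<close>

lemma lipschitz_derivative_bound: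
  fixes g :: "'a::euclidean_space \<Rightarrow> real"
  assumes "open U" "x \<in> U" "L-lipschitz_on U g" "g differentiable (at x)"
  shows "\<bar>pd y g x\<bar> \<le> L * norm y"
proof -
  have "((\<lambda>t. g (x + t *\<^sub>R y)) has_real_derivative pd y g x) (at 0)"
    using partial_deriv_line[of g x 0 y] assms(4) by simp
  then have "((\<lambda>h. (g (x + h *\<^sub>R y) - g x) / h) \<longlongrightarrow> pd y g x) (at 0)"
    by (simp add: DERIV_def)
  then have lim: "((\<lambda>h. \<bar>(g (x + h *\<^sub>R y) - g x) / h\<bar>) \<longlongrightarrow> \<bar>pd y g x\<bar>) (at 0)"
    by (rule tendsto_rabs)
  have "\<forall>\<^sub>F h in nhds 0. x + h *\<^sub>R y \<in> U" by (rule eventually_line_in_open[OF assms(1,2)])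
  then have "\<forall>\<^sub>F h in at 0. x + h *\<^sub>R y \<in> U \<and> h \<noteq> 0"
    by (auto simp: eventually_at_filter elim: eventually_mono)
  then have "\<forall>\<^sub>F h in at 0. \<bar>(g (x + h *\<^sub>R y) - g x) / h\<bar> \<le> L * norm y"
  proof eventually_elim
    case (elim h)
    have "\<bar>g (x + h *\<^sub>R y) - g x\<bar> \<le> L * (\<bar>h\<bar> * norm y)"
      using lipschitz_onD[OF assms(3), of "x + h *\<^sub>R y" x] elim assms(2) by (simp add: dist_norm)
    then show ?case using elim by (simp add: abs_divide pos_divide_le_eq mult_ac)
  qed
  then show ?thesis by (rule tendsto_upperbound[OF lim]) simp
qed

lemma C11_hessian_bounded:
  fixes u :: "real^'n \<Rightarrow> real"
  assumes "open U" "C11_closure U u" "Ck_dir 2 U u"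
  shows "\<exists>B. \<forall>x\<in>U. \<forall>\<xi>. norm \<xi> = 1 \<longrightarrow> \<bar>\<xi> \<bullet> (hessian u x *v \<xi>)\<bar> \<le> B"
proof -
  have "\<forall>j::'n. \<exists>L. L-lipschitz_on U (pd (axis j 1) u)"
    using assms(2) unfolding C11_closure_def by (simp add: axis_in_Basis_iff)
  then obtain L where L: "\<And>j::'n. (L j)-lipschitz_on U (pd (axis j 1) u)"
    unfolding choice_iff by blast
  have "\<bar>\<xi> \<bullet> (hessian u x *v \<xi>)\<bar> \<le> (\<Sum>i\<in>(UNIV::'n set). \<Sum>j\<in>UNIV. L j)" if x: "x \<in> U" and \<xi>: "norm \<xi> = 1" for x \<xi>
  proof -
    have "\<bar>\<xi> \<bullet> (hessian u x *v \<xi>)\<bar> = \<bar>\<Sum>i\<in>UNIV. \<Sum>j\<in>UNIV. \<xi> $ i * (hessian u x $ i $ j * \<xi> $ j)\<bar>"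
      by (simp add: inner_vec_def matrix_vector_mult_def sum_distrib_left)
    also have "\<dots> \<le> (\<Sum>i\<in>UNIV. \<bar>\<Sum>j\<in>UNIV. \<xi> $ i * (hessian u x $ i $ j * \<xi> $ j)\<bar>)" by (rule sum_abs)
    also have "\<dots> \<le> (\<Sum>i\<in>UNIV. \<Sum>j\<in>UNIV. \<bar>\<xi> $ i * (hessian u x $ i $ j * \<xi> $ j)\<bar>)" by (intro sum_mono sum_abs)
    also have "\<dots> \<le> (\<Sum>i\<in>(UNIV::'n set). \<Sum>j\<in>UNIV. L j)"
    proof (intro sum_mono)
      fix i j :: 'n
      have "\<bar>hessian u x $ i $ j\<bar> \<le> L j"
      proof -
        have "pd (axis j 1) u differentiable (at x)"
          using assms(3) x by (simp add: numeral_2_eq_2)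
        from lipschitz_derivative_bound[OF assms(1) x L this, of "axis i 1"]
        show ?thesis by (simp add: hessian_def)
      qed
      moreover have "\<bar>\<xi> $ i\<bar> \<le> 1" "\<bar>\<xi> $ j\<bar> \<le> 1" using component_le_norm_cart[of \<xi>] \<xi> by metis+
      ultimately have "\<bar>\<xi> $ i\<bar> * (\<bar>hessian u x $ i $ j\<bar> * \<bar>\<xi> $ j\<bar>) \<le> 1 * (L j * 1)"
        by (intro mult_mono) auto
      then show "\<bar>\<xi> $ i * (hessian u x $ i $ j * \<xi> $ j)\<bar> \<le> L j" by (simp add: abs_mult)
    qed
    finally show ?thesis .
  qed
  then show ?thesis by blast
qed

lemma p_psh_product_positive:
  fixes u :: "real^'n \<Rightarrow> real"
  assumes "p_psh_on p U u" "x \<in> U" "p_sum_prod p (hessian u x) > 0"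
  shows "p_positive CARD('n) p (\<lambda>i. eigvals (hessian u x) ! i)"
  unfolding p_positive_def
proof
  fix I assume I: "I \<in> index_sets CARD('n) p"
  have "(\<Sum>i\<in>I. eigvals (hessian u x) ! i) \<noteq> 0"
    using assms(3) I unfolding p_sum_prod_def by (metis finite_index_sets less_irrefl prod_zero)
  moreover have "(\<Sum>i\<in>I. eigvals (hessian u x) ! i) \<ge> 0"
    using assms(1,2) I unfolding p_psh_on_def by blast
  ultimately show "0 < (\<Sum>i\<in>I. eigvals (hessian u x) ! i)" by simp
qed

text \<open>For \<open>p = n\<close> there is only one index set.\<close>

lemma laplacian_eq_full_sum:
  fixes u :: "real^'n \<Rightarrow> real"
  assumes "open U" "x \<in> U" "Ck_dir 2 U u"
  shows "laplacian u x = p_sum_prod CARD('n) (hessian u x)"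
proof -
  have "index_sets CARD('n) CARD('n) = {{..<CARD('n)}}"
    unfolding index_sets_def using card_subset_eq[of "{..<CARD('n)}"] by auto
  then show ?thesis
    unfolding p_sum_prod_def laplacian_def trace_eq_sum_eigvals[OF hessian_symmetric[OF assms]] by simp
qed

locale dirichlet_solution =
  fixes U :: "(real^'n) set" and p :: nat and u v :: "real^'n \<Rightarrow> real"
    and f :: "(real^'n) \<times> real \<times> (real^'n) \<Rightarrow> real" and Ku Kv m0 Kf :: real
  assumes U: "open U" "bounded U" "U \<noteq> {}"
    and v: "Ck_closure 2 U v" "p_psh_on p U v"
    and f: "Ck_closure 2 (U \<times> UNIV \<times> UNIV) f" "\<And>x z q. x \<in> closure U \<Longrightarrow> f (x, z, q) > 0"
    and u: "Ck_on 4 U u" "C11_closure U u" "p_psh_on p U u"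
    and eq: "\<And>x. x \<in> U \<Longrightarrow> p_sum_prod p (hessian u x) = f (x, u x, grad u x)"
    and bd: "\<And>x. x \<in> frontier U \<Longrightarrow> u x = v x" and lt: "\<And>x. x \<in> U \<Longrightarrow> u x < v x"
    and norms: "Ck_norm 1 U u \<le> Ku" "Ck_norm 1 U v \<le> Kv"
      "m0 \<le> (INF y\<in>jet_range (closure U) (Ck_norm 1 U u). f y)"
      "Ck_norm 2 (jet_range U (Ck_norm 1 U u)) f \<le> Kf"
begin

lemma u_smooth: "Ck_dir 4 U u" "Ck_dir 2 U u"
  using Ck_on_imp_Ck_dir[OF U(1) u(1)] by (auto intro: Ck_dir_le)

lemma v_smooth: "Ck_dir 2 U v"
  using Ck_on_imp_Ck_dir[OF U(1)] v(2) unfolding p_psh_on_def by blast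

lemma f_smooth: "Ck_dir 2 (U \<times> UNIV \<times> UNIV) f"
  using f(1) unfolding Ck_closure_def
  by (intro Ck_on_imp_Ck_dir open_Times U open_UNIV) blast

lemma C1_bdd:
  assumes "Ck_closure 1 U g" "es \<in> dirs_le 1"
  shows "bdd_above ((\<lambda>x. \<bar>iter_partial es g x\<bar>) ` U)"
proof (rule Ck_closure_derivative_bdd[OF assms(1) _ order_refl closure_subset order_refl assms(2)])
  show "compact (closure U)" using U(2) by simp
qed

lemma Ck_closure_1: "Ck_closure 1 U u" "Ck_closure 1 U v"
proof -
  show "Ck_closure 1 U u" using u(2) unfolding C11_closure_def by blast
  have "es \<in> dirs_le 2" if "es \<in> dirs_le 1" for es :: "(real^'n) list" using that by (auto simp: dirs_le_def)
  then show "Ck_closure 1 U v" using v(1) unfolding Ck_closure_def Ck_on_def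
    by (auto simp: less_Suc_eq_le) 
qed

lemma value_gradient_bounds:
  assumes "x \<in> U"
  shows "\<bar>u x\<bar> \<le> Ck_norm 1 U u" "\<bar>v x\<bar> \<le> Ck_norm 1 U v"
    "norm (grad u x) \<le> Ck_norm 1 U u" "norm (grad v x) \<le> Ck_norm 1 U v"
proof -
  have e: "[] \<in> dirs_le 1" by (simp add: dirs_le_def)
  show "\<bar>u x\<bar> \<le> Ck_norm 1 U u"
    using Ck_norm_derivative_bound[OF C1_bdd[OF Ck_closure_1(1)] assms e] by (simp add: iter_partial_def)
  show "\<bar>v x\<bar> \<le> Ck_norm 1 U v"
    using Ck_norm_derivative_bound[OF C1_bdd[OF Ck_closure_1(2)] assms e] by (simp add: iter_partial_def)
  show "norm (grad u x) \<le> Ck_norm 1 U u"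
    by (rule norm_grad_le_Ck_norm[OF C1_bdd[OF Ck_closure_1(1)] assms Ck_dir_differentiable[OF u_smooth(2) _ assms]]) auto
  show "norm (grad v x) \<le> Ck_norm 1 U v"
    by (rule norm_grad_le_Ck_norm[OF C1_bdd[OF Ck_closure_1(2)] assms Ck_dir_differentiable[OF v_smooth _ assms]]) auto
qed

lemma jet_in_range: "x \<in> U \<Longrightarrow> (x, u x, grad u x) \<in> jet_range U (Ck_norm 1 U u)"
  using value_gradient_bounds[of x] by (auto simp: jet_range_def)

lemma f_lower: "x \<in> U \<Longrightarrow> m0 \<le> f (x, u x, grad u x)"
proof -
  assume x: "x \<in> U"
  have mem: "(x, u x, grad u x) \<in> jet_range (closure U) (Ck_norm 1 U u)"
    using jet_in_range[OF x] closure_subset by (auto simp: jet_range_def)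
  have bdd: "bdd_below (f ` jet_range (closure U) (Ck_norm 1 U u))"
    using f(2) by (intro bdd_belowI2[of _ 0]) (auto simp: jet_range_def intro: less_imp_le)
  show ?thesis by (rule order_trans[OF norms(3) cINF_lower[OF bdd mem]])
qed

lemma f_derivative_bound:
  assumes "x \<in> U" "es \<in> dirs_le 2"
  shows "\<bar>iter_partial es f (x, u x, grad u x)\<bar> \<le> Kf"
proof -
  let ?M = "Ck_norm 1 U u"
  let ?C = "closure U \<times> {-?M..?M} \<times> cball (0 :: real^'n) ?M"
  have "bdd_above ((\<lambda>y. \<bar>iter_partial es f y\<bar>) ` jet_range U ?M)" if "es \<in> dirs_le 2" for es
  proof (rule Ck_closure_derivative_bdd[OF f(1) _ _ _ _ that])
    show "compact ?C" using U(2) by (intro compact_Times) auto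
    show "?C \<subseteq> closure (U \<times> UNIV \<times> UNIV)" by (auto simp: closure_Times)
    show "jet_range U ?M \<subseteq> ?C" unfolding jet_range_def using closure_subset by (intro Sigma_mono) auto
    show "jet_range U ?M \<subseteq> U \<times> UNIV \<times> UNIV" by (auto simp: jet_range_def)
  qed
  from Ck_norm_derivative_bound[OF this jet_in_range[OF assms(1)] assms(2)] norms(4)
  show ?thesis by linarith
qed

lemma f_bounds:
  assumes "x \<in> U"
  shows "\<bar>f (x, u x, grad u x)\<bar> \<le> Kf"
    "b \<in> Basis \<Longrightarrow> \<bar>pd b f (x, u x, grad u x)\<bar> \<le> Kf"
    "b \<in> Basis \<Longrightarrow> b' \<in> Basis \<Longrightarrow> \<bar>pd b' (pd b f) (x, u x, grad u x)\<bar> \<le> Kf"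
  using f_derivative_bound[OF assms, of "[]"] f_derivative_bound[OF assms, of "[b]"]
    f_derivative_bound[OF assms, of "[b', b]"]
  by (auto simp: dirs_le_def iter_partial_def)

lemma satisfies_pogorelov_data:
  assumes p: "1 \<le> p" "p < CARD('n)" "CARD('n) \<le> 2 * p" and R: "\<And>x. x \<in> U \<Longrightarrow> norm x \<le> R" "R \<ge> 0"
    and m0: "m0 > 0" and K: "K = \<bar>Ku\<bar> + \<bar>Kv\<bar>" and F: "F = \<bar>Kf\<bar> + 1"
  shows "\<exists>B. pogorelov_data U p u v f R K F m0 B"
proof -
  obtain B where B: "\<And>x \<xi>. x \<in> U \<Longrightarrow> norm \<xi> = 1 \<Longrightarrow> \<bar>\<xi> \<bullet> (hessian u x *v \<xi>)\<bar> \<le> B"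
    using C11_hessian_bounded[OF U(1) u(2) u_smooth(2)] by blast
  have "pogorelov_data U p u v f R K F m0 B"
  proof
    fix x assume x: "x \<in> U"
    show "p_positive CARD('n) p (\<lambda>i. eigvals (hessian u x) ! i)"
      using f(2)[of x] closure_subset x by (intro p_psh_product_positive[OF u(3) x]) (auto simp: eq)
    show "0 \<le> (\<Sum>i\<in>I. eigvals (hessian v x) ! i)" if "I \<in> index_sets CARD('n) p" for I
      using v(2) x that unfolding p_psh_on_def by blast
    show "v x - u x > 0" using lt[OF x] by simp
    show "v x - u x \<le> K" "norm (grad u x) + norm (grad v x) \<le> K"
      using value_gradient_bounds[OF x] norms(1,2) unfolding K by linarith+
    show "f (x, u x, grad u x) \<le> F" using f_bounds(1)[OF x] unfolding F by linarith
    fix b :: "(real^'n) \<times> real \<times> (real^'n)" assume b: "b \<in> Basis"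
    show "\<bar>pd b f (x, u x, grad u x)\<bar> \<le> F"
      using f_bounds(2)[OF x b] unfolding F by linarith
    fix b' :: "(real^'n) \<times> real \<times> (real^'n)" assume b': "b' \<in> Basis"
    show "\<bar>pd b' (pd b f) (x, u x, grad u x)\<bar> \<le> F"
      using f_bounds(3)[OF x b b'] unfolding F by linarith
  next
    show "continuous_on (closure U) (\<lambda>x. v x - u x)"
      using Ck_closure_1 unfolding Ck_closure_def by (intro continuous_on_diff) auto
  qed (use U R p u_smooth v_smooth bd B f_smooth eq f_lower m0 F in auto)
  then show ?thesis ..
qed

end

theorem theorem1p3:
  fixes \<Omega> :: "(real^'n) set" and p :: nat
  assumes "1 \<le> p" and "p \<le> CARD('n)" and "real p \<ge> real CARD('n) / 2"
    and "open \<Omega>" and "connected \<Omega>" and "\<Omega> \<noteq> {}" and "bounded \<Omega>"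
  shows "\<forall>K\<^sub>u K\<^sub>v m K\<^sub>f :: real. m > 0 \<longrightarrow>
    (\<exists>C \<beta> :: real. \<forall>(u :: real^'n \<Rightarrow> real) (v :: real^'n \<Rightarrow> real)
        (f :: (real^'n) \<times> real \<times> (real^'n) \<Rightarrow> real).
      Ck_closure 2 \<Omega> v \<and> p_psh_on p \<Omega> v \<and>
      Ck_closure 2 (\<Omega> \<times> UNIV \<times> UNIV) f \<and>
      (\<forall>x\<in>closure \<Omega>. \<forall>z q. f (x, z, q) > 0) \<and>
      Ck_on 4 \<Omega> u \<and> C11_closure \<Omega> u \<and> p_psh_on p \<Omega> u \<and>
      (\<forall>x\<in>\<Omega>. p_sum_prod p (hessian u x) = f (x, u x, grad u x)) \<and>
      (\<forall>x\<in>frontier \<Omega>. u x = v x) \<and>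
      (\<forall>x\<in>\<Omega>. u x < v x) \<and>
      Ck_norm 1 \<Omega> u \<le> K\<^sub>u \<and> Ck_norm 1 \<Omega> v \<le> K\<^sub>v \<and>
      m \<le> (INF y\<in>jet_range (closure \<Omega>) (Ck_norm 1 \<Omega> u). f y) \<and>
      Ck_norm 2 (jet_range \<Omega> (Ck_norm 1 \<Omega> u)) f \<le> K\<^sub>f
      \<longrightarrow> (SUP x\<in>\<Omega>. ereal ((v x - u x) powr \<beta> * laplacian u x)) \<le> ereal C)"
proof (intro allI impI)
  fix Ku Kv m Kf :: real assume m: "m > 0"
  have main: "\<exists>C \<beta>. \<forall>u v f. dirichlet_solution \<Omega> p u v f Ku Kv m Kf \<longrightarrow>
     (\<forall>x\<in>\<Omega>. (v x - u x) powr \<beta> * laplacian u x \<le> C)"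
  proof (cases "p = CARD('n)")
    case True
    \<comment> \<open>The Laplacian is bounded without any weight.\<close>
    have "(v x - u x) powr 0 * laplacian u x \<le> Kf"
      if s: "dirichlet_solution \<Omega> p u v f Ku Kv m Kf" and x: "x \<in> \<Omega>" for u v f x
    proof -
      interpret dirichlet_solution \<Omega> p u v f Ku Kv m Kf by (rule s)
      have "laplacian u x = f (x, u x, grad u x)"
        using laplacian_eq_full_sum[OF U(1) x u_smooth(2)] eq[OF x] True by simp
      then show ?thesis using f_bounds(1)[OF x] lt[OF x] by simp
    qed
    then show ?thesis by blast
  next
    case False
    then have p: "1 \<le> p" "p < CARD('n)" "CARD('n) \<le> 2 * p" using assms(1-3) by auto
    obtain R where R: "\<And>x. x \<in> \<Omega> \<Longrightarrow> norm x \<le> R" "R \<ge> 0"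
      using assms(7) unfolding bounded_pos by (metis less_imp_le)
    define K F where "K = \<bar>Ku\<bar> + \<bar>Kv\<bar>" and "F = \<bar>Kf\<bar> + 1"
    define D k where "D = real DIM((real^'n) \<times> real \<times> (real^'n))" and "k = F * D / m"
    define C1 C2 where "C1 = linear_cost CARD('n) K k D" and "C2 = bounded_cost CARD('n) K k R"
    define A \<beta> where "A = 2 * (C1 + 1) * (1 + 2 ^ card (index_sets CARD('n) p) * F)"
      and "\<beta> = 9 + 12 * A * R\<^sup>2"
    define E c where "E = \<beta> * card (index_sets CARD('n) p) + C2 * (1 + \<beta> + A)
         + 4 * real CARD('n) * card (index_sets CARD('n) p) * (3 * A\<^sup>2 * R\<^sup>2 + 4 * \<beta>\<^sup>2 * K\<^sup>2)"
      and "c = K\<^sup>2 / 2 + 1"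
    define M where "M = 1 + 2 * E + (C1 * F + E * F + E) / (1 / (3 * c) / (16 * real CARD('n) ^ 3))"
    define T where "T = M * (K powr \<beta> + K powr (\<beta> - 1)) * exp (A * R\<^sup>2 / 2 + ln c / 3)"
    have "(v x - u x) powr \<beta> * laplacian u x \<le> CARD('n) * T"
      if s: "dirichlet_solution \<Omega> p u v f Ku Kv m Kf" and x: "x \<in> \<Omega>" for u v f x
    proof -
      interpret dirichlet_solution \<Omega> p u v f Ku Kv m Kf by (rule s)
      obtain B where "pogorelov_data \<Omega> p u v f R K F m B"
        using satisfies_pogorelov_data[OF p R m K_def F_def] by blast
      then interpret pogorelov_data \<Omega> p u v f R K F m B .
      interpret pogorelov_constants \<Omega> p u v f R K F m B D k C1 C2 A \<beta> E c M
        by unfold_locales (fact D_def k_def C1_def C2_def A_def \<beta>_def E_def c_def M_def)+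
      have "(v x - u x) powr \<beta> * laplacian u x
          = (\<Sum>i\<in>UNIV. (v x - u x) powr \<beta> * (axis i 1 \<bullet> (hessian u x *v axis i 1)))"
        unfolding laplacian_def trace_axis by (rule sum_distrib_left)
      also have "\<dots> \<le> (\<Sum>i\<in>(UNIV :: 'n set). T)"
        unfolding T_def
        by (intro sum_mono hessian_estimate[OF x]) simp
      finally show ?thesis by simp
    qed
    then show ?thesis by blast
  qed
  then obtain C \<beta> where C: "\<And>u v f x. dirichlet_solution \<Omega> p u v f Ku Kv m Kf \<Longrightarrow> x \<in> \<Omega> \<Longrightarrow>
     (v x - u x) powr \<beta> * laplacian u x \<le> C" by blast
  show "\<exists>C \<beta> :: real. \<forall>(u :: real^'n \<Rightarrow> real) (v :: real^'n \<Rightarrow> real)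
        (f :: (real^'n) \<times> real \<times> (real^'n) \<Rightarrow> real).
      Ck_closure 2 \<Omega> v \<and> p_psh_on p \<Omega> v \<and>
      Ck_closure 2 (\<Omega> \<times> UNIV \<times> UNIV) f \<and>
      (\<forall>x\<in>closure \<Omega>. \<forall>z q. f (x, z, q) > 0) \<and>
      Ck_on 4 \<Omega> u \<and> C11_closure \<Omega> u \<and> p_psh_on p \<Omega> u \<and>
      (\<forall>x\<in>\<Omega>. p_sum_prod p (hessian u x) = f (x, u x, grad u x)) \<and>
      (\<forall>x\<in>frontier \<Omega>. u x = v x) \<and>
      (\<forall>x\<in>\<Omega>. u x < v x) \<and>
      Ck_norm 1 \<Omega> u \<le> Ku \<and> Ck_norm 1 \<Omega> v \<le> Kv \<and>
      m \<le> (INF y\<in>jet_range (closure \<Omega>) (Ck_norm 1 \<Omega> u). f y) \<and>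
      Ck_norm 2 (jet_range \<Omega> (Ck_norm 1 \<Omega> u)) f \<le> Kf
      \<longrightarrow> (SUP x\<in>\<Omega>. ereal ((v x - u x) powr \<beta> * laplacian u x)) \<le> ereal C"
  proof (rule exI[of _ C], rule exI[of _ \<beta>], intro allI impI, elim conjE)
    fix u v f
    assume "Ck_closure 2 \<Omega> v" "p_psh_on p \<Omega> v" "Ck_closure 2 (\<Omega> \<times> UNIV \<times> UNIV) f"
      "\<forall>x\<in>closure \<Omega>. \<forall>z q. f (x, z, q) > 0" "Ck_on 4 \<Omega> u" "C11_closure \<Omega> u" "p_psh_on p \<Omega> u"
      "\<forall>x\<in>\<Omega>. p_sum_prod p (hessian u x) = f (x, u x, grad u x)"
      "\<forall>x\<in>frontier \<Omega>. u x = v x" "\<forall>x\<in>\<Omega>. u x < v x"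
      "Ck_norm 1 \<Omega> u \<le> Ku" "Ck_norm 1 \<Omega> v \<le> Kv"
      "m \<le> (INF y\<in>jet_range (closure \<Omega>) (Ck_norm 1 \<Omega> u). f y)"
      "Ck_norm 2 (jet_range \<Omega> (Ck_norm 1 \<Omega> u)) f \<le> Kf"
    then have "dirichlet_solution \<Omega> p u v f Ku Kv m Kf"
      using assms(4,6,7) by unfold_locales blast+
    then show "(SUP x\<in>\<Omega>. ereal ((v x - u x) powr \<beta> * laplacian u x)) \<le> ereal C"
      by (intro SUP_least) (simp add: C)
  qed
qed

end
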